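(* Let $m:\mathbb{R}^{2d}\to\mathbb{C}$ be a Riemann-integrable function in $W(L^\infty,\ell^1)(\mathbb{R}^{2d})$ and let $S$ be a trace-class operator on $L^2(\mathbb{R}^d)$. Then $$\big\|\mu^m_{\alpha,\beta}\star S-m\star S\big\|_{\mathcal{S}^1}\to 0\quad\text{as }\alpha,\beta\to 0 .$$
   Context: For $z=(x,\omega)\in\mathbb{R}^{2d}$, $\pi(z)\psi(t)=e^{2\pi i\omega\cdot t}\psi(t-x)$ on $L^2(\mathbb{R}^d)$. $\mathcal{S}^1$ is the space of trace-class operators with trace norm. For $\alpha,\beta>0$ let $\Lambda_{\alpha,\beta}=\alpha\mathbb{Z}^d\times\beta\mathbb{Z}^d\subset\mathbb{R}^{2d}$ and $$\mu^m_{\alpha,\beta}=\alpha^d\beta^d\sum_{\lambda\in\Lambda_{\alpha,\beta}}m(\lambda)\delta_\lambda .$$ For a bounded complex measure $\mu$ on $\mathbb{R}^{2d}$, $\mu\star S$ is the operator given weakly by $\langle(\mu\star S)\psi,\phi\rangle=\int_{\mathbb{R}^{2d}}\langle\pi(z)S\pi(z)^*\psi,\phi\rangle\,d\mu(z)$; for $m\in L^1(\mathbb{R}^{2d})$, $m\star S$ is $\mu\star S$ with $d\mu=m\,dz$. $W(L^\infty,\ell^1)(\mathbb{R}^{2d})$ is the Wiener amalgam space of functions with $\|m\|_{W(L^\infty,\ell^1)}=\sum_{n\in\mathbb{Z}^{2d}}\sup_{z\in n+[0,1)^{2d}}|m(z)|<\infty$ (other bounded uniform partitions of unity give equivalent norms).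 Riemann-integrability of $m$ on $\mathbb{R}^{2d}$ is understood as Riemann-integrability on every compact box. The limit is along pairs $\alpha,\beta>0$ tending to $0$. *)

theory Defs
  imports "HOL-Analysis.Analysis"
begin

section \<open>The Hilbert space of square-integrable functions\<close>

definition square_integrable :: "(real^'n \<Rightarrow> complex) \<Rightarrow> bool" where
  "square_integrable f \<longleftrightarrow>
     f \<in> borel_measurable borel \<and> integrable lborel (\<lambda>t. (norm (f t))\<^sup>2)"

definition L2_rel :: "(real^'n \<Rightarrow> complex) \<Rightarrow> (real^'n \<Rightarrow> complex) \<Rightarrow> bool" where
  "L2_rel f g \<longleftrightarrow> square_integrable f \<and> square_integrable g \<and> (AE t in lborel. f t = g t)"

lemma square_integrable_zero: "square_integrable (\<lambda>_. 0)"
  by (simp add: square_integrable_def)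

lemma part_equivp_L2_rel: "part_equivp (L2_rel :: (real^'n \<Rightarrow> complex) \<Rightarrow> _)"
proof (rule part_equivpI)
  show "\<exists>f :: real^'n \<Rightarrow> complex. L2_rel f f"
    using square_integrable_zero by (auto simp: L2_rel_def)
  show "symp (L2_rel :: (real^'n \<Rightarrow> complex) \<Rightarrow> _)"
    by (auto simp: symp_def L2_rel_def)
  show "transp (L2_rel :: (real^'n \<Rightarrow> complex) \<Rightarrow> _)"
  proof (rule transpI)
    fix x y z :: "real^'n \<Rightarrow> complex"
    assume xy: "L2_rel x y" and yz: "L2_rel y z"
    then have "AE t in lborel. x t = y t" "AE t in lborel. y t = z t"
      by (auto simp: L2_rel_def)
    then have "AE t in lborel. x t = z t" by eventually_elim simp
    then show "L2_rel x z" using xy yz by (simp add: L2_rel_def)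
  qed
qed

quotient_type (overloaded) 'n L2 = "real^'n \<Rightarrow> complex" / partial: L2_rel
  by (rule part_equivp_L2_rel)

text \<open>Almost everywhere equal functions are identified; \<^typ>\<open>'n L2\<close> is $L^2(\mathbb{R}^d)$
  with $d$ the cardinality of \<^typ>\<open>'n\<close>.\<close>

lemma square_integrable_mult:
  fixes f g :: "real^'n \<Rightarrow> complex"
  assumes "square_integrable f" "square_integrable g"
  shows "integrable lborel (\<lambda>t. f t * cnj (g t))"
proof (rule Bochner_Integration.integrable_bound)
  show "integrable lborel (\<lambda>t. (norm (f t))\<^sup>2 + (norm (g t))\<^sup>2)"
    using assms by (auto simp: square_integrable_def)
  show "(\<lambda>t. f t * cnj (g t)) \<in> borel_measurable lborel"
    using assms by (auto simp: square_integrable_def intro!: borel_measurable_times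
      borel_measurable_continuous_on[of cnj] continuous_intros)
  have "a * b \<le> a\<^sup>2 + b\<^sup>2" if "a \<ge> 0" "b \<ge> 0" for a b :: real
    using that sum_squares_bound[of a b] mult_nonneg_nonneg[of a b] by linarith
  then show "AE t in lborel. norm (f t * cnj (g t)) \<le> norm ((norm (f t))\<^sup>2 + (norm (g t))\<^sup>2)"
    by (intro AE_I2) (simp add: norm_mult)
qed

lemma square_integrable_add:
  fixes f g :: "real^'n \<Rightarrow> complex"
  assumes "square_integrable f" "square_integrable g"
  shows "square_integrable (\<lambda>t. f t + g t)"
  unfolding square_integrable_def
proof
  show m: "(\<lambda>t. f t + g t) \<in> borel_measurable borel"
    using assms by (auto simp: square_integrable_def)
  show "integrable lborel (\<lambda>t. (norm (f t + g t))\<^sup>2)"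
  proof (rule Bochner_Integration.integrable_bound)
    show "integrable lborel (\<lambda>t. 2 * (norm (f t))\<^sup>2 + 2 * (norm (g t))\<^sup>2)"
      using assms by (auto simp: square_integrable_def)
    show "(\<lambda>t. (norm (f t + g t))\<^sup>2) \<in> borel_measurable lborel"
      using m by simp
    have "(norm (a + b))\<^sup>2 \<le> 2 * (norm a)\<^sup>2 + 2 * (norm b)\<^sup>2" for a b :: complex
    proof -
      have "(norm (a + b))\<^sup>2 \<le> (norm a + norm b)\<^sup>2"
        by (intro power_mono norm_triangle_ineq) auto
      also have "\<dots> \<le> 2 * (norm a)\<^sup>2 + 2 * (norm b)\<^sup>2"
        using sum_squares_bound[of "norm a" "norm b"] by (simp add: power2_sum)
      finally show ?thesis .
    qed
    then show "AE t in lborel. norm ((norm (f t + g t))\<^sup>2)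
        \<le> norm (2 * (norm (f t))\<^sup>2 + 2 * (norm (g t))\<^sup>2)"
      by (intro AE_I2) simp
  qed
qed

lemma square_integrable_scale:
  "square_integrable f \<Longrightarrow> square_integrable (\<lambda>t. c * f t)"
  by (auto simp: square_integrable_def norm_mult power_mult_distrib)

lemma square_integrable_shift:
  fixes f :: "real^'n \<Rightarrow> complex"
  assumes "square_integrable f"
  shows "square_integrable (\<lambda>t. exp (2 * of_real pi * \<i> * of_real (w \<bullet> t)) * f (t - x))"
  unfolding square_integrable_def
proof
  have f: "f \<in> borel_measurable borel" "integrable lborel (\<lambda>t. (norm (f t))\<^sup>2)"
    using assms by (auto simp: square_integrable_def)
  have "(\<lambda>t. t - x) \<in> borel_measurable borel" by simp
  then have "(\<lambda>t. f (t - x)) \<in> borel_measurable borel"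
    using f(1) by (rule measurable_compose)
  moreover have "(\<lambda>t::real^'n. exp (2 * of_real pi * \<i> * of_real (w \<bullet> t))) \<in> borel_measurable borel"
    by (intro borel_measurable_continuous_onI continuous_intros)
  ultimately show "(\<lambda>t. exp (2 * of_real pi * \<i> * of_real (w \<bullet> t)) * f (t - x)) \<in> borel_measurable borel"
    by (rule borel_measurable_times[rotated])
  have "integrable (distr lborel borel ((+) (-x))) (\<lambda>t. (norm (f t))\<^sup>2)"
    using f(2) lborel_distr_plus[of "-x"] by simp
  then have "integrable lborel (\<lambda>t. (norm (f (- x + t)))\<^sup>2)"
    using f(1) by (subst (asm) integrable_distr_eq) auto
  moreover have "norm (exp (2 * complex_of_real pi * \<i> * complex_of_real (w \<bullet> t))) = 1" for t
    by (simp add: norm_exp_eq_Re)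
  ultimately show "integrable lborel
      (\<lambda>t. (norm (exp (2 * of_real pi * \<i> * of_real (w \<bullet> t)) * f (t - x)))\<^sup>2)"
    by (simp add: norm_mult)
qed

lemma AE_lborel_shift:
  fixes x :: "'a :: euclidean_space"
  assumes "AE t in lborel. P t"
  shows "AE t in lborel. P (t - x)"
proof -
  have "AE t in distr lborel borel ((+) (-x)). P t"
    by (subst lborel_distr_plus) (rule assms)
  then have "AE t in lborel. P (- x + t)"
    by (rule AE_distrD[rotated]) simp
  then show ?thesis by simp
qed

lift_definition cinner :: "('n :: finite) L2 \<Rightarrow> 'n L2 \<Rightarrow> complex"
  is "\<lambda>f g. LINT t|lborel. f t * cnj (g t)"
proof -
  fix f f' g g' :: "real^'n \<Rightarrow> complex"
  assume A: "L2_rel f f'" "L2_rel g g'"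
  then have "AE t in lborel. f t = f' t" "AE t in lborel. g t = g' t"
    by (auto simp: L2_rel_def)
  then have "AE t in lborel. f t * cnj (g t) = f' t * cnj (g' t)"
    by eventually_elim simp
  then show "(LINT t|lborel. f t * cnj (g t)) = (LINT t|lborel. f' t * cnj (g' t))"
    using A by (intro integral_cong_AE borel_measurable_integrable[OF square_integrable_mult])
      (auto simp: L2_rel_def)
qed

lift_definition cscale :: "complex \<Rightarrow> ('n :: finite) L2 \<Rightarrow> 'n L2"
  is "\<lambda>c f t. c * f t"
  by (auto simp: L2_rel_def square_integrable_scale)

instantiation L2 :: (finite) real_vector
begin

lift_definition zero_L2 :: "'a L2" is "\<lambda>_. 0"
  by (simp add: L2_rel_def square_integrable_zero)

lift_definition plus_L2 :: "'a L2 \<Rightarrow> 'a L2 \<Rightarrow> 'a L2" is "\<lambda>f g t. f t + g t"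
  by (auto simp: L2_rel_def square_integrable_add)

lift_definition uminus_L2 :: "'a L2 \<Rightarrow> 'a L2" is "\<lambda>f t. - f t"
  by (auto simp: L2_rel_def square_integrable_def)

definition minus_L2 :: "'a L2 \<Rightarrow> 'a L2 \<Rightarrow> 'a L2" where
  "minus_L2 x y = x + - y"

definition scaleR_L2 :: "real \<Rightarrow> 'a L2 \<Rightarrow> 'a L2" where
  "scaleR_L2 r = cscale (of_real r)"

lemma L2_vector_axioms:
  fixes x y z :: "'a L2"
  shows "x + y + z = x + (y + z)" "x + y = y + x" "0 + x = x" "- x + x = 0"
    "cscale c (x + y) = cscale c x + cscale c y"
    "cscale (c + d) x = cscale c x + cscale d x"
    "cscale c (cscale d x) = cscale (c * d) x" "cscale 1 x = x"
  by (transfer; auto simp: L2_rel_def square_integrable_add square_integrable_scale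
    square_integrable_zero algebra_simps)+

instance
  by intro_classes
    (rule L2_vector_axioms(1-4) | simp add: L2_vector_axioms(5-8) minus_L2_def scaleR_L2_def)+

end

lemma cinner_commute: "cinner x y = cnj (cinner y x)"
  by transfer (simp add: mult.commute flip: Bochner_Integration.integral_cnj)

lemma cinner_add_left: "cinner (x + y) z = cinner x z + cinner y z"
proof transfer
  fix x y z :: "real^'a \<Rightarrow> complex"
  assume "L2_rel x x" "L2_rel y y" "L2_rel z z"
  then have "integrable lborel (\<lambda>t. x t * cnj (z t))" "integrable lborel (\<lambda>t. y t * cnj (z t))"
    by (auto simp: L2_rel_def square_integrable_mult)
  then show "(LINT t|lborel. (x t + y t) * cnj (z t))
      = (LINT t|lborel. x t * cnj (z t)) + (LINT t|lborel. y t * cnj (z t))"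
    by (simp add: distrib_right)
qed

lemma cinner_cscale_left: "cinner (cscale c x) y = c * cinner x y"
  by transfer (simp add: mult.assoc)

lemma integral_mult_cnj:
  "(LINT t|M. f t * cnj (f t)) = complex_of_real (LINT t|M. (norm (f t))\<^sup>2)"
  unfolding complex_norm_square[symmetric] by (rule integral_complex_of_real)

lemma cinner_self: "Im (cinner x x) = 0" "0 \<le> Re (cinner x x)"
proof -
  show "Im (cinner x x) = 0"
    by transfer (simp add: integral_mult_cnj)
  show "0 \<le> Re (cinner x x)"
    by transfer (simp add: integral_mult_cnj)
qed

lemma cinner_self_eq_0: "Re (cinner x x) = 0 \<longleftrightarrow> x = 0"
proof transfer
  fix f :: "real^'a \<Rightarrow> complex"
  assume f: "L2_rel f f"
  then have i: "integrable lborel (\<lambda>t. (norm (f t))\<^sup>2)"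
    by (simp add: L2_rel_def square_integrable_def)
  have "(LINT t|lborel. (norm (f t))\<^sup>2) = 0 \<longleftrightarrow> (AE t in lborel. f t = 0)"
    using integral_nonneg_eq_0_iff_AE[OF i] by simp
  then show "Re (LINT t|lborel. f t * cnj (f t)) = 0 \<longleftrightarrow> L2_rel f (\<lambda>_. 0)"
    using f by (simp add: integral_mult_cnj L2_rel_def square_integrable_zero)
qed

instantiation L2 :: (finite) real_inner
begin

definition inner_L2 :: "'a L2 \<Rightarrow> 'a L2 \<Rightarrow> real" where
  "inner_L2 x y = Re (cinner x y)"

definition norm_L2 :: "'a L2 \<Rightarrow> real" where
  "norm_L2 x = sqrt (x \<bullet> x)"

definition sgn_L2 :: "'a L2 \<Rightarrow> 'a L2" where
  "sgn_L2 x = x /\<^sub>R norm x"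

definition dist_L2 :: "'a L2 \<Rightarrow> 'a L2 \<Rightarrow> real" where
  "dist_L2 x y = norm (x - y)"

definition uniformity_L2 :: "('a L2 \<times> 'a L2) filter" where
  "uniformity_L2 = (INF e\<in>{0<..}. principal {(x, y). dist x y < e})"

definition open_L2 :: "'a L2 set \<Rightarrow> bool" where
  "open_L2 U \<longleftrightarrow> (\<forall>x\<in>U. \<forall>\<^sub>F (x', y) in uniformity. x' = x \<longrightarrow> y \<in> U)"

instance
proof
  fix x y z :: "'a L2" and r :: real and U :: "'a L2 set"
  show "x \<bullet> y = y \<bullet> x"
    using cinner_commute[of x y] by (simp add: inner_L2_def)
  show "(x + y) \<bullet> z = x \<bullet> z + y \<bullet> z"
    by (simp add: inner_L2_def cinner_add_left)
  show "(r *\<^sub>R x) \<bullet> y = r * (x \<bullet> y)"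
    by (simp add: inner_L2_def scaleR_L2_def cinner_cscale_left)
  show "0 \<le> x \<bullet> x"
    by (simp add: inner_L2_def cinner_self)
  show "x \<bullet> x = 0 \<longleftrightarrow> x = 0"
    by (simp add: inner_L2_def cinner_self_eq_0)
  show "norm x = sqrt (x \<bullet> x)" by (rule norm_L2_def)
  show "sgn x = x /\<^sub>R norm x" by (rule sgn_L2_def)
  show "dist x y = norm (x - y)" by (rule dist_L2_def)
  show "uniformity = (INF e\<in>{0<..}. principal {(x :: 'a L2, y). dist x y < e})"
    by (rule uniformity_L2_def)
  show "open U \<longleftrightarrow> (\<forall>x\<in>U. \<forall>\<^sub>F (x', y) in uniformity. x' = x \<longrightarrow> y \<in> U)"
    by (rule open_L2_def)
qed

end


section \<open>Trace-class operators\<close>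

definition bounded_op :: "(('n :: finite) L2 \<Rightarrow> 'n L2) \<Rightarrow> bool" where
  "bounded_op T \<longleftrightarrow> bounded_linear T \<and> (\<forall>c x. T (cscale c x) = cscale c (T x))"

definition adj :: "(('n :: finite) L2 \<Rightarrow> 'n L2) \<Rightarrow> ('n L2 \<Rightarrow> 'n L2)" where
  "adj T = (THE B. bounded_op B \<and> (\<forall>x y. cinner (T x) y = cinner x (B y)))"

definition positive_op :: "(('n :: finite) L2 \<Rightarrow> 'n L2) \<Rightarrow> bool" where
  "positive_op A \<longleftrightarrow> bounded_op A \<and> (\<forall>x. Im (cinner (A x) x) = 0 \<and> 0 \<le> Re (cinner (A x) x))"

text \<open>$|T| = (T^*T)^{1/2}$, the positive square root.\<close>

definition abs_op :: "(('n :: finite) L2 \<Rightarrow> 'n L2) \<Rightarrow> ('n L2 \<Rightarrow> 'n L2)" where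
  "abs_op T = (THE A. positive_op A \<and> A \<circ> A = adj T \<circ> T)"

definition orthonormal_basis :: "('n :: finite) L2 set \<Rightarrow> bool" where
  "orthonormal_basis B \<longleftrightarrow>
     (\<forall>e\<in>B. \<forall>e'\<in>B. cinner e e' = (if e = e' then 1 else 0)) \<and>
     (\<forall>x. (\<forall>e\<in>B. cinner x e = 0) \<longrightarrow> x = 0)"

text \<open>$\mathrm{tr}\,|T|$, which does not depend on the orthonormal basis; the value is
  $\infty$ outside the trace class.\<close>

definition trace_norm :: "(('n :: finite) L2 \<Rightarrow> 'n L2) \<Rightarrow> ennreal" where
  "trace_norm T =
     (if bounded_op T
      then (\<Sum>\<^sub>\<infinity>e\<in>(SOME B. orthonormal_basis B). ennreal (Re (cinner (abs_op T e) e)))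
      else \<infinity>)"

definition trace_class :: "(('n :: finite) L2 \<Rightarrow> 'n L2) \<Rightarrow> bool" where
  "trace_class T \<longleftrightarrow> bounded_op T \<and> trace_norm T < \<infinity>"


section \<open>Complex measures\<close>

text \<open>A complex Borel measure is a set function $\mu$. It can always be written as
  $d\mu = h\,d\nu$ with $\nu$ positive and $h \in L^1(\nu)$, and then
  $\int f\,d\mu = \int f h\,d\nu$ does not depend on the choice of $(\nu, h)$ for bounded
  Borel functions $f$. The $\sigma$-algebra of $\nu$ may be larger than the Borel one.\<close>

definition has_density ::
    "('a :: topological_space set \<Rightarrow> complex) \<Rightarrow> 'a measure \<Rightarrow> ('a \<Rightarrow> complex) \<Rightarrow> bool" where
  "has_density \<mu> \<nu> h \<longleftrightarrow> space \<nu> = UNIV \<and> sets borel \<subseteq> sets \<nu> \<and> integrable \<nu> h \<and>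
     (\<forall>A\<in>sets borel. \<mu> A = (LINT z:A|\<nu>. h z))"

definition cm_integral ::
    "('a :: topological_space set \<Rightarrow> complex) \<Rightarrow> ('a \<Rightarrow> complex) \<Rightarrow> complex" where
  "cm_integral \<mu> f = (THE I. \<exists>\<nu> h. has_density \<mu> \<nu> h \<and> I = (LINT z|\<nu>. f z * h z))"

lemma has_density_integral_limit:
  fixes f :: "'a :: topological_space \<Rightarrow> complex"
  assumes d: "has_density \<mu> \<nu> h"
    and s: "\<And>i. simple_function borel (s i)" "\<And>x. (\<lambda>i. s i x) \<longlonglongrightarrow> f x"
      "\<And>i x. norm (s i x) \<le> K"
    and f: "f \<in> borel_measurable borel"
  shows "(\<lambda>i. \<Sum>y\<in>range (s i). y * \<mu> (s i -` {y})) \<longlonglongrightarrow> (LINT z|\<nu>. f z * h z)"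
proof -
  have \<nu>: "space \<nu> = UNIV" "sets borel \<subseteq> sets \<nu>" and h: "integrable \<nu> h"
    and \<mu>: "\<And>A. A \<in> sets borel \<Longrightarrow> \<mu> A = (LINT z:A|\<nu>. h z)"
    using d by (auto simp: has_density_def)
  have meas: "g \<in> borel_measurable \<nu>" if "g \<in> borel_measurable borel" for g :: "'a \<Rightarrow> complex"
    using that \<nu> by (auto simp: measurable_def)
  have eq: "(LINT z|\<nu>. s i z * h z) = (\<Sum>y\<in>range (s i). y * \<mu> (s i -` {y}))" for i
  proof -
    have fin: "finite (range (s i))" and v: "s i -` {y} \<in> sets borel" for y
      using s(1)[of i] simple_functionD(2)[OF s(1)[of i], of "{y}"]
      by (auto simp: simple_function_def)
    have int: "set_integrable \<nu> (s i -` {y}) h" for y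
      using v[of y] \<nu> h unfolding set_integrable_def
      by (intro integrable_mult_indicator) auto
    have "s i z * h z = (\<Sum>y\<in>range (s i). y * (indicator (s i -` {y}) z *\<^sub>R h z))" for z
    proof -
      have "(\<Sum>y\<in>range (s i). y * (indicator (s i -` {y}) z *\<^sub>R h z))
          = (\<Sum>y\<in>range (s i). if y = s i z then s i z * h z else 0)"
        by (intro sum.cong) (auto simp: indicator_def)
      then show ?thesis using fin by simp
    qed
    then have "(LINT z|\<nu>. s i z * h z)
        = (LINT z|\<nu>. (\<Sum>y\<in>range (s i). y * (indicator (s i -` {y}) z *\<^sub>R h z)))"
      by (intro Bochner_Integration.integral_cong) auto
    also have "\<dots> = (\<Sum>y\<in>range (s i). LINT z|\<nu>. y * (indicator (s i -` {y}) z *\<^sub>R h z))"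
      using int unfolding set_integrable_def
      by (intro Bochner_Integration.integral_sum integrable_mult_right)
    also have "\<dots> = (\<Sum>y\<in>range (s i). y * \<mu> (s i -` {y}))"
      by (simp only: \<mu>[OF v] set_lebesgue_integral_def integral_mult_right_zero)
    finally show ?thesis .
  qed
  have "(\<lambda>i. LINT z|\<nu>. s i z * h z) \<longlonglongrightarrow> (LINT z|\<nu>. f z * h z)"
  proof (rule integral_dominated_convergence)
    show "(\<lambda>z. f z * h z) \<in> borel_measurable \<nu>"
      using h meas[OF f] by (intro borel_measurable_times) auto
    show "(\<lambda>z. s i z * h z) \<in> borel_measurable \<nu>" for i
      using h meas[OF borel_measurable_simple_function[OF s(1)]]
      by (intro borel_measurable_times) auto
    show "integrable \<nu> (\<lambda>z. K * norm (h z))"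
      using h by simp
    show "AE z in \<nu>. (\<lambda>i. s i z * h z) \<longlonglongrightarrow> f z * h z"
      using s(2) by (intro AE_I2 tendsto_intros)
    show "AE z in \<nu>. norm (s i z * h z) \<le> K * norm (h z)" for i
      using s(3) by (intro AE_I2) (auto simp: norm_mult intro!: mult_right_mono)
  qed
  then show ?thesis by (simp add: eq)
qed

lemma cm_integral_eq:
  fixes f :: "'a :: topological_space \<Rightarrow> complex"
  assumes d: "has_density \<mu> \<nu> h"
    and f: "f \<in> borel_measurable borel" and K: "\<And>x. norm (f x) \<le> K"
  shows "cm_integral \<mu> f = (LINT z|\<nu>. f z * h z)"
proof -
  obtain s where s: "\<And>i. simple_function borel (s i)" "\<And>x. (\<lambda>i. s i x) \<longlonglongrightarrow> f x"
      and s2: "\<And>i x. norm (s i x) \<le> 2 * norm (f x)"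
    using borel_measurable_implies_sequence_metric[OF f, of 0] by (auto simp: dist_norm)
  have s3: "norm (s i x) \<le> 2 * K" for i x
    using s2[of i x] K[of x] by linarith
  show ?thesis
    unfolding cm_integral_def
  proof (rule the_equality)
    show "\<exists>\<nu>' h'. has_density \<mu> \<nu>' h' \<and> (LINT z|\<nu>. f z * h z) = (LINT z|\<nu>'. f z * h' z)"
      using d by blast
    fix I
    assume "\<exists>\<nu>' h'. has_density \<mu> \<nu>' h' \<and> I = (LINT z|\<nu>'. f z * h' z)"
    then obtain \<nu>' h' where d': "has_density \<mu> \<nu>' h'" and I: "I = (LINT z|\<nu>'. f z * h' z)"
      by blast
    show "I = (LINT z|\<nu>. f z * h z)"
      unfolding I using has_density_integral_limit[OF d' s s3 f]
        has_density_integral_limit[OF d s s3 f] by (rule LIMSEQ_unique)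
  qed
qed


section \<open>Time-frequency shifts and convolution with operators\<close>

type_synonym 'n phase_space = "(real^'n) \<times> (real^'n)"

lift_definition tf_shift :: "('n :: finite) phase_space \<Rightarrow> 'n L2 \<Rightarrow> 'n L2"
  is "\<lambda>(x, w) f t. exp (2 * of_real pi * \<i> * of_real (w \<bullet> t)) * f (t - x)"
proof -
  fix z :: "'n phase_space" and f g :: "real^'n \<Rightarrow> complex"
  obtain x w where z: "z = (x, w)" by fastforce
  assume fg: "L2_rel f g"
  then have "AE t in lborel. f (t - x) = g (t - x)"
    by (intro AE_lborel_shift) (simp add: L2_rel_def)
  then show "L2_rel ((\<lambda>(x, w) f t. exp (2 * of_real pi * \<i> * of_real (w \<bullet> t)) * f (t - x)) z f)
      ((\<lambda>(x, w) f t. exp (2 * of_real pi * \<i> * of_real (w \<bullet> t)) * f (t - x)) z g)"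
    using fg unfolding z L2_rel_def by (auto intro: square_integrable_shift)
qed

definition measure_star ::
    "(('n :: finite) phase_space set \<Rightarrow> complex) \<Rightarrow> ('n L2 \<Rightarrow> 'n L2) \<Rightarrow> ('n L2 \<Rightarrow> 'n L2)"
    (infixr "\<star>" 75) where
  "\<mu> \<star> S = (THE T. bounded_op T \<and> (\<forall>\<psi> \<phi>. cinner (T \<psi>) \<phi> =
     cm_integral \<mu> (\<lambda>z. cinner (tf_shift z (S (adj (tf_shift z) \<psi>))) \<phi>)))"

text \<open>The measure $m\,dz$. Lebesgue rather than Borel measurability of $m$ matters: a Riemann
  integrable function need not be Borel measurable.\<close>

definition density_measure :: "(('n :: finite) phase_space \<Rightarrow> complex) \<Rightarrow> ('n phase_space set \<Rightarrow> complex)"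
  where "density_measure m A = (LINT z:A|lebesgue. m z)"

definition lattice :: "real \<Rightarrow> real \<Rightarrow> ('n :: finite) phase_space set" where
  "lattice \<alpha> \<beta> = {(\<alpha> *\<^sub>R k, \<beta> *\<^sub>R l) | k l. (\<forall>i. k $ i \<in> \<int>) \<and> (\<forall>i. l $ i \<in> \<int>)}"

definition sampled_measure ::
    "(('n :: finite) phase_space \<Rightarrow> complex) \<Rightarrow> real \<Rightarrow> real \<Rightarrow> ('n phase_space set \<Rightarrow> complex)" where
  "sampled_measure m \<alpha> \<beta> A =
     of_real (\<alpha> ^ CARD('n) * \<beta> ^ CARD('n)) * (\<Sum>\<^sub>\<infinity>z\<in>lattice \<alpha> \<beta>. m z * indicator A z)"


section \<open>Function classes\<close>

definition amalgam_norm :: "(('n :: finite) phase_space \<Rightarrow> complex) \<Rightarrow> ennreal" where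
  "amalgam_norm m = (\<Sum>\<^sub>\<infinity>n\<in>lattice 1 1.
     SUP z\<in>{z. \<forall>b\<in>Basis. 0 \<le> (z - n) \<bullet> b \<and> (z - n) \<bullet> b < 1}. ennreal (norm (m z)))"

text \<open>As \<^const>\<open>has_integral\<close> on boxes, but with balls of constant radius as gauges, which turns
  the Henstock--Kurzweil integral into the Riemann integral.\<close>

definition riemann_integrable_on ::
    "('a :: euclidean_space \<Rightarrow> 'b :: real_normed_vector) \<Rightarrow> 'a \<Rightarrow> 'a \<Rightarrow> bool" where
  "riemann_integrable_on f a b \<longleftrightarrow> (\<exists>I. \<forall>e>0. \<exists>\<delta>>0. \<forall>p.
     p tagged_division_of (cbox a b) \<and> (\<lambda>x. ball x \<delta>) fine p \<longrightarrow>
     norm ((\<Sum>(x, k)\<in>p. measure lborel k *\<^sub>R f x) - I) < e)"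

definition riemann_integrable :: "('a :: euclidean_space \<Rightarrow> 'b :: real_normed_vector) \<Rightarrow> bool" where
  "riemann_integrable f \<longleftrightarrow> (\<forall>a b. riemann_integrable_on f a b)"

end

theory Submission
  imports Defs
begin

text \<open>Conjugating \<open>S\<close> by time-frequency shifts gives a map \<open>z \<mapsto> \<pi>(z) S \<pi>(z)*\<close> into the trace
  class. For trace-class \<open>S\<close> this map is bounded and continuous in trace norm, because \<open>S\<close> is a
  trace-norm limit of finite-rank operators and \<open>z \<mapsto> \<pi>(z) f\<close> is continuous for every \<open>f\<close>. The
  sampled operator is then a Riemann sum of \<open>m(z) \<pi>(z) S \<pi>(z)*\<close> over the cells of the lattice, and
  the amalgam norm supplies the domination at infinity.

  Riemann sums are written as integrals: let \<open>\<lambda>(z)\<close> be the lattice point whose half-open cell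
  contains \<open>z\<close> (\<open>lattice_floor\<close>). All cells have volume \<open>\<alpha>^d \<beta>^d\<close>, so the weighted lattice sum of
  \<open>g\<close> is the Lebesgue integral of \<open>g(\<lambda>(z))\<close> (\<open>integral_lattice_floor\<close>). With
  \<open>G(z) = \<Sum>e\<in>F. <\<pi>(z) S \<pi>(z)* e, U e>\<close> the trace-norm pairing of the difference of the two operators
  is \<open>\<integral> (m(\<lambda>(z)) G(\<lambda>(z)) - m(z) G(z)) dz\<close>, and its modulus is at most
  \<open>K \<integral> |m(\<lambda>(z)) - m(z)| dz + \<integral> |m(z)| |G(\<lambda>(z)) - G(z)| dz\<close>. Both integrals tend to 0 by dominated
  convergence: a Riemann integrable function is continuous almost everywhere
  (\<open>riemann_integrable_AE_isCont\<close>), and a finite sum of translated unit-cell suprema of \<open>|m|\<close>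
  dominates all \<open>|m(\<lambda>(z))|\<close> with mesh at most 1 (\<open>norm_lattice_sample_le\<close>).

  These estimates must be uniform in the orthonormal family \<open>F\<close> and the contraction \<open>U\<close>. Therefore
  the trace norm is handled in dual form: \<open>nuclear_bound T C\<close> says that \<open>\<Sum>e\<in>F. <T e, U e>\<close> is at most
  \<open>C\<close> for all finite orthonormal \<open>F\<close> and all contractions \<open>U\<close>. This condition is subadditive,
  invariant under conjugation by unitaries and easy for operators of rank one. Polar decomposition
  links it to \<open>trace_norm\<close>: a nuclear bound dominates the trace norm
  (\<open>trace_norm_le_nuclear_bound\<close>), and a trace-class operator is approximated by finite-rank
  operators in this sense (\<open>trace_class_finite_rank_approximation\<close>). The link rests on the
  completeness of \<open>L2\<close> and on existence and uniqueness of positive square roots. The operator theory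
  is carried out in real Hilbert spaces, with the real part of the complex inner product; complex
  linearity is recovered because the constructed operators commute with multiplication by scalars.\<close>

section \<open>Positive operators on a Hilbert space\<close>

definition positive_semidefinite :: "('a::real_inner \<Rightarrow>\<^sub>L 'a) \<Rightarrow> bool" where
  "positive_semidefinite A \<longleftrightarrow> (\<forall>x y. A x \<bullet> y = x \<bullet> A y) \<and> (\<forall>x. 0 \<le> A x \<bullet> x)"

lemma positive_semidefiniteD:
  assumes "positive_semidefinite A"
  shows "A x \<bullet> y = x \<bullet> A y" "0 \<le> A x \<bullet> x"
  using assms unfolding positive_semidefinite_def by blast+

text \<open>The Cauchy-Schwarz inequality for the form \<open><A x, y>\<close>, with the second vector taken to be \<open>A x\<close>.\<close>
lemma positive_semidefinite_norm_le:
  assumes "positive_semidefinite A"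
  shows "(norm (A x))\<^sup>2 \<le> norm A * (A x \<bullet> x)"
proof (cases "norm A = 0")
  case True
  then show ?thesis by simp
next
  case False
  then have pos: "norm A > 0" by simp
  note sym = positive_semidefiniteD(1)[OF assms] and nn = positive_semidefiniteD(2)[OF assms]
  \<comment> \<open>The value of \<open>t\<close> that minimizes the quadratic estimate of \<open><A (x + t A x), x + t A x>\<close>.\<close>
  define t where "t = - 1 / norm A"
  have "0 \<le> A (x + t *\<^sub>R A x) \<bullet> (x + t *\<^sub>R A x)" by (rule nn)
  also have "\<dots> = A x \<bullet> x + 2 * t * (norm (A x))\<^sup>2 + t\<^sup>2 * (A (A x) \<bullet> A x)"
    using sym[of "A x" x]
    by (simp add: blinfun.bilinear_simps inner_left_distrib inner_right_distrib power2_eq_square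
        power2_norm_eq_inner[unfolded power2_eq_square] algebra_simps)
  also have "A (A x) \<bullet> A x \<le> norm (A (A x)) * norm (A x)" by (rule norm_cauchy_schwarz)
  also have "\<dots> \<le> (norm A * norm (A x)) * norm (A x)"
    by (intro mult_right_mono norm_blinfun) auto
  finally have "0 \<le> A x \<bullet> x + 2 * t * (norm (A x))\<^sup>2 + t\<^sup>2 * (norm A * norm (A x) * norm (A x))"
    by (simp add: mult_left_mono)
  also have "\<dots> = A x \<bullet> x - (norm (A x))\<^sup>2 / norm A"
    using pos by (simp add: t_def field_simps power2_eq_square)
  finally show ?thesis using pos by (simp add: field_simps)
qed

lemma positive_semidefinite_apply_eq_0:
  assumes "positive_semidefinite A" "A x \<bullet> x = 0"
  shows "A x = 0"
  using positive_semidefinite_norm_le[OF assms(1), of x] assms(2) by simp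

lemma contraction_of_positive_semidefinite:
  assumes A: "positive_semidefinite A" and M: "norm A \<le> M" "M > 0"
  shows "norm (id_blinfun - (1 / M) *\<^sub>R A) \<le> 1"
proof (rule norm_blinfun_bound)
  fix x
  have "(norm ((id_blinfun - (1 / M) *\<^sub>R A) x))\<^sup>2
      = (norm x)\<^sup>2 - 2 / M * (A x \<bullet> x) + (norm (A x))\<^sup>2 / M\<^sup>2"
    unfolding power2_norm_eq_inner
    by (simp add: blinfun.bilinear_simps inner_diff_left inner_diff_right inner_commute
        power2_eq_square algebra_simps)
  also have "(norm (A x))\<^sup>2 / M\<^sup>2 \<le> 2 / M * (A x \<bullet> x)"
  proof -
    note nn = positive_semidefiniteD(2)[OF A, of x]
    have "(norm (A x))\<^sup>2 \<le> norm A * (A x \<bullet> x)" by (rule positive_semidefinite_norm_le[OF A])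
    also have "\<dots> \<le> M * (A x \<bullet> x)" using M nn by (intro mult_right_mono)
    also have "\<dots> \<le> 2 * M * (A x \<bullet> x)" using M nn by simp
    finally show ?thesis using M by (simp add: field_simps power2_eq_square)
  qed
  finally have "(norm ((id_blinfun - (1 / M) *\<^sub>R A) x))\<^sup>2 \<le> (norm x)\<^sup>2" by linarith
  then show "norm ((id_blinfun - (1 / M) *\<^sub>R A) x) \<le> 1 * norm x"
    unfolding mult_1 by (rule power2_le_imp_le) simp
qed simp

text \<open>If \<open>Y\<close> is a fixed point, then \<open>(1 - Y)^2 = 1 - B\<close>. For \<open>B\<close> of norm at most 1 the square root of
  \<open>1 - B\<close> is thus obtained from the limit of this iteration.\<close>
primrec sqrt_iteration :: "('a::real_normed_vector \<Rightarrow>\<^sub>L 'a) \<Rightarrow> nat \<Rightarrow> 'a \<Rightarrow>\<^sub>L 'a" where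
  "sqrt_iteration B 0 = 0"
| "sqrt_iteration B (Suc n) = (1/2) *\<^sub>R (B + (sqrt_iteration B n o\<^sub>L sqrt_iteration B n))"

text \<open>The same iteration for the number \<open>B = 1\<close>. It increases to 1 and majorizes the operator
  iteration, so that convergence in operator norm costs nothing even in the critical case
  \<open>norm B = 1\<close>, where the iteration map is no contraction.\<close>
primrec sqrt_majorant :: "nat \<Rightarrow> real" where
  "sqrt_majorant 0 = 0"
| "sqrt_majorant (Suc n) = (1 + (sqrt_majorant n)\<^sup>2) / 2"

lemma sqrt_majorant_bounds: "0 \<le> sqrt_majorant n" "sqrt_majorant n \<le> 1"
  by (induction n) (auto simp: power_le_one)

lemma sqrt_majorant_mono: "incseq sqrt_majorant"
proof (rule incseq_SucI)
  fix n
  have "0 \<le> (1 - sqrt_majorant n)\<^sup>2" by simp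
  then show "sqrt_majorant n \<le> sqrt_majorant (Suc n)"
    by (simp add: power2_eq_square algebra_simps)
qed

lemma norm_sqrt_iteration:
  assumes "norm B \<le> 1"
  shows "norm (sqrt_iteration B n) \<le> sqrt_majorant n"
proof (induction n)
  case (Suc n)
  have "norm (sqrt_iteration B n o\<^sub>L sqrt_iteration B n) \<le> (sqrt_majorant n)\<^sup>2"
    using norm_blinfun_compose[of "sqrt_iteration B n" "sqrt_iteration B n"]
      mult_mono[OF Suc Suc] sqrt_majorant_bounds[of n] by (simp add: power2_eq_square)
  then have "norm (B + (sqrt_iteration B n o\<^sub>L sqrt_iteration B n)) \<le> 1 + (sqrt_majorant n)\<^sup>2"
    using assms norm_triangle_ineq[of B "sqrt_iteration B n o\<^sub>L sqrt_iteration B n"] by linarith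
  then show ?case by simp
qed simp

text \<open>The increments satisfy the same recursion as those of the majorant, since
  \<open>Y Y - X X = Y (Y - X) + (Y - X) X\<close>.\<close>
lemma norm_sqrt_iteration_step:
  assumes B: "norm B \<le> 1"
  shows "norm (sqrt_iteration B (Suc n) - sqrt_iteration B n) \<le> sqrt_majorant (Suc n) - sqrt_majorant n"
proof (induction n)
  case 0
  then show ?case using B by simp
next
  case (Suc n)
  let ?Y = "sqrt_iteration B (Suc n)" and ?X = "sqrt_iteration B n"
  let ?y = "sqrt_majorant (Suc n)" and ?x = "sqrt_majorant n"
  have "sqrt_iteration B (Suc (Suc n)) - ?Y = (1/2) *\<^sub>R ((?Y o\<^sub>L (?Y - ?X)) + ((?Y - ?X) o\<^sub>L ?X))"
  proof -
    have half: "(1/2) *\<^sub>R (B + R) - Y = (1/2) *\<^sub>R (R - Q)" if "Y = (1/2) *\<^sub>R (B + Q)" for R Y Q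
      by (simp add: that scaleR_diff_right scaleR_add_right)
    have "sqrt_iteration B (Suc (Suc n)) - ?Y = (1/2) *\<^sub>R ((?Y o\<^sub>L ?Y) - (?X o\<^sub>L ?X))"
      unfolding sqrt_iteration.simps(2)[of B "Suc n"] by (rule half) (rule sqrt_iteration.simps(2))
    also have "(?Y o\<^sub>L ?Y) - (?X o\<^sub>L ?X) = (?Y o\<^sub>L (?Y - ?X)) + ((?Y - ?X) o\<^sub>L ?X)"
      by (intro blinfun_eqI) (simp add: blinfun.bilinear_simps del: sqrt_iteration.simps)
    finally show ?thesis .
  qed
  also have "norm \<dots> \<le> (1/2) * (norm ?Y * norm (?Y - ?X) + norm (?Y - ?X) * norm ?X)"
    using norm_triangle_ineq[of "?Y o\<^sub>L (?Y - ?X)" "(?Y - ?X) o\<^sub>L ?X"]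
      norm_blinfun_compose[of ?Y "?Y - ?X"] norm_blinfun_compose[of "?Y - ?X" ?X]
    by (simp del: sqrt_iteration.simps)
  also have "\<dots> \<le> (1/2) * (?y * (?y - ?x) + (?y - ?x) * ?x)"
    using Suc norm_sqrt_iteration[OF B, of "Suc n"] norm_sqrt_iteration[OF B, of n]
      sqrt_majorant_bounds[of n] sqrt_majorant_bounds[of "Suc n"] norm_ge_zero[of "?Y - ?X"]
      incseq_SucD[OF sqrt_majorant_mono, of n]
    by (intro mult_left_mono add_mono mult_mono) (assumption | linarith | rule norm_ge_zero)+
  also have "\<dots> = sqrt_majorant (Suc (Suc n)) - ?y"
    by (simp add: power2_eq_square field_simps)
  finally show ?case .
qed

lemma norm_sqrt_iteration_diff:
  assumes B: "norm B \<le> 1" and "n \<le> k"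
  shows "norm (sqrt_iteration B k - sqrt_iteration B n) \<le> sqrt_majorant k - sqrt_majorant n"
  using \<open>n \<le> k\<close>
proof (induction k rule: dec_induct)
  case (step k)
  have "norm (sqrt_iteration B (Suc k) - sqrt_iteration B n)
      \<le> norm (sqrt_iteration B (Suc k) - sqrt_iteration B k) + norm (sqrt_iteration B k - sqrt_iteration B n)"
    by (rule norm_triangle_ineq[THEN order_trans[rotated]]) simp
  then show ?case using step norm_sqrt_iteration_step[OF B, of k] by linarith
qed simp

lemma sqrt_iteration_fixpoint:
  fixes B :: "'a::banach \<Rightarrow>\<^sub>L 'a"
  assumes B: "norm B \<le> 1"
  obtains Y where "sqrt_iteration B \<longlonglongrightarrow> Y" "norm Y \<le> 1" "Y = (1/2) *\<^sub>R (B + (Y o\<^sub>L Y))"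
proof -
  have "convergent sqrt_majorant"
    using sqrt_majorant_mono sqrt_majorant_bounds
    by (intro Bseq_mono_convergent BseqI'[of _ 1]) (auto simp: incseq_def)
  then have y: "Cauchy sqrt_majorant" by (rule convergent_Cauchy)
  have "Cauchy (sqrt_iteration B)"
  proof (rule CauchyI')
    fix e :: real assume "e > 0"
    then obtain M where M: "\<And>m n. m \<ge> M \<Longrightarrow> n \<ge> M \<Longrightarrow> norm (sqrt_majorant m - sqrt_majorant n) < e"
      using CauchyD[OF y] by blast
    show "\<exists>M. \<forall>m\<ge>M. \<forall>n>m. dist (sqrt_iteration B m) (sqrt_iteration B n) < e"
    proof (intro exI allI impI)
      fix m n assume mn: "M \<le> m" "m < n"
      then have "norm (sqrt_iteration B n - sqrt_iteration B m) \<le> sqrt_majorant n - sqrt_majorant m"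
        by (intro norm_sqrt_iteration_diff[OF B]) simp
      also have "\<dots> < e" using M[of n m] mn by simp
      finally show "dist (sqrt_iteration B m) (sqrt_iteration B n) < e" by (simp add: dist_norm norm_minus_commute)
    qed
  qed
  then obtain Y where Y: "sqrt_iteration B \<longlonglongrightarrow> Y"
    using Cauchy_convergent convergent_def by blast
  have "norm Y \<le> 1"
    by (rule LIMSEQ_le_const2[OF tendsto_norm[OF Y]])
      (meson norm_sqrt_iteration[OF B] order_trans sqrt_majorant_bounds(2))
  moreover have "(\<lambda>n. sqrt_iteration B (Suc n)) \<longlonglongrightarrow> (1/2) *\<^sub>R (B + (Y o\<^sub>L Y))"
    unfolding sqrt_iteration.simps
    by (intro tendsto_intros bounded_bilinear.tendsto[OF bounded_bilinear_blinfun_compose] Y)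
  then have "Y = (1/2) *\<^sub>R (B + (Y o\<^sub>L Y))"
    using LIMSEQ_Suc[OF Y] LIMSEQ_unique by blast
  ultimately show ?thesis using Y that by blast
qed

text \<open>Scaling reduces to \<open>P = M (1 - B)\<close> with \<open>B\<close> of norm at most 1. Symmetry of the root and
  commutation with \<open>C\<close> pass from \<open>B\<close> to every iterate and to the limit. The commutation property
  gives uniqueness and complex linearity.\<close>
lemma positive_sqrt_exists:
  fixes P :: "'a::{real_inner,banach} \<Rightarrow>\<^sub>L 'a"
  assumes P: "positive_semidefinite P"
  shows "\<exists>A. positive_semidefinite A \<and> A o\<^sub>L A = P \<and>
    (\<forall>C. C o\<^sub>L P = P o\<^sub>L C \<longrightarrow> C o\<^sub>L A = A o\<^sub>L C)"
proof -
  define M where "M = norm P + 1"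
  have M: "M > 0" "norm P \<le> M" by (auto simp: M_def add_nonneg_pos)
  define B where "B = id_blinfun - (1 / M) *\<^sub>R P"
  have B: "norm B \<le> 1"
    unfolding B_def by (rule contraction_of_positive_semidefinite[OF P M(2,1)])
  obtain Y where Y: "sqrt_iteration B \<longlonglongrightarrow> Y" "norm Y \<le> 1" "Y = (1/2) *\<^sub>R (B + (Y o\<^sub>L Y))"
    using sqrt_iteration_fixpoint[OF B] .
  note Psym = positive_semidefiniteD(1)[OF P]
  have Bsym: "B x \<bullet> y = x \<bullet> B y" for x y
    by (simp add: B_def blinfun.bilinear_simps inner_diff_left inner_diff_right Psym)
  have "sqrt_iteration B n x \<bullet> y = x \<bullet> sqrt_iteration B n y" for n x y
    by (induction n arbitrary: x y)
      (simp_all add: blinfun.bilinear_simps inner_left_distrib inner_right_distrib Bsym)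
  then have Ysym: "Y x \<bullet> y = x \<bullet> Y y" for x y
  proof -
    assume eq: "\<And>n x y. sqrt_iteration B n x \<bullet> y = x \<bullet> sqrt_iteration B n y"
    have "(\<lambda>n. sqrt_iteration B n x \<bullet> y) \<longlonglongrightarrow> Y x \<bullet> y"
         "(\<lambda>n. x \<bullet> sqrt_iteration B n y) \<longlonglongrightarrow> x \<bullet> Y y"
      by (intro tendsto_intros Y(1))+
    then show ?thesis unfolding eq by (rule LIMSEQ_unique)
  qed
  define A where "A = sqrt M *\<^sub>R (id_blinfun - Y)"
  have "positive_semidefinite A"
    unfolding positive_semidefinite_def
  proof safe
    fix x y show "A x \<bullet> y = x \<bullet> A y"
      by (simp add: A_def blinfun.bilinear_simps inner_diff_left inner_diff_right Ysym)
  next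
    fix x
    have "Y x \<bullet> x \<le> norm (Y x) * norm x" by (rule norm_cauchy_schwarz)
    also have "\<dots> \<le> norm x * norm x"
      using norm_blinfun[of Y x] mult_right_mono[OF Y(2), of "norm x"]
      by (intro mult_right_mono) auto
    also have "\<dots> = x \<bullet> x" by (simp add: power2_norm_eq_inner[symmetric] power2_eq_square)
    finally show "0 \<le> A x \<bullet> x"
      using M by (simp add: A_def blinfun.bilinear_simps inner_diff_left)
  qed
  moreover have "A o\<^sub>L A = P"
  proof (rule blinfun_eqI)
    fix x
    have "2 *\<^sub>R Y x = B x + Y (Y x)"
      using arg_cong[OF Y(3), of "\<lambda>Z. 2 *\<^sub>R blinfun_apply Z x"]
      by (simp add: blinfun.bilinear_simps)
    then have "Y (Y x) = 2 *\<^sub>R Y x - x + (1 / M) *\<^sub>R P x"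
      by (simp add: B_def blinfun.bilinear_simps algebra_simps)
    moreover have "(A o\<^sub>L A) x = (sqrt M * sqrt M) *\<^sub>R (x - 2 *\<^sub>R Y x + Y (Y x))"
      by (simp add: A_def blinfun.bilinear_simps algebra_simps scaleR_2)
    ultimately show "(A o\<^sub>L A) x = P x" using M by simp
  qed
  moreover have "C o\<^sub>L A = A o\<^sub>L C" if C: "C o\<^sub>L P = P o\<^sub>L C" for C
  proof -
    have CP: "C (P x) = P (C x)" for x using arg_cong[OF C, of "\<lambda>Z. blinfun_apply Z x"] by simp
    have CB: "C (B x) = B (C x)" for x by (simp add: B_def blinfun.bilinear_simps CP)
    have "C (sqrt_iteration B n x) = sqrt_iteration B n (C x)" for n x
      by (induction n arbitrary: x) (simp_all add: blinfun.bilinear_simps CB)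
    moreover have "(\<lambda>n. C (sqrt_iteration B n x)) \<longlonglongrightarrow> C (Y x)"
         "(\<lambda>n. sqrt_iteration B n (C x)) \<longlonglongrightarrow> Y (C x)" for x
      by (intro tendsto_intros Y(1))+
    ultimately have "C (Y x) = Y (C x)" for x using LIMSEQ_unique by fastforce
    then show ?thesis
      by (intro blinfun_eqI) (simp add: A_def blinfun.bilinear_simps)
  qed
  ultimately show ?thesis by blast
qed

text \<open>For \<open>y = (A - C) x\<close> the vector \<open>(A + C) y = (A A - C C) x\<close> vanishes, so both nonnegative numbers
  \<open><A y, y>\<close> and \<open><C y, y>\<close> vanish, hence \<open>A y = C y = 0\<close> and \<open><y, y> = <x, (A - C) y> = 0\<close>.\<close>
lemma positive_sqrt_unique_commuting:
  assumes A: "positive_semidefinite A" and C: "positive_semidefinite C"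
    and eq: "A o\<^sub>L A = C o\<^sub>L C" and comm: "C o\<^sub>L A = A o\<^sub>L C"
  shows "A = C"
proof (rule blinfun_eqI)
  fix x
  define y where "y = A x - C x"
  have e: "A (A z) = C (C z)" and c: "C (A z) = A (C z)" for z
    using arg_cong[OF eq, of "\<lambda>Z. blinfun_apply Z z"] arg_cong[OF comm, of "\<lambda>Z. blinfun_apply Z z"]
    by simp_all
  have "A y + C y = 0" by (simp add: y_def blinfun.bilinear_simps e c)
  then have "A y \<bullet> y + C y \<bullet> y = 0" by (simp flip: inner_left_distrib)
  moreover have "0 \<le> A y \<bullet> y" "0 \<le> C y \<bullet> y"
    using A C by (blast dest: positive_semidefiniteD(2))+
  ultimately have "A y = 0" "C y = 0"
    by (auto intro: positive_semidefinite_apply_eq_0 A C)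
  moreover have "y \<bullet> y = x \<bullet> (A y - C y)"
    using positive_semidefiniteD(1)[OF A] positive_semidefiniteD(1)[OF C]
    by (simp add: y_def inner_diff_left inner_diff_right blinfun.bilinear_simps)
  ultimately have "y \<bullet> y = 0" by simp
  then show "A x = C x" by (simp add: y_def)
qed

text \<open>Any other root \<open>C\<close> commutes with \<open>P = C C\<close>, hence with the constructed root.\<close>
lemma positive_sqrt_ex1:
  fixes P :: "'a::{real_inner,banach} \<Rightarrow>\<^sub>L 'a"
  assumes P: "positive_semidefinite P"
  shows "\<exists>!A. positive_semidefinite A \<and> A o\<^sub>L A = P"
proof -
  obtain A where A: "positive_semidefinite A" "A o\<^sub>L A = P"
    "\<And>C. C o\<^sub>L P = P o\<^sub>L C \<Longrightarrow> C o\<^sub>L A = A o\<^sub>L C"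
    using positive_sqrt_exists[OF P] by blast
  show ?thesis
  proof (intro ex1I[of _ A] conjI A(1,2))
    fix C assume C: "positive_semidefinite C \<and> C o\<^sub>L C = P"
    have "C o\<^sub>L (C o\<^sub>L C) = (C o\<^sub>L C) o\<^sub>L C" by (rule blinfun_eqI) simp
    moreover have "C o\<^sub>L C = P" using C by simp
    ultimately have "C o\<^sub>L P = P o\<^sub>L C" by (simp only:)
    then have comm: "C o\<^sub>L A = A o\<^sub>L C" by (rule A(3))
    have "A o\<^sub>L A = C o\<^sub>L C" using C A(2) by simp
    then have "A = C" using C A(1) comm by (blast intro: positive_sqrt_unique_commuting)
    then show "C = A" ..
  qed
qed

text \<open>The representing vector minimizes \<open>|x|^2 - 2 f x\<close>; the parallelogram law makes minimizing
  sequences Cauchy.\<close>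
lemma riesz_representation:
  fixes f :: "'a::{real_inner,banach} \<Rightarrow> real"
  assumes f: "bounded_linear f"
  obtains y where "\<And>x. f x = y \<bullet> x"
proof -
  interpret f: bounded_linear f by fact
  obtain K where K: "\<And>x. norm (f x) \<le> norm x * K" using f.bounded by blast
  define q where "q x = (norm x)\<^sup>2 - 2 * f x" for x
  have lower: "- K\<^sup>2 \<le> q x" for x
  proof -
    have "0 \<le> (norm x - K)\<^sup>2" by simp
    then show ?thesis using K[of x] by (simp add: q_def power2_diff mult.commute)
  qed
  define d where "d = Inf (range q)"
  have bdd: "bdd_below (range q)" using lower by (auto intro!: bdd_belowI)
  have d: "d \<le> q x" for x unfolding d_def using bdd by (intro cInf_lower) auto
  have "\<exists>x. q x < d + 1 / real (Suc n)" for n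
  proof -
    have "d < d + 1 / real (Suc n)" by simp
    then show ?thesis using cInf_less_iff[OF _ bdd, of "d + 1 / real (Suc n)"] by (auto simp: d_def)
  qed
  then obtain x where x: "\<And>n. q (x n) < d + 1 / real (Suc n)" by metis
  \<comment> \<open>The parallelogram law: the linear terms of \<open>q\<close> cancel.\<close>
  have par: "(norm (u - v))\<^sup>2 = 2 * q u + 2 * q v - 4 * q ((1/2) *\<^sub>R (u + v))" for u v
    unfolding q_def power2_norm_eq_inner
    by (simp add: f.add f.scaleR inner_left_distrib inner_right_distrib inner_diff_left
        inner_diff_right inner_commute algebra_simps)
  have close: "(norm (u - v))\<^sup>2 \<le> 2 * (q u - d) + 2 * (q v - d)" for u v
    using d[of "(1/2) *\<^sub>R (u + v)"] unfolding par by (simp only: right_diff_distrib)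
  have "Cauchy x"
  proof (rule CauchyI)
    fix e :: real assume e: "e > 0"
    obtain N where N: "1 / real (Suc N) < e\<^sup>2 / 4"
      by (rule nat_approx_posE[of "e\<^sup>2 / 4"]) (use e in simp)
    show "\<exists>M. \<forall>m\<ge>M. \<forall>n\<ge>M. norm (x m - x n) < e"
    proof (intro exI allI impI)
      fix m n assume mn: "N \<le> m" "N \<le> n"
      have "q (x k) - d < e\<^sup>2 / 4" if "N \<le> k" for k
      proof -
        have "1 / real (Suc k) \<le> 1 / real (Suc N)" using that by (intro divide_left_mono) auto
        then show ?thesis using x[of k] N by linarith
      qed
      from this[OF mn(1)] this[OF mn(2)] close[of "x m" "x n"]
      have "(norm (x m - x n))\<^sup>2 < e\<^sup>2" by argo
      then show "norm (x m - x n) < e" using e by (simp add: power2_less_imp_less)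
    qed
  qed
  then obtain y where y: "x \<longlonglongrightarrow> y" using Cauchy_convergent convergent_def by blast
  have "(\<lambda>n. q (x n)) \<longlonglongrightarrow> q y"
    unfolding q_def by (intro tendsto_intros y f.tendsto)
  moreover have "(\<lambda>n. d + 1 / real (Suc n)) \<longlonglongrightarrow> d + 0"
    by (intro tendsto_intros LIMSEQ_Suc lim_1_over_n)
  ultimately have "q y \<le> d + 0"
    by (rule LIMSEQ_le) (use x less_imp_le in blast)
  then have min: "q y \<le> q z" for z using d[of z] by simp
  have "f h = y \<bullet> h" for h
  proof (cases "h = 0")
    case True then show ?thesis by (simp add: f.zero)
  next
    case False
    \<comment> \<open>The minimum of \<open>t \<mapsto> q (y + t h)\<close> over all real \<open>t\<close>.\<close>
    define t where "t = (f h - y \<bullet> h) / (h \<bullet> h)"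
    have h: "h \<bullet> h > 0" using False by simp
    have "q (y + t *\<^sub>R h) - q y = t\<^sup>2 * (h \<bullet> h) - 2 * t * (f h - y \<bullet> h)"
      unfolding q_def power2_norm_eq_inner
      by (simp add: f.add f.scaleR inner_left_distrib inner_right_distrib inner_commute
          power2_eq_square algebra_simps)
    also have "\<dots> = - ((f h - y \<bullet> h)\<^sup>2 / (h \<bullet> h))"
      using h by (simp add: t_def power2_eq_square)
    finally have "(f h - y \<bullet> h)\<^sup>2 / (h \<bullet> h) \<le> 0" using min[of "y + t *\<^sub>R h"] by linarith
    then show ?thesis using h by (simp add: divide_le_0_iff)
  qed
  then show ?thesis by (rule that)
qed

text \<open>The resolvents replace the partial isometry of the polar decomposition: \<open>S (|S| + \<epsilon>)^(-1)\<close> is a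
  contraction that maps \<open>|S| x\<close> almost to \<open>S x\<close>.\<close>
lemma positive_resolvent:
  fixes A :: "'a::{real_inner,banach} \<Rightarrow>\<^sub>L 'a"
  assumes A: "positive_semidefinite A" and e: "\<epsilon> > 0"
  shows "\<exists>J::'a \<Rightarrow>\<^sub>L 'a. (\<forall>x. A (J x) + \<epsilon> *\<^sub>R J x = x) \<and> (\<forall>x. J (A x) + \<epsilon> *\<^sub>R J x = x)"
proof -
  note nn = positive_semidefiniteD(2)[OF A]
  have lower: "\<epsilon> * norm x \<le> norm (A x + \<epsilon> *\<^sub>R x)" for x
  proof (cases "x = 0")
    case False
    have "\<epsilon> * norm x * norm x \<le> (A x + \<epsilon> *\<^sub>R x) \<bullet> x"
      using nn[of x] by (simp add: inner_left_distrib power2_norm_eq_inner[symmetric] power2_eq_square)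
    also have "\<dots> \<le> norm (A x + \<epsilon> *\<^sub>R x) * norm x" by (rule norm_cauchy_schwarz)
    finally show ?thesis using False by simp
  qed simp
  have inj: "u = v" if "A u + \<epsilon> *\<^sub>R u = A v + \<epsilon> *\<^sub>R v" for u v
    using lower[of "u - v"] that e
    by (simp add: blinfun.bilinear_simps algebra_simps mult_le_0_iff)
  have surj: "\<exists>x. A x + \<epsilon> *\<^sub>R x = y" for y
  proof -
    define M where "M = norm A + 1"
    have M: "M > 0" "norm A \<le> M" by (auto simp: M_def add_nonneg_pos)
    \<comment> \<open>Fixed points of \<open>g\<close> solve \<open>(M + \<epsilon>) x = y + (M - A) x\<close>, and \<open>M - A\<close> has norm at most \<open>M\<close>.\<close>
    define g where "g x = (1 / (M + \<epsilon>)) *\<^sub>R (y + M *\<^sub>R (id_blinfun - (1 / M) *\<^sub>R A) x)" for x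
    have "\<exists>!x. g x = x"
    proof (rule banach_fix_type)
      show "0 \<le> M / (M + \<epsilon>)" "M / (M + \<epsilon>) < 1" using M e by auto
      show "\<forall>x z. dist (g x) (g z) \<le> M / (M + \<epsilon>) * dist x z"
      proof (intro allI)
        fix x z
        have "g x - g z = (M / (M + \<epsilon>)) *\<^sub>R (id_blinfun - (1 / M) *\<^sub>R A) (x - z)"
          by (simp add: g_def scaleR_diff_right scaleR_add_right blinfun.diff_right)
        moreover have "norm ((id_blinfun - (1 / M) *\<^sub>R A) (x - z)) \<le> norm (x - z)"
          using norm_blinfun[of "id_blinfun - (1 / M) *\<^sub>R A" "x - z"]
            mult_right_mono[OF contraction_of_positive_semidefinite[OF A M(2,1)] norm_ge_zero[of "x - z"]]
          by simp
        ultimately show "dist (g x) (g z) \<le> M / (M + \<epsilon>) * dist x z"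
          using M e by (simp add: dist_norm divide_right_mono mult_left_mono)
      qed
    qed
    then obtain x where "g x = x" by blast
    then have "(M + \<epsilon>) *\<^sub>R x = y + M *\<^sub>R (id_blinfun - (1 / M) *\<^sub>R A) x"
    proof -
      have "(M + \<epsilon>) *\<^sub>R g x = y + M *\<^sub>R (id_blinfun - (1 / M) *\<^sub>R A) x"
        using M e by (simp add: g_def)
      then show ?thesis using \<open>g x = x\<close> by simp
    qed
    then show ?thesis using M
      by (intro exI[of _ x]) (simp add: blinfun.bilinear_simps algebra_simps)
  qed
  define j where "j y = (SOME x. A x + \<epsilon> *\<^sub>R x = y)" for y
  have j: "A (j y) + \<epsilon> *\<^sub>R j y = y" for y unfolding j_def using surj[of y] by (rule someI_ex)
  have "bounded_linear j"
  proof (rule bounded_linear_intro[where K = "1 / \<epsilon>"])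
    show "j (x + y) = j x + j y" for x y
    proof (rule inj)
      have "A (j x + j y) + \<epsilon> *\<^sub>R (j x + j y) = (A (j x) + \<epsilon> *\<^sub>R j x) + (A (j y) + \<epsilon> *\<^sub>R j y)"
        by (simp add: blinfun.bilinear_simps algebra_simps)
      then show "A (j (x + y)) + \<epsilon> *\<^sub>R j (x + y) = A (j x + j y) + \<epsilon> *\<^sub>R (j x + j y)"
        by (simp only: j)
    qed
    show "j (r *\<^sub>R x) = r *\<^sub>R j x" for r x
    proof (rule inj)
      have "A (r *\<^sub>R j x) + \<epsilon> *\<^sub>R r *\<^sub>R j x = r *\<^sub>R (A (j x) + \<epsilon> *\<^sub>R j x)"
        by (simp add: blinfun.bilinear_simps algebra_simps)
      then show "A (j (r *\<^sub>R x)) + \<epsilon> *\<^sub>R j (r *\<^sub>R x) = A (r *\<^sub>R j x) + \<epsilon> *\<^sub>R r *\<^sub>R j x"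
        by (simp only: j)
    qed
    show "norm (j x) \<le> norm x * (1 / \<epsilon>)" for x
      using lower[of "j x"] e unfolding j by (simp add: pos_le_divide_eq mult.commute)
  qed
  then have J: "blinfun_apply (Blinfun j) = j" by (rule bounded_linear_Blinfun_apply)
  show ?thesis
  proof (intro exI[of _ "Blinfun j"] conjI allI; unfold J)
    show "A (j x) + \<epsilon> *\<^sub>R j x = x" for x by (rule j)
    show "j (A x) + \<epsilon> *\<^sub>R j x = x" for x
    proof (rule inj)
      have "A (j (A x) + \<epsilon> *\<^sub>R j x) + \<epsilon> *\<^sub>R (j (A x) + \<epsilon> *\<^sub>R j x)
          = (A (j (A x)) + \<epsilon> *\<^sub>R j (A x)) + \<epsilon> *\<^sub>R (A (j x) + \<epsilon> *\<^sub>R j x)"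
        by (simp only: blinfun.bilinear_simps scaleR_add_right add_ac)
      then show "A (j (A x) + \<epsilon> *\<^sub>R j x) + \<epsilon> *\<^sub>R (j (A x) + \<epsilon> *\<^sub>R j x)
          = A x + \<epsilon> *\<^sub>R x" by (simp only: j)
    qed
  qed
qed

section \<open>A dual form of the trace norm\<close>

definition orthonormal :: "'a::real_inner set \<Rightarrow> bool" where
  "orthonormal F \<longleftrightarrow> (\<forall>e\<in>F. \<forall>e'\<in>F. e \<bullet> e' = (if e = e' then 1 else 0))"

text \<open>On a real Hilbert space the least such \<open>C\<close> is the trace norm of \<open>T\<close>. For a complex-linear
  operator on a complex Hilbert space, regarded as a real one, it is twice the complex trace norm.\<close>
definition nuclear_bound :: "('a::real_inner \<Rightarrow> 'a) \<Rightarrow> real \<Rightarrow> bool" where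
  "nuclear_bound T C \<longleftrightarrow> (\<forall>F U. finite F \<longrightarrow> orthonormal F \<longrightarrow> linear U \<longrightarrow>
     (\<forall>x. norm (U x) \<le> norm x) \<longrightarrow> (\<Sum>e\<in>F. T e \<bullet> U e) \<le> C)"

lemma nuclear_boundI:
  assumes "\<And>F U. finite F \<Longrightarrow> orthonormal F \<Longrightarrow> linear U \<Longrightarrow> (\<And>x. norm (U x) \<le> norm x) \<Longrightarrow>
    (\<Sum>e\<in>F. T e \<bullet> U e) \<le> C"
  shows "nuclear_bound T C"
  using assms unfolding nuclear_bound_def by blast

lemma nuclear_boundD:
  assumes "nuclear_bound T C" "finite F" "orthonormal F" "linear U" "\<And>x. norm (U x) \<le> norm x"
  shows "(\<Sum>e\<in>F. T e \<bullet> U e) \<le> C"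
  using assms unfolding nuclear_bound_def by blast

lemma nuclear_bound_mono: "nuclear_bound T C \<Longrightarrow> C \<le> D \<Longrightarrow> nuclear_bound T D"
  unfolding nuclear_bound_def by (meson order_trans)

lemma nuclear_bound_add:
  assumes "nuclear_bound T C" "nuclear_bound T' C'"
  shows "nuclear_bound (\<lambda>x. T x + T' x) (C + C')"
proof (rule nuclear_boundI)
  fix F :: "'a set" and U :: "'a \<Rightarrow> 'a"
  assume "finite F" "orthonormal F" "linear U" "\<And>x. norm (U x) \<le> norm x"
  with assms have "(\<Sum>e\<in>F. T e \<bullet> U e) \<le> C" "(\<Sum>e\<in>F. T' e \<bullet> U e) \<le> C'"
    by (auto intro: nuclear_boundD)
  then show "(\<Sum>e\<in>F. (T e + T' e) \<bullet> U e) \<le> C + C'"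
    by (simp add: inner_left_distrib sum.distrib)
qed

lemma nuclear_bound_minus:
  assumes "nuclear_bound T C"
  shows "nuclear_bound (\<lambda>x. - T x) C"
proof (rule nuclear_boundI)
  fix F :: "'a set" and U :: "'a \<Rightarrow> 'a"
  assume "finite F" "orthonormal F" "linear U" "\<And>x. norm (U x) \<le> norm x"
  then have "(\<Sum>e\<in>F. T e \<bullet> - U e) \<le> C"
    by (intro nuclear_boundD[OF assms]) (auto intro: linear_compose_neg)
  then show "(\<Sum>e\<in>F. - T e \<bullet> U e) \<le> C" by simp
qed

lemma nuclear_bound_diff:
  assumes "nuclear_bound T C" "nuclear_bound T' C'"
  shows "nuclear_bound (\<lambda>x. T x - T' x) (C + C')"
  using nuclear_bound_add[OF assms(1) nuclear_bound_minus[OF assms(2)]] by simp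

lemma nuclear_bound_sum:
  assumes "\<And>b. b \<in> B \<Longrightarrow> nuclear_bound (T b) (C b)"
  shows "nuclear_bound (\<lambda>x. \<Sum>b\<in>B. T b x) (\<Sum>b\<in>B. C b)"
  using assms
proof (induction B rule: infinite_finite_induct)
  case (insert b B)
  then show ?case using nuclear_bound_add[of "T b" "C b"] by simp
qed (auto intro: nuclear_boundI)

text \<open>Conjugation by \<open>P\<close> amounts to replacing the family \<open>F\<close> by its image under \<open>Q\<close> and the contraction
  \<open>U\<close> by \<open>Q U P\<close>.\<close>
lemma nuclear_bound_conjugate:
  fixes T P Q :: "'a::real_inner \<Rightarrow> 'a"
  assumes T: "nuclear_bound T C"
    and P: "linear P" "\<And>x. norm (P x) = norm x"
    and Q: "linear Q" "\<And>x. norm (Q x) = norm x" "\<And>x. P (Q x) = x"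
    and adj: "\<And>x y. P x \<bullet> y = x \<bullet> Q y"
  shows "nuclear_bound (\<lambda>x. P (T (Q x))) C"
proof (rule nuclear_boundI)
  fix F :: "'a set" and U :: "'a \<Rightarrow> 'a"
  assume F: "finite F" "orthonormal F" and U: "linear U" "\<And>x. norm (U x) \<le> norm x"
  have inj: "inj_on Q F" using Q(3) by (metis inj_onI)
  have "(\<Sum>e\<in>F. P (T (Q e)) \<bullet> U e) = (\<Sum>e\<in>F. T (Q e) \<bullet> Q (U (P (Q e))))"
    by (simp add: adj Q(3))
  also have "\<dots> = (\<Sum>e\<in>Q ` F. T e \<bullet> Q (U (P e)))"
    by (simp add: sum.reindex[OF inj])
  also have "\<dots> \<le> C"
  proof (rule nuclear_boundD[OF T])
    have "Q u \<bullet> Q v = u \<bullet> v" for u v by (metis adj Q(3))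
    then show "orthonormal (Q ` F)"
      using F(2) inj by (auto simp: orthonormal_def inj_on_eq_iff)
    have "linear (Q \<circ> (U \<circ> P))" by (intro linear_compose P Q U)
    then show "linear (\<lambda>e. Q (U (P e)))" by (simp add: comp_def)
    show "norm (Q (U (P x))) \<le> norm x" for x using U(2)[of "P x"] by (simp add: P Q)
  qed (use F in auto)
  finally show "(\<Sum>e\<in>F. P (T (Q e)) \<bullet> U e) \<le> C" .
qed

lemma inner_orthonormal_sum:
  assumes "finite F" "orthonormal F"
  shows "(\<Sum>e\<in>F. c e *\<^sub>R e) \<bullet> (\<Sum>e\<in>F. d e *\<^sub>R e) = (\<Sum>e\<in>F. c e * d e)"
proof -
  have "(\<Sum>e\<in>F. c e *\<^sub>R e) \<bullet> (\<Sum>e\<in>F. d e *\<^sub>R e) = (\<Sum>e\<in>F. c e * (\<Sum>e'\<in>F. d e' * (e \<bullet> e')))"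
    by (subst inner_sum_left) (simp add: inner_sum_right sum_distrib_left mult.left_commute)
  also have "\<dots> = (\<Sum>e\<in>F. c e * (\<Sum>e'\<in>F. if e = e' then d e' else 0))"
    using assms(2) by (intro sum.cong arg_cong2[of _ _ _ _ "(*)"] refl) (auto simp: orthonormal_def)
  also have "\<dots> = (\<Sum>e\<in>F. c e * d e)" using assms(1) by (intro sum.cong) auto
  finally show ?thesis .
qed

text \<open>Bessel's inequality for the adjoint of \<open>U\<close> applied to \<open>a\<close>: the
  sum \<open>s\<close> equals both \<open>norm y ^ 2\<close> and \<open><a, U y>\<close> for \<open>y = \<Sum>e\<in>F. <a, U e> e\<close>.\<close>
lemma bessel_contraction:
  assumes F: "finite F" "orthonormal F" and U: "linear U" "\<And>x. norm (U x) \<le> norm x"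
  shows "(\<Sum>e\<in>F. (a \<bullet> U e)\<^sup>2) \<le> (norm a)\<^sup>2"
proof -
  define y where "y = (\<Sum>e\<in>F. (a \<bullet> U e) *\<^sub>R e)"
  define s where "s = (\<Sum>e\<in>F. (a \<bullet> U e)\<^sup>2)"
  have s: "0 \<le> s" by (auto simp: s_def intro: sum_nonneg)
  have y: "(norm y)\<^sup>2 = s"
    unfolding power2_norm_eq_inner y_def inner_orthonormal_sum[OF F] s_def by (simp add: power2_eq_square)
  have "s = a \<bullet> U y"
    by (simp add: s_def y_def linear_sum[OF U(1)] linear_scale[OF U(1)] inner_sum_right power2_eq_square)
  also have "\<dots> \<le> norm a * norm (U y)" by (rule norm_cauchy_schwarz)
  also have "\<dots> \<le> norm a * norm y" using U(2) by (simp add: mult_left_mono)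
  finally have "norm y * norm y \<le> norm a * norm y" using y by (simp add: power2_eq_square)
  then have "norm y \<le> norm a"
    by (cases "norm y = 0") (auto simp: mult_le_cancel_right)
  then have "(norm y)\<^sup>2 \<le> (norm a)\<^sup>2" by (rule power_mono) simp
  then show ?thesis using y by (simp add: s_def)
qed

lemma bessel:
  assumes "finite F" "orthonormal F"
  shows "(\<Sum>e\<in>F. (a \<bullet> e)\<^sup>2) \<le> (norm a)\<^sup>2"
  using bessel_contraction[OF assms, of "\<lambda>x. x" a] by (simp add: module_hom_ident)

lemma nuclear_bound_rank_one:
  "nuclear_bound (\<lambda>x. (x \<bullet> c) *\<^sub>R a) (norm c * norm a)"
proof (rule nuclear_boundI)
  fix F :: "'a set" and U :: "'a \<Rightarrow> 'a"
  assume F: "finite F" "orthonormal F" and U: "linear U" "\<And>x. norm (U x) \<le> norm x"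
  have "(\<Sum>e\<in>F. ((e \<bullet> c) *\<^sub>R a) \<bullet> U e) \<le> (\<Sum>e\<in>F. \<bar>c \<bullet> e\<bar> * \<bar>a \<bullet> U e\<bar>)"
    by (intro sum_mono) (simp add: inner_commute flip: abs_mult)
  also have "\<dots> \<le> L2_set (\<lambda>e. c \<bullet> e) F * L2_set (\<lambda>e. a \<bullet> U e) F" by (rule L2_set_mult_ineq)
  also have "\<dots> \<le> norm c * norm a"
    unfolding L2_set_def using bessel[OF F, of c] bessel_contraction[OF F U, of a]
    by (intro mult_mono real_le_lsqrt) (auto intro: sum_nonneg)
  finally show "(\<Sum>e\<in>F. ((e \<bullet> c) *\<^sub>R a) \<bullet> U e) \<le> norm c * norm a" .
qed

lemma norm_positive_resolvent:
  assumes A: "positive_semidefinite A" and e: "\<epsilon> > 0"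
    and J: "A y + \<epsilon> *\<^sub>R y = x"
  shows "norm (A y) \<le> norm x"
proof -
  have "(norm x)\<^sup>2 = (norm (A y))\<^sup>2 + 2 * \<epsilon> * (A y \<bullet> y) + \<epsilon>\<^sup>2 * (norm y)\<^sup>2"
    unfolding J[symmetric] power2_norm_eq_inner
    by (simp add: inner_left_distrib inner_right_distrib inner_commute power2_eq_square algebra_simps)
  moreover have "0 \<le> 2 * \<epsilon> * (A y \<bullet> y)" "0 \<le> \<epsilon>\<^sup>2 * (norm y)\<^sup>2"
    using positive_semidefiniteD(2)[OF A, of y] e by simp_all
  ultimately have "(norm (A y))\<^sup>2 \<le> (norm x)\<^sup>2" by linarith
  then show ?thesis by (rule power2_le_imp_le) simp
qed

text \<open>Testing \<open>S\<close> against the contraction \<open>S J\<close> with \<open>J = (A + \<epsilon>)^(-1)\<close> gives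
  \<open><S e, S J e> = <A e, A J e> = <A e, e> - \<epsilon> <A e, J e>\<close>, and the error is at most \<open>\<epsilon>\<close>.\<close>
lemma sum_modulus_le_nuclear_bound:
  fixes S A :: "'a::{real_inner,banach} \<Rightarrow>\<^sub>L 'a"
  assumes A: "positive_semidefinite A" and AS: "\<And>x y. A x \<bullet> A y = S x \<bullet> S y"
    and C: "nuclear_bound S C" and F: "finite F" "orthonormal F"
  shows "(\<Sum>e\<in>F. A e \<bullet> e) \<le> C"
proof (rule field_le_epsilon)
  fix \<delta> :: real assume "\<delta> > 0"
  \<comment> \<open>The summand 1 covers the empty family.\<close>
  define \<epsilon> where "\<epsilon> = \<delta> / (real (card F) + 1)"
  have e: "\<epsilon> > 0" using \<open>\<delta> > 0\<close> by (simp add: \<epsilon>_def)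
  obtain J :: "'a \<Rightarrow>\<^sub>L 'a" where J: "\<And>x. A (J x) + \<epsilon> *\<^sub>R J x = x" using positive_resolvent[OF A e] by blast
  have AJ: "norm (A (J x)) \<le> norm x" for x by (rule norm_positive_resolvent[OF A e J])
  have nA: "norm (A x) = norm (S x)" for x using AS[of x x] by (simp add: norm_eq_sqrt_inner)
  have "(\<Sum>e\<in>F. S e \<bullet> S (J e)) \<le> C"
    by (rule nuclear_boundD[OF C F])
      (auto simp: AJ nA[symmetric] intro!: bounded_linear.linear bounded_linear_intros)
  moreover have "A e \<bullet> e \<le> S e \<bullet> S (J e) + \<epsilon>" if "e \<in> F" for e
  proof -
    have "A (J e) = e - \<epsilon> *\<^sub>R J e" using J[of e] by (simp add: algebra_simps)
    then have "S e \<bullet> S (J e) = A e \<bullet> (e - \<epsilon> *\<^sub>R J e)" by (simp add: AS[symmetric])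
    also have "\<dots> = A e \<bullet> e - \<epsilon> * (e \<bullet> A (J e))"
      by (simp add: inner_diff_right positive_semidefiniteD(1)[OF A, of e "J e"])
    finally have "A e \<bullet> e = S e \<bullet> S (J e) + \<epsilon> * (e \<bullet> A (J e))" by simp
    moreover have "norm e = 1" using F(2) that by (simp add: orthonormal_def norm_eq_1)
    then have "e \<bullet> A (J e) \<le> 1" using norm_cauchy_schwarz[of e "A (J e)"] AJ[of e] by simp
    ultimately show ?thesis using e by (simp add: mult_left_le)
  qed
  then have "(\<Sum>e\<in>F. A e \<bullet> e) \<le> (\<Sum>e\<in>F. S e \<bullet> S (J e) + \<epsilon>)" by (rule sum_mono)
  moreover have "real (card F) * \<epsilon> \<le> \<delta>"
    using \<open>\<delta> > 0\<close> by (simp add: \<epsilon>_def field_simps)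
  ultimately show "(\<Sum>e\<in>F. A e \<bullet> e) \<le> C + \<delta>" by (simp add: sum.distrib)
qed

text \<open>Here \<open>A = |S|\<close> and \<open>R\<close> is the square root of \<open>|S|\<close>; with the polar decomposition \<open>S = W |S|\<close> the
  operator \<open>V\<close> is \<open>W R\<close>. It is obtained as the norm limit of \<open>S (A + \<epsilon>)^(-1) R\<close>
  for \<open>\<epsilon>\<close> tending to 0. The factorization exhibits \<open>S\<close> as a product of two Hilbert-Schmidt operators
  when \<open>S\<close> is of trace class.\<close>
lemma half_modulus_factorization:
  fixes S A R :: "'a::{real_inner,banach} \<Rightarrow>\<^sub>L 'a"
  assumes A: "positive_semidefinite A" and AS: "\<And>x y. A x \<bullet> A y = S x \<bullet> S y"
    and R: "positive_semidefinite R" "R o\<^sub>L R = A"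
  shows "\<exists>V::'a \<Rightarrow>\<^sub>L 'a. (\<forall>x. V (R x) = S x) \<and> (\<forall>x. norm (V x) \<le> norm (R x))"
proof -
  have RR: "R (R x) = A x" for x using arg_cong[OF R(2), of "\<lambda>Z. blinfun_apply Z x"] by simp
  have nA: "norm (S x) = norm (A x)" for x using AS[of x x] by (simp add: norm_eq_sqrt_inner)
  define \<epsilon> where "\<epsilon> n = 1 / real (Suc n)" for n
  have e: "\<epsilon> n > 0" for n by (simp add: \<epsilon>_def)
  have "\<forall>n. \<exists>J::'a \<Rightarrow>\<^sub>L 'a. (\<forall>x. A (J x) + \<epsilon> n *\<^sub>R J x = x) \<and> (\<forall>x. J (A x) + \<epsilon> n *\<^sub>R J x = x)"
    using positive_resolvent[OF A e] by blast
  from choice[OF this] obtain J :: "nat \<Rightarrow> 'a \<Rightarrow>\<^sub>L 'a"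
    where J: "\<And>n x. A (J n x) + \<epsilon> n *\<^sub>R J n x = x" and J': "\<And>n x. J n (A x) + \<epsilon> n *\<^sub>R J n x = x"
    by blast
  have AJ: "norm (A (J n x)) \<le> norm x" for n x by (rule norm_positive_resolvent[OF A e J])
  \<comment> \<open>With \<open>y = (A + \<epsilon>)^(-1) R x\<close> one has \<open>|R y|^2 + \<epsilon> |y|^2 = <x, R y>\<close>.\<close>
  have small: "norm (\<epsilon> n *\<^sub>R J n (R x)) \<le> sqrt (\<epsilon> n) * norm x" for n x
  proof -
    define y where "y = J n (R x)"
    have "(norm (R y))\<^sup>2 + \<epsilon> n * (norm y)\<^sup>2 = (A y + \<epsilon> n *\<^sub>R y) \<bullet> y"
      by (simp add: power2_norm_eq_inner inner_left_distrib RR[symmetric] positive_semidefiniteD(1)[OF R(1)])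
    also have "\<dots> = x \<bullet> R y" using J[of n "R x"] by (simp add: y_def positive_semidefiniteD(1)[OF R(1)])
    also have "\<dots> \<le> norm x * norm (R y)" by (rule norm_cauchy_schwarz)
    finally have 1: "(norm (R y))\<^sup>2 + \<epsilon> n * (norm y)\<^sup>2 \<le> norm x * norm (R y)" .
    have "norm x * norm (R y) \<le> (norm x)\<^sup>2 + (norm (R y))\<^sup>2"
      using sum_squares_bound[of "norm x" "norm (R y)"] mult_nonneg_nonneg[OF norm_ge_zero[of x] norm_ge_zero[of "R y"]]
      by linarith
    then have "\<epsilon> n * (norm y)\<^sup>2 \<le> (norm x)\<^sup>2" using 1 by linarith
    then have "\<epsilon> n * (\<epsilon> n * (norm y)\<^sup>2) \<le> \<epsilon> n * (norm x)\<^sup>2"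
      using e[of n] by (intro mult_left_mono) auto
    moreover have "(norm (\<epsilon> n *\<^sub>R y))\<^sup>2 = \<epsilon> n * (\<epsilon> n * (norm y)\<^sup>2)"
      by (simp add: power_mult_distrib power2_eq_square)
    moreover have "(sqrt (\<epsilon> n) * norm x)\<^sup>2 = \<epsilon> n * (norm x)\<^sup>2"
      using e[of n] by (simp add: power_mult_distrib)
    ultimately have "(norm (\<epsilon> n *\<^sub>R y))\<^sup>2 \<le> (sqrt (\<epsilon> n) * norm x)\<^sup>2" by linarith
    then show ?thesis unfolding y_def by (rule power2_le_imp_le) (use e[of n] in simp)
  qed
  define W where "W n = S o\<^sub>L (J n o\<^sub>L R)" for n
  have diff: "norm (W n - W k) \<le> sqrt (\<epsilon> n) + sqrt (\<epsilon> k)" for n k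
  proof (rule norm_blinfun_bound)
    fix x
    have "norm ((W n - W k) x) = norm (S (J n (R x) - J k (R x)))"
      by (simp add: W_def blinfun.bilinear_simps)
    also have "\<dots> = norm (A (J n (R x)) - A (J k (R x)))" by (subst nA) (simp add: blinfun.diff_right)
    also have "A (J n (R x)) - A (J k (R x)) = \<epsilon> k *\<^sub>R J k (R x) - \<epsilon> n *\<^sub>R J n (R x)"
      using J[of n "R x"] J[of k "R x"] by (simp add: diff_eq_eq add_diff_eq eq_diff_eq add.commute)
    also have "norm \<dots> \<le> sqrt (\<epsilon> k) * norm x + sqrt (\<epsilon> n) * norm x"
      using norm_triangle_ineq4[of "\<epsilon> k *\<^sub>R J k (R x)" "\<epsilon> n *\<^sub>R J n (R x)"] small[of k x] small[of n x] by linarith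
    finally show "norm ((W n - W k) x) \<le> (sqrt (\<epsilon> n) + sqrt (\<epsilon> k)) * norm x" by (simp add: algebra_simps)
  qed (use less_imp_le[OF e] in \<open>intro add_nonneg_nonneg real_sqrt_ge_zero\<close>)
  have e0: "\<epsilon> \<longlonglongrightarrow> 0" unfolding \<epsilon>_def by (rule LIMSEQ_Suc[OF lim_1_over_n])
  then have s0: "(\<lambda>n. sqrt (\<epsilon> n)) \<longlonglongrightarrow> 0" using tendsto_real_sqrt by fastforce
  have "Cauchy W"
  proof (rule CauchyI)
    fix \<delta> :: real assume d: "\<delta> > 0"
    then have "\<forall>\<^sub>F n in sequentially. sqrt (\<epsilon> n) < \<delta> / 2" using s0 order_tendstoD(2) half_gt_zero by blast
    then obtain N where N: "\<And>n. n \<ge> N \<Longrightarrow> sqrt (\<epsilon> n) < \<delta> / 2" by (auto simp: eventually_sequentially)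
    have "norm (W m - W n) < \<delta>" if "m \<ge> N" "n \<ge> N" for m n
      using diff[of m n] N[OF that(1)] N[OF that(2)] by linarith
    then show "\<exists>M. \<forall>m\<ge>M. \<forall>n\<ge>M. norm (W m - W n) < \<delta>" by blast
  qed
  then obtain V where V: "W \<longlonglongrightarrow> V" using Cauchy_convergent convergent_def by blast
  have V': "(\<lambda>n. W n x) \<longlonglongrightarrow> V x" for x by (intro tendsto_intros V)
  show ?thesis
  proof (intro exI[of _ V] conjI allI)
    fix x
    have "(\<lambda>n. W n (R x) - S x) \<longlonglongrightarrow> 0"
    proof (rule Lim_null_comparison)
      show "\<forall>\<^sub>F n in sequentially. norm (W n (R x) - S x) \<le> \<epsilon> n * norm x"
      proof (intro always_eventually allI)
        fix n
        have "J n (A x) - x = - (\<epsilon> n *\<^sub>R J n x)"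
          by (subst (2) J'[of n x, symmetric]) (simp add: algebra_simps)
        then have "W n (R x) - S x = - (\<epsilon> n *\<^sub>R S (J n x))"
          by (simp add: W_def RR blinfun.diff_right[symmetric] blinfun.minus_right blinfun.scaleR_right)
        then show "norm (W n (R x) - S x) \<le> \<epsilon> n * norm x"
          using AJ[of n x] e[of n] by (simp add: nA)
      qed
      show "(\<lambda>n. \<epsilon> n * norm x) \<longlonglongrightarrow> 0" using tendsto_mult_right[OF e0, of "norm x"] by simp
    qed
    then have "(\<lambda>n. W n (R x)) \<longlonglongrightarrow> S x" by (rule LIM_zero_cancel)
    then show "V (R x) = S x" using V' LIMSEQ_unique by blast
    have "norm (W n x) \<le> norm (R x)" for n using AJ[of n "R x"] by (simp add: W_def nA)
    then show "norm (V x) \<le> norm (R x)" by (intro LIMSEQ_le_const2[OF tendsto_norm[OF V'[of x]]]) auto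
  qed
qed


definition complete_orthonormal :: "'a::real_inner set \<Rightarrow> bool" where
  "complete_orthonormal B \<longleftrightarrow> orthonormal B \<and> (\<forall>x. (\<forall>b\<in>B. x \<bullet> b = 0) \<longrightarrow> x = 0)"

lemma orthonormal_subset: "orthonormal B \<Longrightarrow> F \<subseteq> B \<Longrightarrow> orthonormal F"
  unfolding orthonormal_def by blast

lemma has_sum_metric:
  "(f has_sum l) A \<longleftrightarrow> (\<forall>\<epsilon>>0. \<exists>X. finite X \<and> X \<subseteq> A \<and>
     (\<forall>Y. finite Y \<and> X \<subseteq> Y \<and> Y \<subseteq> A \<longrightarrow> dist (sum f Y) l < \<epsilon>))"
  by (simp add: has_sum_def tendsto_iff eventually_finite_subsets_at_top)

lemma has_sum_finite_approximations:
  assumes "(f has_sum l) A" "\<epsilon> > 0"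
  obtains X where "finite X" "X \<subseteq> A" "\<And>Y. finite Y \<Longrightarrow> X \<subseteq> Y \<Longrightarrow> Y \<subseteq> A \<Longrightarrow> dist (sum f Y) l < \<epsilon>"
  using assms unfolding has_sum_metric by metis

text \<open>The functional \<open>z \<mapsto> \<Sum>b. <z, b> <x, b>\<close> is represented by a vector with the same coefficients as \<open>x\<close>,
  hence by \<open>x\<close>. Evaluating it at \<open>x\<close> gives Parseval's identity, and this turns into convergence of
  the expansion because partial sums are orthogonal projections.\<close>
lemma has_sum_orthonormal_expansion:
  fixes B :: "'a::{real_inner,banach} set"
  assumes B: "complete_orthonormal B"
  shows "((\<lambda>b. (x \<bullet> b) *\<^sub>R b) has_sum x) B"
proof -
  have on: "orthonormal F" if "F \<subseteq> B" for F
    using B that orthonormal_subset[of B F] by (simp add: complete_orthonormal_def)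
  have sq: "(\<lambda>b. (z \<bullet> b)\<^sup>2) summable_on B" for z :: 'a
    using bessel on by (intro nonneg_bdd_above_summable_on) (auto intro!: bdd_aboveI2)
  have fin: "(\<Sum>b\<in>F. \<bar>(z \<bullet> b) * (x \<bullet> b)\<bar>) \<le> norm x * norm z" if "finite F" "F \<subseteq> B" for F z
  proof -
    have "(\<Sum>b\<in>F. \<bar>(z \<bullet> b) * (x \<bullet> b)\<bar>) = (\<Sum>b\<in>F. \<bar>x \<bullet> b\<bar> * \<bar>z \<bullet> b\<bar>)"
      by (simp add: abs_mult mult.commute)
    also have "\<dots> \<le> L2_set (\<lambda>b. x \<bullet> b) F * L2_set (\<lambda>b. z \<bullet> b) F" by (rule L2_set_mult_ineq)
    also have "\<dots> \<le> norm x * norm z"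
      unfolding L2_set_def using bessel[OF that(1) on[OF that(2)]]
      by (intro mult_mono real_le_lsqrt) (auto intro: sum_nonneg)
    finally show ?thesis .
  qed
  have abs: "(\<lambda>b. norm ((z \<bullet> b) * (x \<bullet> b))) summable_on B" for z
    using fin by (intro nonneg_bdd_above_summable_on bdd_aboveI2[where M = "norm x * norm z"]) auto
  then have smb: "(\<lambda>b. (z \<bullet> b) * (x \<bullet> b)) summable_on B" for z by (rule abs_summable_summable)
  have "bounded_linear (\<lambda>z. \<Sum>\<^sub>\<infinity>b\<in>B. (z \<bullet> b) * (x \<bullet> b))"
  proof (rule bounded_linear_intro[where K = "norm x"])
    show "(\<Sum>\<^sub>\<infinity>b\<in>B. ((y + z) \<bullet> b) * (x \<bullet> b)) = (\<Sum>\<^sub>\<infinity>b\<in>B. (y \<bullet> b) * (x \<bullet> b)) + (\<Sum>\<^sub>\<infinity>b\<in>B. (z \<bullet> b) * (x \<bullet> b))" for y z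
      by (simp add: inner_left_distrib distrib_right infsum_add[OF smb smb])
    show "(\<Sum>\<^sub>\<infinity>b\<in>B. ((r *\<^sub>R z) \<bullet> b) * (x \<bullet> b)) = r *\<^sub>R (\<Sum>\<^sub>\<infinity>b\<in>B. (z \<bullet> b) * (x \<bullet> b))" for r z
      by (simp add: mult.assoc infsum_cmult_right')
    fix z
    have "norm (\<Sum>\<^sub>\<infinity>b\<in>B. (z \<bullet> b) * (x \<bullet> b)) \<le> (\<Sum>\<^sub>\<infinity>b\<in>B. norm ((z \<bullet> b) * (x \<bullet> b)))"
      by (rule norm_infsum_bound[OF abs])
    also have "\<dots> \<le> norm x * norm z" using fin by (intro infsum_le_finite_sums[OF abs]) auto
    finally show "norm (\<Sum>\<^sub>\<infinity>b\<in>B. (z \<bullet> b) * (x \<bullet> b)) \<le> norm z * norm x" by (simp add: mult.commute)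
  qed
  then obtain y where y: "\<And>z. (\<Sum>\<^sub>\<infinity>b\<in>B. (z \<bullet> b) * (x \<bullet> b)) = y \<bullet> z" using riesz_representation by blast
  have "(x - y) \<bullet> c = 0" if c: "c \<in> B" for c
  proof -
    have "y \<bullet> c = (\<Sum>\<^sub>\<infinity>b\<in>B. (c \<bullet> b) * (x \<bullet> b))" by (rule y[symmetric])
    also have "\<dots> = (\<Sum>\<^sub>\<infinity>b\<in>{c}. (c \<bullet> b) * (x \<bullet> b))"
      using on[OF subset_refl] c by (intro infsum_cong_neutral) (auto simp: orthonormal_def)
    also have "\<dots> = x \<bullet> c" using on[OF subset_refl] c by (simp add: orthonormal_def)
    finally show ?thesis by (simp add: inner_diff_left)
  qed
  then have "y = x" using B unfolding complete_orthonormal_def by (metis eq_iff_diff_eq_0)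
  then have parseval: "((\<lambda>b. (x \<bullet> b)\<^sup>2) has_sum (norm x)\<^sup>2) B"
    using y[of x] has_sum_infsum[OF sq[of x]]
    by (simp add: power2_norm_eq_inner) (simp add: power2_eq_square)
  show ?thesis
    unfolding has_sum_metric
  proof safe
    fix \<epsilon> :: real assume "\<epsilon> > 0"
    then have "\<epsilon>\<^sup>2 > 0" by simp
    then obtain X where X: "finite X" "X \<subseteq> B"
      and X': "\<And>Y. finite Y \<Longrightarrow> X \<subseteq> Y \<Longrightarrow> Y \<subseteq> B \<Longrightarrow> dist (\<Sum>b\<in>Y. (x \<bullet> b)\<^sup>2) ((norm x)\<^sup>2) < \<epsilon>\<^sup>2"
      by (rule has_sum_finite_approximations[OF parseval]) blast
    show "\<exists>X. finite X \<and> X \<subseteq> B \<and> (\<forall>Y. finite Y \<and> X \<subseteq> Y \<and> Y \<subseteq> B \<longrightarrow> dist (\<Sum>b\<in>Y. (x \<bullet> b) *\<^sub>R b) x < \<epsilon>)"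
    proof (intro exI[of _ X] conjI allI impI X)
      fix Y assume Y: "finite Y \<and> X \<subseteq> Y \<and> Y \<subseteq> B"
      let ?y = "\<Sum>b\<in>Y. (x \<bullet> b) *\<^sub>R b"
      have 1: "?y \<bullet> ?y = (\<Sum>b\<in>Y. (x \<bullet> b)\<^sup>2)"
        using Y on by (subst inner_orthonormal_sum) (auto simp: power2_eq_square)
      have 2: "x \<bullet> ?y = (\<Sum>b\<in>Y. (x \<bullet> b)\<^sup>2)" by (simp add: inner_sum_right power2_eq_square)
      have "(dist ?y x)\<^sup>2 = (norm x)\<^sup>2 - (\<Sum>b\<in>Y. (x \<bullet> b)\<^sup>2)"
        unfolding dist_norm power2_norm_eq_inner
        by (simp only: inner_diff_left inner_diff_right 1 2 inner_commute[of ?y x])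
      also have "\<dots> < \<epsilon>\<^sup>2" using X'[of Y] Y by (simp add: dist_real_def)
      finally show "dist ?y x < \<epsilon>" using \<open>\<epsilon> > 0\<close> by (intro power2_less_imp_less[of _ \<epsilon>]) auto
    qed
  qed
qed

text \<open>Expanding \<open>R x\<close> in the basis and applying \<open>V\<close> gives \<open>S x = \<Sum>b\<in>B. <x, R b> V b\<close>, a sum of
  operators of rank one with nuclear bounds \<open>|R b| |V b| \<le> |R b|^2\<close>.\<close>
lemma nuclear_bound_of_expansion:
  fixes S R V :: "'a::{real_inner,banach} \<Rightarrow>\<^sub>L 'a"
  assumes B: "complete_orthonormal B" and R: "positive_semidefinite R"
    and V: "\<And>x. V (R x) = S x" "\<And>x. norm (V x) \<le> norm (R x)"
    and B': "finite B'" "B' \<subseteq> B"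
    and bound: "\<And>F. finite F \<Longrightarrow> F \<subseteq> B - B' \<Longrightarrow> (\<Sum>b\<in>F. (norm (R b))\<^sup>2) \<le> C"
  shows "nuclear_bound (\<lambda>x. S x - (\<Sum>b\<in>B'. (x \<bullet> R b) *\<^sub>R V b)) C"
proof (rule nuclear_boundI)
  fix F :: "'a set" and U :: "'a \<Rightarrow> 'a"
  assume F: "finite F" "orthonormal F" and U: "linear U" "\<And>x. norm (U x) \<le> norm x"
  define g where "g b = (\<Sum>e\<in>F. (e \<bullet> R b) * (V b \<bullet> U e))" for b
  have "((\<lambda>b. (e \<bullet> R b) * (V b \<bullet> U e)) has_sum (S e \<bullet> U e)) B" for e
  proof -
    have bl: "bounded_linear (\<lambda>y. V y \<bullet> U e)" by (intro bounded_linear_intros)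
    have "((\<lambda>b. V ((R e \<bullet> b) *\<^sub>R b) \<bullet> U e) has_sum (V (R e) \<bullet> U e)) B"
      using has_sum_bounded_linear[OF bl has_sum_orthonormal_expansion[OF B, of "R e"]] by (simp add: o_def)
    then show ?thesis
      by (simp add: V blinfun.scaleR_right positive_semidefiniteD(1)[OF R])
  qed
  then have g: "(g has_sum (\<Sum>e\<in>F. S e \<bullet> U e)) B"
  proof -
    assume *: "\<And>e. ((\<lambda>b. (e \<bullet> R b) * (V b \<bullet> U e)) has_sum (S e \<bullet> U e)) B"
    show ?thesis
      unfolding g_def using F(1) by (induction F rule: finite_induct) (auto intro: has_sum_add *)
  qed
  have tail: "(\<Sum>b\<in>G. g b) \<le> C" if G: "finite G" "G \<subseteq> B - B'" for G
  proof -
    have "g b \<le> (norm (R b))\<^sup>2" for b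
    proof -
      have "g b \<le> norm (R b) * norm (V b)"
        using nuclear_boundD[OF nuclear_bound_rank_one F U, of "R b" "V b"] by (simp add: g_def)
      also have "\<dots> \<le> norm (R b) * norm (R b)" using V(2) by (intro mult_left_mono) auto
      finally show ?thesis by (simp add: power2_eq_square)
    qed
    then have "(\<Sum>b\<in>G. g b) \<le> (\<Sum>b\<in>G. (norm (R b))\<^sup>2)" by (intro sum_mono)
    also have "\<dots> \<le> C" by (rule bound[OF G])
    finally show ?thesis .
  qed
  have "(\<Sum>e\<in>F. S e \<bullet> U e) \<le> (\<Sum>b\<in>B'. g b) + C"
  proof (rule field_le_epsilon)
    fix \<epsilon> :: real assume "\<epsilon> > 0"
    then obtain X where X: "finite X" "X \<subseteq> B"
      and X': "\<And>Y. finite Y \<Longrightarrow> X \<subseteq> Y \<Longrightarrow> Y \<subseteq> B \<Longrightarrow> dist (sum g Y) (\<Sum>e\<in>F. S e \<bullet> U e) < \<epsilon>"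
      by (rule has_sum_finite_approximations[OF g]) blast
    have "dist (sum g (B' \<union> X)) (\<Sum>e\<in>F. S e \<bullet> U e) < \<epsilon>" using X B' by (intro X') auto
    moreover have "sum g (B' \<union> X) = sum g B' + sum g (X - B')"
      using X B' by (subst sum.union_disjoint[symmetric]) (auto intro: arg_cong[of _ _ "sum g"])
    moreover have "sum g (X - B') \<le> C" using X by (intro tail) auto
    ultimately show "(\<Sum>e\<in>F. S e \<bullet> U e) \<le> (\<Sum>b\<in>B'. g b) + C + \<epsilon>" by (simp add: dist_real_def)
  qed
  moreover have "(\<Sum>e\<in>F. (S e - (\<Sum>b\<in>B'. (e \<bullet> R b) *\<^sub>R V b)) \<bullet> U e) = (\<Sum>e\<in>F. S e \<bullet> U e) - (\<Sum>b\<in>B'. g b)"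
    unfolding g_def by (subst sum.swap) (simp add: inner_diff_left inner_sum_left sum_subtractf)
  ultimately show "(\<Sum>e\<in>F. (S e - (\<Sum>b\<in>B'. (e \<bullet> R b) *\<^sub>R V b)) \<bullet> U e) \<le> C" by simp
qed

text \<open>A tail of the convergent sum of \<open>|R b|^2\<close> is a nuclear bound of the remainder.\<close>
lemma finite_rank_approximation:
  fixes S R V :: "'a::{real_inner,banach} \<Rightarrow>\<^sub>L 'a"
  assumes B: "complete_orthonormal B" and R: "positive_semidefinite R"
    and V: "\<And>x. V (R x) = S x" "\<And>x. norm (V x) \<le> norm (R x)"
    and bound: "\<And>F. finite F \<Longrightarrow> F \<subseteq> B \<Longrightarrow> (\<Sum>b\<in>F. (norm (R b))\<^sup>2) \<le> C"
    and "\<epsilon> > 0"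
  shows "\<exists>B'. finite B' \<and> nuclear_bound (\<lambda>x. S x - (\<Sum>b\<in>B'. (x \<bullet> R b) *\<^sub>R V b)) \<epsilon>"
proof -
  let ?r = "\<lambda>b. (norm (R b))\<^sup>2"
  have smb: "?r summable_on B"
    using bound by (intro nonneg_bdd_above_summable_on) (auto intro!: bdd_aboveI2)
  obtain B' where B': "finite B'" "B' \<subseteq> B"
    and close: "\<And>Y. finite Y \<Longrightarrow> B' \<subseteq> Y \<Longrightarrow> Y \<subseteq> B \<Longrightarrow> dist (sum ?r Y) (infsum ?r B) < \<epsilon> / 2"
    by (rule has_sum_finite_approximations[OF has_sum_infsum[OF smb] half_gt_zero[OF \<open>\<epsilon> > 0\<close>]]) blast
  have "(\<Sum>b\<in>F. ?r b) \<le> \<epsilon>" if F: "finite F" "F \<subseteq> B - B'" for F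
  proof -
    have "sum ?r (B' \<union> F) = sum ?r B' + sum ?r F" using F B' by (intro sum.union_disjoint) auto
    moreover have "dist (sum ?r (B' \<union> F)) (infsum ?r B) < \<epsilon> / 2" "dist (sum ?r B') (infsum ?r B) < \<epsilon> / 2"
      using F B' by (intro close; auto)+
    ultimately show ?thesis by (simp only: dist_real_def abs_if split: if_splits)
  qed
  then show ?thesis using nuclear_bound_of_expansion[OF B R V B'] B' by blast
qed

section \<open>The Hilbert space of square-integrable functions\<close>

lemma square_integrable_rep: "square_integrable (rep_L2 x)"
  using Quotient3_rel_rep[OF Quotient3_L2] Quotient3_rep_reflp[OF Quotient3_L2] by (metis L2_rel_def)

lemma abs_rep_L2: "abs_L2 (rep_L2 x) = x"
  by (rule Quotient3_abs_rep[OF Quotient3_L2])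

lemma L2_rel_refl: "square_integrable f \<Longrightarrow> L2_rel f f"
  by (simp add: L2_rel_def)

lemma square_integrable_uminus: "square_integrable f \<Longrightarrow> square_integrable (\<lambda>t. - f t)"
  by (auto simp: square_integrable_def)

lemma square_integrable_diff:
  "square_integrable f \<Longrightarrow> square_integrable g \<Longrightarrow> square_integrable (\<lambda>t. f t - g t)"
  using square_integrable_add[of f "\<lambda>t. - g t"] square_integrable_uminus[of g] by simp

lemma abs_L2_diff:
  assumes "square_integrable f" "square_integrable g"
  shows "abs_L2 f - abs_L2 g = abs_L2 (\<lambda>t. f t - g t)"
  using assms by (simp add: minus_L2_def uminus_L2.abs_eq plus_L2.abs_eq L2_rel_refl square_integrable_uminus)

lemma norm_abs_L2:
  assumes "square_integrable f"
  shows "(norm (abs_L2 f))\<^sup>2 = (LINT t|lborel. (norm (f t))\<^sup>2)"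
  using assms by (simp add: power2_norm_eq_inner inner_L2_def cinner.abs_eq L2_rel_refl integral_mult_cnj)

lemma nn_integral_square_eq_norm:
  assumes "square_integrable f"
  shows "(\<integral>\<^sup>+t. ennreal ((norm (f t))\<^sup>2) \<partial>lborel) = ennreal ((norm (abs_L2 f))\<^sup>2)"
  using assms unfolding norm_abs_L2[OF assms]
  by (intro nn_integral_eq_integral) (auto simp: square_integrable_def)

lemma square_integrableI_nn_integral:
  fixes f :: "real^'n \<Rightarrow> complex"
  assumes f: "f \<in> borel_measurable borel" and fin: "(\<integral>\<^sup>+t. ennreal ((norm (f t))\<^sup>2) \<partial>lborel) < \<infinity>"
  shows "square_integrable f"
  unfolding square_integrable_def
proof
  show "integrable lborel (\<lambda>t. (norm (f t))\<^sup>2)"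
    using f fin by (intro integrableI_bounded) auto
qed (rule f)

text \<open>Dominated convergence in \<open>L2\<close>, on which the continuity of time-frequency shifts rests.\<close>
lemma norm_abs_L2_dominated_limit:
  fixes f :: "nat \<Rightarrow> real^'n \<Rightarrow> complex"
  assumes m: "\<And>n. f n \<in> borel_measurable borel" "g \<in> borel_measurable borel"
    and lim: "AE t in lborel. (\<lambda>n. f n t) \<longlonglongrightarrow> g t"
    and w: "w \<in> borel_measurable borel" "integrable lborel (\<lambda>t. (w t :: real)\<^sup>2)"
    and dom: "\<And>n t. norm (f n t) \<le> w t"
  shows "square_integrable (f n)" "square_integrable g"
    "(\<lambda>n. abs_L2 (f n)) \<longlonglongrightarrow> abs_L2 g"
proof -
  show fs: "square_integrable (f n)" for n
    unfolding square_integrable_def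
    using m by (intro conjI Bochner_Integration.integrable_bound[OF w(2)])
      (auto intro!: AE_I2 power_mono dom)
  have gw: "AE t in lborel. norm (g t) \<le> w t"
    using lim
  proof eventually_elim
    fix t assume "(\<lambda>n. f n t) \<longlonglongrightarrow> g t"
    from tendsto_norm[OF this] show "norm (g t) \<le> w t"
      by (rule LIMSEQ_le_const2) (use dom in blast)
  qed
  show gs: "square_integrable g"
    unfolding square_integrable_def
  proof (intro conjI m Bochner_Integration.integrable_bound[OF w(2)])
    show "AE t in lborel. norm ((norm (g t))\<^sup>2) \<le> norm ((w t)\<^sup>2)"
      using gw by eventually_elim (auto intro: power_mono)
  qed (use m in auto)
  have "(\<lambda>n. LINT t|lborel. (norm (f n t - g t))\<^sup>2) \<longlonglongrightarrow> (LINT t::real^'n|lborel. 0 :: real)"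
  proof (rule integral_dominated_convergence[where w = "\<lambda>t. 4 * (w t)\<^sup>2"])
    show "AE t in lborel. (\<lambda>n. (norm (f n t - g t))\<^sup>2) \<longlonglongrightarrow> 0"
      using lim
    proof eventually_elim
      fix t assume "(\<lambda>n. f n t) \<longlonglongrightarrow> g t"
      then have "(\<lambda>n. (norm (f n t - g t))\<^sup>2) \<longlonglongrightarrow> (norm (g t - g t))\<^sup>2" by (intro tendsto_intros)
      then show "(\<lambda>n. (norm (f n t - g t))\<^sup>2) \<longlonglongrightarrow> 0" by simp
    qed
    show "AE t in lborel. norm ((norm (f n t - g t))\<^sup>2) \<le> 4 * (w t)\<^sup>2" for n
      using gw
    proof eventually_elim
      fix t assume "norm (g t) \<le> w t"
      then have "norm (f n t - g t) \<le> 2 * w t" using dom[of n t] norm_triangle_ineq4[of "f n t" "g t"] by linarith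
      then have "(norm (f n t - g t))\<^sup>2 \<le> (2 * w t)\<^sup>2" by (intro power_mono) auto
      then show "norm ((norm (f n t - g t))\<^sup>2) \<le> 4 * (w t)\<^sup>2" by (simp add: power_mult_distrib)
    qed
  qed (use w m in auto)
  then have "(\<lambda>n. (norm (abs_L2 (f n) - abs_L2 g))\<^sup>2) \<longlonglongrightarrow> 0"
    by (simp add: abs_L2_diff fs gs norm_abs_L2 square_integrable_diff)
  then have "(\<lambda>n. sqrt ((norm (abs_L2 (f n) - abs_L2 g))\<^sup>2)) \<longlonglongrightarrow> sqrt 0" by (rule tendsto_real_sqrt)
  then show "(\<lambda>n. abs_L2 (f n)) \<longlonglongrightarrow> abs_L2 g"
    by (simp add: tendsto_norm_zero_iff LIM_zero_iff)
qed

text \<open>The increments \<open>d k\<close> satisfy \<open>\<Sum>k. 2^k |d k t|^2 < \<infinity>\<close> for almost all \<open>t\<close>, since the integral of this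
  sum is finite. By the inequality of arithmetic and geometric means \<open>|d k t|\<close> is at most
  \<open>2^(-k) + 2^k |d k t|^2\<close>, so the increments are absolutely summable.\<close>
lemma rapidly_Cauchy_AE_convergent:
  fixes f :: "nat \<Rightarrow> real^'n \<Rightarrow> complex"
  assumes f: "\<And>k. square_integrable (f k)"
    and step: "\<And>k. norm (abs_L2 (f (Suc k)) - abs_L2 (f k)) \<le> (1/2) ^ k"
  shows "AE t in lborel. convergent (\<lambda>k. f k t)"
proof -
  define d where "d k t = f (Suc k) t - f k t" for k t
  have ds: "square_integrable (d k)" for k unfolding d_def by (intro square_integrable_diff f)
  then have dm[measurable]: "d k \<in> borel_measurable borel" for k by (simp add: square_integrable_def)
  have dn: "(\<integral>\<^sup>+t. ennreal (2 ^ k * (norm (d k t))\<^sup>2) \<partial>lborel) \<le> ennreal ((1/2) ^ k)" for k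
  proof -
    have "(\<integral>\<^sup>+t. ennreal (2 ^ k * (norm (d k t))\<^sup>2) \<partial>lborel) = ennreal (2 ^ k) * ennreal ((norm (abs_L2 (d k)))\<^sup>2)"
      by (simp add: ennreal_mult nn_integral_cmult nn_integral_square_eq_norm[OF ds])
    also have "\<dots> = ennreal (2 ^ k * (norm (abs_L2 (f (Suc k)) - abs_L2 (f k)))\<^sup>2)"
      unfolding d_def by (simp add: abs_L2_diff f ennreal_mult)
    also have "\<dots> \<le> ennreal (2 ^ k * ((1/2) ^ k)\<^sup>2)"
      by (intro ennreal_leI mult_left_mono power_mono step) auto
    also have "2 ^ k * ((1/2) ^ k)\<^sup>2 = (1/2 :: real) ^ k"
      by (simp add: power2_eq_square flip: power_mult_distrib)
    finally show ?thesis .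
  qed
  have "(\<integral>\<^sup>+t. (\<Sum>k. ennreal (2 ^ k * (norm (d k t))\<^sup>2)) \<partial>lborel)
      = (\<Sum>k. \<integral>\<^sup>+t. ennreal (2 ^ k * (norm (d k t))\<^sup>2) \<partial>lborel)"
    by (intro nn_integral_suminf) simp
  also have "\<dots> \<le> (\<Sum>k. ennreal ((1/2) ^ k))" by (intro suminf_le dn) auto
  also have "\<dots> < \<infinity>"
    using summable_geometric[of "1/2 :: real"] by (simp add: ennreal_suminf_neq_top less_top)
  finally have "(\<integral>\<^sup>+t. (\<Sum>k. ennreal (2 ^ k * (norm (d k t))\<^sup>2)) \<partial>lborel) < \<infinity>" .
  then have "(\<integral>\<^sup>+t. (\<Sum>k. ennreal (2 ^ k * (norm (d k t))\<^sup>2)) \<partial>lborel) \<noteq> \<infinity>" by simp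
  then have "AE t in lborel. (\<Sum>k. ennreal (2 ^ k * (norm (d k t))\<^sup>2)) \<noteq> \<infinity>"
    by (intro nn_integral_PInf_AE) simp_all
  then show ?thesis
  proof eventually_elim
    fix t assume "(\<Sum>k. ennreal (2 ^ k * (norm (d k t))\<^sup>2)) \<noteq> \<infinity>"
    then have s: "summable (\<lambda>k. 2 ^ k * (norm (d k t))\<^sup>2)"
      by (intro summable_suminf_not_top) auto
    have "summable (\<lambda>k. d k t)"
    proof (rule summable_comparison_test'[OF summable_add[OF summable_geometric[of "1/2 :: real"] s]])
      fix k
      have "0 \<le> ((1/2) ^ k - norm (d k t))\<^sup>2" by simp
      then have "0 \<le> 2 ^ k * (((1/2) ^ k)\<^sup>2 + (norm (d k t))\<^sup>2 - 2 * (1/2) ^ k * norm (d k t))"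
        by (simp add: power2_diff)
      also have "\<dots> = 2 ^ k * (1/2) ^ k * ((1/2) ^ k) + 2 ^ k * (norm (d k t))\<^sup>2 - 2 * (2 ^ k * (1/2) ^ k) * norm (d k t)"
        by (simp only: power2_eq_square algebra_simps)
      also have "2 ^ k * (1/2) ^ k = (1 :: real)" by (simp flip: power_mult_distrib)
      finally have "2 * norm (d k t) \<le> (1/2) ^ k + 2 ^ k * (norm (d k t))\<^sup>2" by simp
      then show "norm (d k t) \<le> (1/2) ^ k + 2 ^ k * (norm (d k t))\<^sup>2"
        using norm_ge_zero[of "d k t"] by linarith
    qed simp
    then have "convergent (\<lambda>k. f 0 t + (\<Sum>i<k. d i t))"
      by (intro convergent_add convergent_const) (simp add: summable_iff_convergent)
    moreover have "f 0 t + (\<Sum>i<k. d i t) = f k t" for k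
      using sum_lessThan_telescope[of "\<lambda>i. f i t" k] by (simp add: d_def)
    ultimately show "convergent (\<lambda>k. f k t)" by simp
  qed
qed

text \<open>The Riesz-Fischer theorem: a rapidly Cauchy subsequence converges almost everywhere, and Fatou's
  lemma shows that its pointwise limit is also the limit in \<open>L2\<close>.\<close>
instance L2 :: (finite) complete_space
proof
  fix X :: "nat \<Rightarrow> 'a L2"
  assume X: "Cauchy X"
  have "\<exists>r. strict_mono r \<and> (\<forall>k. norm (X (r (Suc k)) - X (r k)) \<le> (1/2) ^ k)"
  proof -
    have "\<exists>N. \<forall>m\<ge>N. \<forall>n\<ge>N. norm (X m - X n) < (1/2) ^ k" for k :: nat
      using CauchyD[OF X, of "(1/2) ^ k"] by simp
    then obtain N where N: "\<And>k m n. m \<ge> N k \<Longrightarrow> n \<ge> N k \<Longrightarrow> norm (X m - X n) < (1/2) ^ k" by metis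
    define r where "r = rec_nat (N 0) (\<lambda>k rk. max (Suc rk) (N (Suc k)))"
    have r0: "r 0 = N 0" and rS: "r (Suc k) = max (Suc (r k)) (N (Suc k))" for k
      by (simp_all add: r_def)
    have r: "r k < r (Suc k)" for k by (simp add: rS)
    have Nr: "N k \<le> r k" for k by (cases k) (simp_all add: r0 rS)
    have "norm (X (r (Suc k)) - X (r k)) \<le> (1/2) ^ k" for k
      by (rule less_imp_le, rule N[where k = k]) (use r[of k] Nr[of k] in linarith)+
    moreover have "strict_mono r" using r by (simp add: strict_mono_Suc_iff)
    ultimately show ?thesis by blast
  qed
  then obtain r where r: "strict_mono r" and step: "\<And>k. norm (X (r (Suc k)) - X (r k)) \<le> (1/2) ^ k" by blast
  define f where "f k = rep_L2 (X (r k))" for k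
  have fs: "square_integrable (f k)" and fX: "abs_L2 (f k) = X (r k)" for k
    by (simp_all add: f_def square_integrable_rep abs_rep_L2)
  have fm[measurable]: "f k \<in> borel_measurable borel" for k using fs by (simp add: square_integrable_def)
  have conv: "AE t in lborel. convergent (\<lambda>k. f k t)"
    by (rule rapidly_Cauchy_AE_convergent[OF fs]) (simp add: fX step)
  define g where "g t = lim (\<lambda>k. f k t)" for t
  have gm[measurable]: "g \<in> borel_measurable borel" unfolding g_def by (rule borel_measurable_lim_metric) simp
  have tail: "square_integrable (\<lambda>t. g t - f k t) \<and> norm (abs_L2 (\<lambda>t. g t - f k t)) \<le> e"
    if e: "e > 0" and k: "\<And>j. j \<ge> k \<Longrightarrow> norm (X (r j) - X (r k)) \<le> e" for e k
  proof -
    have "(\<integral>\<^sup>+t. ennreal ((norm (g t - f k t))\<^sup>2) \<partial>lborel)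
        = (\<integral>\<^sup>+t. liminf (\<lambda>j. ennreal ((norm (f j t - f k t))\<^sup>2)) \<partial>lborel)"
    proof (rule nn_integral_cong_AE)
      show "AE t in lborel. ennreal ((norm (g t - f k t))\<^sup>2) = liminf (\<lambda>j. ennreal ((norm (f j t - f k t))\<^sup>2))"
        using conv
      proof eventually_elim
        fix t assume "convergent (\<lambda>j. f j t)"
        then have "(\<lambda>j. f j t) \<longlonglongrightarrow> g t" by (simp add: g_def convergent_LIMSEQ_iff)
        then have "(\<lambda>j. ennreal ((norm (f j t - f k t))\<^sup>2)) \<longlonglongrightarrow> ennreal ((norm (g t - f k t))\<^sup>2)"
          by (intro tendsto_intros)
        then show "ennreal ((norm (g t - f k t))\<^sup>2) = liminf (\<lambda>j. ennreal ((norm (f j t - f k t))\<^sup>2))"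
          by (intro lim_imp_Liminf[symmetric]) auto
      qed
    qed
    also have "\<dots> \<le> liminf (\<lambda>j. \<integral>\<^sup>+t. ennreal ((norm (f j t - f k t))\<^sup>2) \<partial>lborel)"
      by (intro nn_integral_liminf) simp
    also have "\<dots> \<le> ennreal (e\<^sup>2)"
    proof -
      have "(\<integral>\<^sup>+t. ennreal ((norm (f j t - f k t))\<^sup>2) \<partial>lborel) \<le> ennreal (e\<^sup>2)" if "j \<ge> k" for j
        using k[OF that] by (simp add: nn_integral_square_eq_norm square_integrable_diff fs fX power_mono ennreal_leI
            flip: abs_L2_diff)
      then have "liminf (\<lambda>j. \<integral>\<^sup>+t. ennreal ((norm (f j t - f k t))\<^sup>2) \<partial>lborel) \<le> liminf (\<lambda>j. ennreal (e\<^sup>2))"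
        by (intro Liminf_mono) (auto simp: eventually_sequentially)
      then show ?thesis by (simp add: Liminf_const)
    qed
    finally have le: "(\<integral>\<^sup>+t. ennreal ((norm (g t - f k t))\<^sup>2) \<partial>lborel) \<le> ennreal (e\<^sup>2)" .
    have s: "square_integrable (\<lambda>t. g t - f k t)"
      by (rule square_integrableI_nn_integral) (use le in \<open>auto intro: le_less_trans\<close>)
    have "(norm (abs_L2 (\<lambda>t. g t - f k t)))\<^sup>2 \<le> e\<^sup>2" using le by (simp add: nn_integral_square_eq_norm[OF s])
    then have "norm (abs_L2 (\<lambda>t. g t - f k t)) \<le> e" by (rule power2_le_imp_le) (use e in simp)
    then show ?thesis using s by blast
  qed
  have ev: "\<exists>K. \<forall>k\<ge>K. \<forall>j\<ge>k. norm (X (r j) - X (r k)) \<le> e" if e: "e > 0" for e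
  proof -
    obtain M where M: "\<And>m n. m \<ge> M \<Longrightarrow> n \<ge> M \<Longrightarrow> norm (X m - X n) < e" using CauchyD[OF X e] by blast
    have "norm (X (r j) - X (r k)) \<le> e" if "M \<le> k" "k \<le> j" for j k
      using M[of "r j" "r k"] seq_suble[OF r, of j] seq_suble[OF r, of k] that by simp
    then show ?thesis by blast
  qed
  obtain k0 where "\<forall>k\<ge>k0. \<forall>j\<ge>k. norm (X (r j) - X (r k)) \<le> 1" using ev[of 1] by auto
  then have "square_integrable (\<lambda>t. g t - f k0 t)" using tail[of 1 k0] by simp
  then have gs: "square_integrable g" using square_integrable_add[OF _ fs[of k0]] by force
  have "(X \<circ> r) \<longlonglongrightarrow> abs_L2 g"
  proof (rule LIMSEQ_I)
    fix e :: real assume e: "e > 0"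
    obtain K where "\<forall>k\<ge>K. \<forall>j\<ge>k. norm (X (r j) - X (r k)) \<le> e / 2" using ev[of "e/2"] e by auto
    then have "norm (abs_L2 g - X (r k)) \<le> e / 2" if "k \<ge> K" for k
      using tail[of "e/2" k] e that by (simp add: gs fs abs_L2_diff flip: fX)
    then show "\<exists>no. \<forall>n\<ge>no. norm ((X \<circ> r) n - abs_L2 g) < e"
      using e by (intro exI[of _ K]) (force simp: norm_minus_commute)
  qed
  then show "convergent X"
    using X r Cauchy_converges_subseq convergentI by blast
qed

instance L2 :: (finite) banach ..

lemma cscale_one[simp]: "cscale 1 x = x"
  and cscale_cscale: "cscale c (cscale d x) = cscale (c * d) x"
  and cscale_add_right: "cscale c (x + y) = cscale c x + cscale c y"
  and scaleR_eq_cscale: "r *\<^sub>R x = cscale (of_real r) x"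
  by (simp_all add: L2_vector_axioms scaleR_L2_def)

lemma cinner_cscale_right: "cinner x (cscale c y) = cnj c * cinner x y"
  by (subst cinner_commute) (simp add: cinner_cscale_left cinner_commute[of x y])

lemma cinner_add_right: "cinner x (y + z) = cinner x y + cinner x z"
  by (subst cinner_commute) (simp add: cinner_add_left cinner_commute[of x])

text \<open>The real inner product determines the complex one. This transfers results on real Hilbert spaces
  to complex-linear operators.\<close>
lemma cinner_eq_inner: "cinner x y = Complex (x \<bullet> y) (x \<bullet> cscale \<i> y)"
  by (simp add: inner_L2_def cinner_cscale_right complex_eq_iff)

lemma norm_cscale[simp]: "norm (cscale c x) = norm c * norm x"
proof -
  have "(norm (cscale c x))\<^sup>2 = (norm c * norm x)\<^sup>2"
    unfolding power_mult_distrib power2_norm_eq_inner[of "cscale c x"] power2_norm_eq_inner[of x] inner_L2_def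
    using cinner_self(1)[of x]
    by (simp add: cinner_cscale_left cinner_cscale_right complex_norm_square[symmetric] mult.assoc[symmetric]
        del: of_real_power) (simp add: cmod_power2 flip: power2_eq_square)
  then show ?thesis by (simp add: power2_eq_iff_nonneg)
qed

lemma cinner_cauchy_schwarz: "norm (cinner x y) \<le> norm x * norm y"
proof (cases "cinner x y = 0")
  case False
  define c where "c = cinner x y / of_real (norm (cinner x y))"
  have c: "norm c = 1" using False by (simp add: c_def norm_divide)
  have "cinner x (cscale c y) = of_real (norm (cinner x y))"
    using False complex_norm_square[of "cinner x y"]
    by (simp add: cinner_cscale_right c_def power2_eq_square field_simps)
  then have "norm (cinner x y) = x \<bullet> cscale c y" by (simp add: inner_L2_def)
  also have "\<dots> \<le> norm x * norm (cscale c y)" by (rule norm_cauchy_schwarz)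
  finally show ?thesis using c by simp
qed simp

lemma bounded_bilinear_cinner: "bounded_bilinear cinner"
proof
  show "\<exists>K. \<forall>a b. norm (cinner a b) \<le> norm a * norm b * K"
    by (intro exI[of _ 1]) (simp add: cinner_cauchy_schwarz)
qed (simp_all add: cinner_add_left cinner_add_right scaleR_eq_cscale cinner_cscale_left cinner_cscale_right scaleR_conv_of_real)

lemma bounded_linear_cscale: "bounded_linear (cscale c)"
  by (rule bounded_linear_intro[where K = "norm c"])
    (simp_all add: cscale_add_right scaleR_eq_cscale cscale_cscale mult.commute)

lemma cinner_ext: "(\<And>z. cinner x z = cinner y z) \<Longrightarrow> x = y"
  by (rule vector_eq_rdot[THEN iffD1]) (simp add: inner_L2_def inner_commute[of _ "x"] inner_commute[of _ "y"])

section \<open>Adjoint, modulus and trace norm\<close>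

lemma bounded_op_blinfun: "bounded_op T \<Longrightarrow> blinfun_apply (Blinfun T) = T"
  by (simp add: bounded_op_def bounded_linear_Blinfun_apply)

text \<open>This yields both the adjoint and the weakly defined convolution operators: for fixed \<open>x\<close> the
  functional \<open>y \<mapsto> Re (B x y)\<close> is represented by a vector.\<close>
lemma sesquilinear_representation:
  fixes B :: "('n::finite) L2 \<Rightarrow> 'n L2 \<Rightarrow> complex"
  assumes add1: "\<And>x y z. B (x + y) z = B x z + B y z" and scale1: "\<And>c x z. B (cscale c x) z = c * B x z"
    and add2: "\<And>x y z. B x (y + z) = B x y + B x z" and scale2: "\<And>c x z. B x (cscale c z) = cnj c * B x z"
    and bound: "\<And>x y. norm (B x y) \<le> K * norm x * norm y"
  shows "\<exists>!T. bounded_op T \<and> (\<forall>x y. cinner (T x) y = B x y)"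
proof -
  have "\<exists>u. \<forall>y. Re (B x y) = u \<bullet> y" for x
  proof -
    have "bounded_linear (\<lambda>y. Re (B x y))"
    proof (rule bounded_linear_intro[where K = "K * norm x"])
      show "norm (Re (B x y)) \<le> norm y * (K * norm x)" for y
        using abs_Re_le_cmod[of "B x y"] bound[of x y] by (simp add: mult.commute)
    qed (simp_all add: add2 scale2 scaleR_eq_cscale)
    then show ?thesis using riesz_representation by metis
  qed
  then obtain T where T: "\<And>x y. Re (B x y) = T x \<bullet> y" by metis
  have TB: "cinner (T x) y = B x y" for x y
    unfolding cinner_eq_inner T[symmetric] by (simp add: scale2 complex_eq_iff)
  have "bounded_linear T"
  proof (rule bounded_linear_intro[where K = K])
    show "T (x + y) = T x + T y" for x y
      by (rule cinner_ext) (simp add: TB add1 cinner_add_left)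
    show "T (r *\<^sub>R x) = r *\<^sub>R T x" for r x
      by (rule cinner_ext) (simp add: TB scale1 scaleR_eq_cscale cinner_cscale_left)
    fix x
    have "norm (T x) * norm (T x) = Re (B x (T x))" by (simp add: T power2_norm_eq_inner[symmetric] power2_eq_square)
    also have "\<dots> \<le> (norm x * K) * norm (T x)"
      using complex_Re_le_cmod[of "B x (T x)"] bound[of x "T x"] by (simp add: mult_ac)
    finally have le: "norm (T x) * norm (T x) \<le> (norm x * K) * norm (T x)" .
    show "norm (T x) \<le> norm x * K"
    proof (cases "T x = 0")
      case True
      show ?thesis
      proof (cases "x = 0")
        case False
        have "0 \<le> K * norm x * norm x" using bound[of x x] norm_ge_zero order_trans by blast
        then show ?thesis using True False by (simp add: zero_le_mult_iff)
      qed (use True in simp)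
    next
      case False
      then show ?thesis using le by simp
    qed
  qed
  moreover have "T (cscale c x) = cscale c (T x)" for c x
    by (rule cinner_ext) (simp add: TB scale1 cinner_cscale_left)
  ultimately have "bounded_op T" by (simp add: bounded_op_def)
  then show ?thesis
  proof (intro ex1I[of _ T] conjI allI TB)
    fix T' assume T': "bounded_op T' \<and> (\<forall>x y. cinner (T' x) y = B x y)"
    show "T' = T"
    proof
      fix x show "T' x = T x" by (rule cinner_ext) (simp add: T' TB)
    qed
  qed
qed

lemma adj_unique:
  assumes "bounded_op B" "\<And>x y. cinner (T x) y = cinner x (B y)"
  shows "adj T = B"
  unfolding adj_def
proof (rule the_equality)
  show "bounded_op B \<and> (\<forall>x y. cinner (T x) y = cinner x (B y))" using assms by blast
  fix B' assume B': "bounded_op B' \<and> (\<forall>x y. cinner (T x) y = cinner x (B' y))"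
  show "B' = B"
  proof
    fix y show "B' y = B y"
      using assms(2) B' by (intro cinner_ext) (metis cinner_commute)
  qed
qed

lemma adj:
  assumes T: "bounded_op T"
  shows "bounded_op (adj T)" "cinner (T x) y = cinner x (adj T y)"
proof -
  obtain K where K: "\<And>x. norm (T x) \<le> norm x * K"
    using T bounded_linear.bounded unfolding bounded_op_def by blast
  have add: "T (x + y) = T x + T y" and sc: "T (cscale c x) = cscale c (T x)" for x y c
    using T by (auto simp: bounded_op_def linear_simps)
  have "norm (cinner y (T x)) \<le> K * norm y * norm x" for x y
    using cinner_cauchy_schwarz[of y "T x"] mult_left_mono[OF K[of x] norm_ge_zero[of y]] by (simp add: mult_ac)
  then have "\<exists>!B. bounded_op B \<and> (\<forall>y x. cinner (B y) x = cinner y (T x))"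
    by (intro sesquilinear_representation[where K = K])
      (simp_all add: cinner_add_left cinner_add_right cinner_cscale_left cinner_cscale_right add sc)
  then obtain B where B: "bounded_op B" "\<And>x y. cinner (B y) x = cinner y (T x)" by blast
  have B': "cinner (T x) y = cinner x (B y)" for x y by (metis B(2) cinner_commute)
  show "bounded_op (adj T)" "cinner (T x) y = cinner x (adj T y)"
    using B(1) B' adj_unique[OF B(1) B'] by simp_all
qed

text \<open>In a complex Hilbert space symmetry follows from the reality of \<open><A x, x>\<close> by polarization.
  Conversely, for a symmetric complex-linear \<open>A\<close> the number \<open><A x, x>\<close> is real because \<open>A\<close> commutes
  with multiplication by \<open>\<i>\<close>.\<close>
lemma positive_op_iff_positive_semidefinite:
  assumes A: "bounded_op A"
  shows "positive_op A \<longleftrightarrow> positive_semidefinite (Blinfun A)"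
proof -
  have add: "A (x + y) = A x + A y" and sc: "A (cscale c x) = cscale c (A x)" for x y c
    using A by (auto simp: bounded_op_def linear_simps)
  show ?thesis
  proof
    assume P: "positive_op A"
    then have re: "Im (cinner (A x) x) = 0" for x by (simp add: positive_op_def)
    \<comment> \<open>Polarization; replacing \<open>x\<close> by \<open>\<i> x\<close> turns imaginary parts into real parts.\<close>
    have im: "Im (cinner (A x) y) + Im (cinner (A y) x) = 0" for x y
      using re[of "x + y"] re[of x] re[of y] by (simp add: add cinner_add_left cinner_add_right)
    have "A x \<bullet> y = x \<bullet> A y" for x y
    proof -
      have "A x \<bullet> y = A y \<bullet> x"
        using im[of "cscale \<i> x" y] by (simp add: sc cinner_cscale_left cinner_cscale_right inner_L2_def)
      then show ?thesis by (simp add: inner_commute)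
    qed
    then show "positive_semidefinite (Blinfun A)"
      using P by (simp add: positive_semidefinite_def bounded_op_blinfun[OF A] positive_op_def inner_L2_def)
  next
    assume P: "positive_semidefinite (Blinfun A)"
    have sym: "A x \<bullet> y = x \<bullet> A y" for x y using positive_semidefiniteD(1)[OF P] by (simp add: bounded_op_blinfun[OF A])
    have "Im (cinner (A x) x) = 0" for x
    proof -
      have "Im (cinner (A x) x) = A x \<bullet> cscale \<i> x" by (simp add: cinner_eq_inner)
      also have "\<dots> = x \<bullet> cscale \<i> (A x)" by (simp add: sym sc)
      also have "\<dots> = Im (cinner x (A x))" by (simp add: cinner_eq_inner)
      also have "\<dots> = - Im (cinner (A x) x)" by (subst cinner_commute) simp
      finally show ?thesis by simp
    qed
    moreover have "0 \<le> Re (cinner (A x) x)" for x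
      using positive_semidefiniteD(2)[OF P, of x] by (simp add: bounded_op_blinfun[OF A] inner_L2_def)
    ultimately show "positive_op A" using A by (simp add: positive_op_def)
  qed
qed

lemma complex_linear_blinfun:
  "bounded_op (blinfun_apply A) \<longleftrightarrow> (\<forall>c. Blinfun (cscale c) o\<^sub>L A = A o\<^sub>L Blinfun (cscale c))"
proof -
  have "bounded_op (blinfun_apply A) \<longleftrightarrow> (\<forall>c x. A (cscale c x) = cscale c (A x))"
    by (simp add: bounded_op_def blinfun.bounded_linear_right)
  also have "\<dots> \<longleftrightarrow> (\<forall>c. Blinfun (cscale c) o\<^sub>L A = A o\<^sub>L Blinfun (cscale c))"
    by (auto simp: blinfun_apply_inject[symmetric] fun_eq_iff bounded_linear_Blinfun_apply[OF bounded_linear_cscale])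
  finally show ?thesis .
qed

lemma complex_positive_sqrt:
  fixes P :: "('n::finite) L2 \<Rightarrow>\<^sub>L 'n L2"
  assumes P: "positive_semidefinite P" "bounded_op (blinfun_apply P)"
  shows "\<exists>A. positive_semidefinite A \<and> A o\<^sub>L A = P \<and> bounded_op (blinfun_apply A)"
proof -
  obtain A where A: "positive_semidefinite A" "A o\<^sub>L A = P"
    "\<And>C. C o\<^sub>L P = P o\<^sub>L C \<Longrightarrow> C o\<^sub>L A = A o\<^sub>L C"
    using positive_sqrt_exists[OF P(1)] by blast
  then show ?thesis using P(2) unfolding complex_linear_blinfun by blast
qed

text \<open>The definite description in \<open>abs_op\<close> denotes the positive square root of \<open>T* T\<close>. Besides
  positivity, the estimates use the modulus only through \<open><A x, A y> = <T x, T y>\<close>.\<close>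
lemma abs_op_is_modulus:
  fixes T :: "('n::finite) L2 \<Rightarrow> 'n L2"
  assumes T: "bounded_op T"
  shows "\<exists>A. positive_semidefinite A \<and> abs_op T = blinfun_apply A \<and> bounded_op (blinfun_apply A) \<and>
    (\<forall>x y. A x \<bullet> A y = T x \<bullet> T y)"
proof -
  have PT: "bounded_op (adj T \<circ> T)"
    using T adj(1)[OF T] by (simp add: bounded_op_def comp_def bounded_linear_compose[of "adj T" T])
  define P where "P = Blinfun (adj T \<circ> T)"
  have P: "blinfun_apply P = adj T \<circ> T" unfolding P_def by (rule bounded_op_blinfun[OF PT])
  have PTT: "P x \<bullet> y = T x \<bullet> T y" for x y
  proof -
    have "y \<bullet> P x = T y \<bullet> T x" using adj(2)[OF T, of y "T x"] by (simp add: P inner_L2_def)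
    then show ?thesis by (simp add: inner_commute)
  qed
  have psd: "positive_semidefinite P"
    unfolding positive_semidefinite_def
    by (simp add: PTT) (simp add: PTT inner_commute[of _ "P _"] inner_commute[of "T _" "T _"])
  have Pb: "bounded_op (blinfun_apply P)" using PT P by simp
  obtain A where A: "positive_semidefinite A" "A o\<^sub>L A = P" "bounded_op (blinfun_apply A)"
    using complex_positive_sqrt[OF psd Pb] by blast
  have "abs_op T = blinfun_apply A"
    unfolding abs_op_def
  proof (rule the_equality)
    have "positive_op (blinfun_apply A)"
      using A by (simp add: positive_op_iff_positive_semidefinite blinfun_apply_inverse)
    moreover have "blinfun_apply A \<circ> blinfun_apply A = adj T \<circ> T"
      unfolding P[symmetric] A(2)[symmetric] by (simp add: fun_eq_iff)
    ultimately show "positive_op (blinfun_apply A) \<and> blinfun_apply A \<circ> blinfun_apply A = adj T \<circ> T" ..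
    fix C assume C: "positive_op C \<and> C \<circ> C = adj T \<circ> T"
    then have Cb: "bounded_op C" by (simp add: positive_op_def)
    have "Blinfun C o\<^sub>L Blinfun C = P"
      using C by (intro blinfun_eqI) (simp add: P bounded_op_blinfun[OF Cb] fun_eq_iff)
    moreover have "positive_semidefinite (Blinfun C)"
      using C Cb positive_op_iff_positive_semidefinite by blast
    ultimately have "Blinfun C = A" using positive_sqrt_ex1[OF psd] A by blast
    then show "C = blinfun_apply A" using bounded_op_blinfun[OF Cb] by metis
  qed
  moreover have "A x \<bullet> A y = T x \<bullet> T y" for x y
    using arg_cong[OF A(2), of "\<lambda>Z. blinfun_apply Z x"] positive_semidefiniteD(1)[OF A(1), of "A x" y] PTT[of x y]
    by simp
  ultimately show ?thesis using A by blast
qed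

lemma orthonormal_of_complex:
  assumes "\<forall>e\<in>B. \<forall>e'\<in>B. cinner e e' = (if e = e' then 1 else 0)"
  shows "orthonormal B"
  using assms by (simp add: orthonormal_def inner_L2_def)

text \<open>The basis chosen in \<open>trace_norm\<close> is a basis only because one exists; Zorn's lemma gives a maximal
  orthonormal set.\<close>
lemma orthonormal_basis_exists: "\<exists>B :: ('n::finite) L2 set. orthonormal_basis B"
proof -
  define Q :: "'n L2 set set" where "Q = {B. \<forall>e\<in>B. \<forall>e'\<in>B. cinner e e' = (if e = e' then 1 else 0)}"
  have "\<exists>M\<in>Q. \<forall>X\<in>Q. M \<subseteq> X \<longrightarrow> X = M"
  proof (rule subset_Zorn')
    fix C assume C: "subset.chain Q C"
    show "\<Union>C \<in> Q"
      unfolding Q_def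
    proof (intro CollectI ballI)
      fix e e' assume "e \<in> \<Union>C" "e' \<in> \<Union>C"
      then obtain X Y where "X \<in> C" "e \<in> X" "Y \<in> C" "e' \<in> Y" by blast
      then obtain Z where "Z \<in> C" "e \<in> Z" "e' \<in> Z"
        using C unfolding subset.chain_def by blast
      then show "cinner e e' = (if e = e' then 1 else 0)"
        using C unfolding subset.chain_def Q_def by blast
    qed
  qed
  then obtain M where M: "M \<in> Q" "\<And>X. X \<in> Q \<Longrightarrow> M \<subseteq> X \<Longrightarrow> X = M" by blast
  have "x = 0" if x: "\<forall>e\<in>M. cinner x e = 0" for x
  proof (rule ccontr)
    assume "x \<noteq> 0"
    define u where "u = cscale (of_real (1 / norm x)) x"
    have "norm u = 1" using \<open>x \<noteq> 0\<close> by (simp add: u_def norm_divide)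
    then have uu: "cinner u u = 1"
      using cinner_self(1)[of u] by (simp add: complex_eq_iff norm_eq_1 inner_L2_def)
    have ue: "cinner u e = 0" "cinner e u = 0" if "e \<in> M" for e
      using x that by (simp_all add: u_def cinner_cscale_left cinner_cscale_right cinner_commute[of e x])
    have "insert u M \<in> Q" using M(1) uu ue unfolding Q_def by auto
    then have "u \<in> M" using M(2)[of "insert u M"] by blast
    then show False using ue[of u] uu by simp
  qed
  then show ?thesis using M(1) unfolding orthonormal_basis_def Q_def by blast
qed

text \<open>The bound holds for every partial sum of the trace of \<open>|T|\<close>, in whatever basis the trace is
  computed.\<close>
lemma trace_norm_le_nuclear_bound:
  assumes T: "bounded_op T" and C: "nuclear_bound T C"
  shows "trace_norm T \<le> ennreal C"
proof -
  define B :: "'a L2 set" where "B = (SOME B. orthonormal_basis B)"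
  have "orthonormal_basis B" unfolding B_def by (rule someI_ex[OF orthonormal_basis_exists])
  then have B: "orthonormal B" by (simp add: orthonormal_basis_def orthonormal_of_complex)
  obtain A where A: "positive_semidefinite A" "abs_op T = blinfun_apply A" "\<And>x y. A x \<bullet> A y = T x \<bullet> T y"
    using abs_op_is_modulus[OF T] by blast
  have "(\<Sum>\<^sub>\<infinity>e\<in>B. ennreal (Re (cinner (abs_op T e) e))) \<le> ennreal C"
  proof (rule infsum_le_finite_sums)
    fix F assume F: "finite F" "F \<subseteq> B"
    have "(\<Sum>e\<in>F. ennreal (Re (cinner (abs_op T e) e))) = (\<Sum>e\<in>F. ennreal (A e \<bullet> e))"
      by (simp add: A(2) inner_L2_def)
    also have "\<dots> = ennreal (\<Sum>e\<in>F. A e \<bullet> e)"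
      using positive_semidefiniteD(2)[OF A(1)] by (intro sum_ennreal)
    also have "(\<Sum>e\<in>F. A e \<bullet> e) \<le> C"
      by (rule sum_modulus_le_nuclear_bound[OF A(1), of "Blinfun T"])
        (use A(3) C F B orthonormal_subset in \<open>auto simp: bounded_op_blinfun[OF T]\<close>)
    finally show "(\<Sum>e\<in>F. ennreal (Re (cinner (abs_op T e) e))) \<le> ennreal C" by (simp add: ennreal_leI)
  qed (rule nonneg_summable_on_complete, simp)
  then show ?thesis using T by (simp add: trace_norm_def B_def)
qed

lemma inj_cscale_ii: "inj (cscale \<i> :: ('n::finite) L2 \<Rightarrow> _)"
  by (rule inj_on_inverseI[where g = "cscale (- \<i>)"]) (simp add: cscale_cscale)

text \<open>A complex basis is not complete with respect to the real inner product; together with its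
  multiples by \<open>\<i>\<close> it is.\<close>
lemma complete_orthonormal_of_complex:
  assumes "orthonormal_basis B"
  shows "complete_orthonormal (B \<union> cscale \<i> ` B)"
proof -
  have B: "cinner e e' = (if e = e' then 1 else 0)" if "e \<in> B" "e' \<in> B" for e e'
    using assms that by (simp add: orthonormal_basis_def)
  have ne: "cscale \<i> e \<noteq> e'" if "e \<in> B" "e' \<in> B" for e e'
  proof
    assume "cscale \<i> e = e'"
    then have "cinner e e' = - \<i>" using B[OF that(1) that(1)] by (auto simp: cinner_cscale_right)
    then show False using B[OF that] by (simp add: complex_eq_iff split: if_splits)
  qed
  have inj: "cscale \<i> e = cscale \<i> e' \<longleftrightarrow> e = e'" for e e' :: "'a L2"
    by (rule inj_eq[OF inj_cscale_ii])
  show ?thesis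
    unfolding complete_orthonormal_def
  proof (intro conjI allI impI)
    show "orthonormal (B \<union> cscale \<i> ` B)"
      unfolding orthonormal_def
      by (auto simp: inner_L2_def cinner_cscale_left cinner_cscale_right B ne ne[symmetric] inj)
    fix x assume x: "\<forall>b\<in>B \<union> cscale \<i> ` B. x \<bullet> b = 0"
    have "cinner x e = 0" if "e \<in> B" for e
      using x that by (simp add: cinner_eq_inner complex_eq_iff)
    then show "x = 0" using assms by (simp add: orthonormal_basis_def)
  qed
qed

text \<open>With \<open>R\<close> the square root of \<open>|S|\<close>, the trace of \<open>|S|\<close> is \<open>\<Sum>b. |R b|^2\<close>. As \<open>R\<close> commutes with
  multiplication by \<open>\<i>\<close>, passing to the real basis doubles this sum, so it remains finite.\<close>
lemma trace_class_finite_rank_approximation: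
  fixes S :: "('n::finite) L2 \<Rightarrow> 'n L2"
  assumes S: "trace_class S" and "\<epsilon> > 0"
  shows "\<exists>(B :: 'n L2 set) c a. finite B \<and> nuclear_bound (\<lambda>x. S x - (\<Sum>b\<in>B. (x \<bullet> c b) *\<^sub>R a b)) \<epsilon>"
proof -
  have Sb: "bounded_op S" using S by (simp add: trace_class_def)
  define B :: "'n L2 set" where "B = (SOME B. orthonormal_basis B)"
  have B: "orthonormal_basis B" unfolding B_def by (rule someI_ex[OF orthonormal_basis_exists])
  obtain A where A: "positive_semidefinite A" "abs_op S = blinfun_apply A" "bounded_op (blinfun_apply A)"
      "\<And>x y. A x \<bullet> A y = S x \<bullet> S y"
    using abs_op_is_modulus[OF Sb] by blast
  obtain R where R: "positive_semidefinite R" "R o\<^sub>L R = A" "bounded_op (blinfun_apply R)"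
    using complex_positive_sqrt[OF A(1,3)] by blast
  have AS: "A x \<bullet> A y = Blinfun S x \<bullet> Blinfun S y" for x y using A(4) by (simp add: bounded_op_blinfun[OF Sb])
  obtain V :: "'n L2 \<Rightarrow>\<^sub>L 'n L2" where V: "\<And>x. V (R x) = Blinfun S x" "\<And>x. norm (V x) \<le> norm (R x)"
    using half_modulus_factorization[OF A(1) AS R(1,2)] by blast
  have RA: "(norm (R x))\<^sup>2 = A x \<bullet> x" for x
    using positive_semidefiniteD(1)[OF R(1), of "R x" x] arg_cong[OF R(2), of "\<lambda>Z. blinfun_apply Z x"]
    by (simp add: power2_norm_eq_inner)
  have "trace_norm S < \<infinity>" using S by (simp add: trace_class_def)
  then obtain C where C: "trace_norm S = ennreal C" "C \<ge> 0" by (cases "trace_norm S") auto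
  have le: "(\<Sum>b\<in>F. (norm (R b))\<^sup>2) \<le> C" if F: "finite F" "F \<subseteq> B" for F
  proof -
    have "ennreal (\<Sum>b\<in>F. (norm (R b))\<^sup>2) = (\<Sum>b\<in>F. ennreal (Re (cinner (abs_op S b) b)))"
      unfolding RA A(2) inner_L2_def[symmetric]
      by (intro sum_ennreal[symmetric] positive_semidefiniteD(2)[OF A(1)])
    also have "\<dots> = (\<Sum>\<^sub>\<infinity>b\<in>F. ennreal (Re (cinner (abs_op S b) b)))" using F by simp
    also have "\<dots> \<le> (\<Sum>\<^sub>\<infinity>b\<in>B. ennreal (Re (cinner (abs_op S b) b)))"
      using F(2) by (intro infsum_mono_neutral nonneg_summable_on_complete) auto
    also have "\<dots> = ennreal C" using C(1) Sb by (simp add: trace_norm_def B_def)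
    finally show ?thesis using C(2) by simp
  qed
  have bound: "(\<Sum>b\<in>F. (norm (R b))\<^sup>2) \<le> C + C" if F: "finite F" "F \<subseteq> B \<union> cscale \<i> ` B" for F
  proof -
    define G where "G = {e \<in> B. cscale \<i> e \<in> F}"
    note inj = inj_cscale_ii[where 'n = 'n]
    have G: "finite G" using F(1) finite_vimageI[OF F(1) inj] by (auto simp: G_def vimage_def elim: finite_subset[rotated])
    have "F \<subseteq> (F \<inter> B) \<union> cscale \<i> ` G" using F(2) by (auto simp: G_def)
    then have "(\<Sum>b\<in>F. (norm (R b))\<^sup>2) \<le> (\<Sum>b\<in>(F \<inter> B) \<union> cscale \<i> ` G. (norm (R b))\<^sup>2)"
      using F(1) G by (intro sum_mono2) auto
    also have "\<dots> \<le> (\<Sum>b\<in>F \<inter> B. (norm (R b))\<^sup>2) + (\<Sum>b\<in>cscale \<i> ` G. (norm (R b))\<^sup>2)"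
      using F(1) G by (subst sum_Un) (auto intro: sum_nonneg)
    also have "(\<Sum>b\<in>cscale \<i> ` G. (norm (R b))\<^sup>2) = (\<Sum>b\<in>G. (norm (R b))\<^sup>2)"
      using R(3) inj by (subst sum.reindex) (auto simp: inj_on_def bounded_op_def)
    also have "(\<Sum>b\<in>F \<inter> B. (norm (R b))\<^sup>2) + (\<Sum>b\<in>G. (norm (R b))\<^sup>2) \<le> C + C"
      using F(1) G by (intro add_mono le) (auto simp: G_def)
    finally show ?thesis .
  qed
  have "\<exists>B'. finite B' \<and> nuclear_bound (\<lambda>x. Blinfun S x - (\<Sum>b\<in>B'. (x \<bullet> R b) *\<^sub>R V b)) \<epsilon>"
    by (rule finite_rank_approximation[OF complete_orthonormal_of_complex[OF B] R(1) V bound \<open>\<epsilon> > 0\<close>])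
  then show ?thesis unfolding bounded_op_blinfun[OF Sb] by blast
qed

lemma trace_class_nuclear_bound:
  fixes S :: "('n::finite) L2 \<Rightarrow> 'n L2"
  assumes S: "trace_class S"
  shows "\<exists>K. nuclear_bound S K"
proof -
  obtain B :: "'n L2 set" and c a where "finite B" "nuclear_bound (\<lambda>x. S x - (\<Sum>b\<in>B. (x \<bullet> c b) *\<^sub>R a b)) 1"
    using trace_class_finite_rank_approximation[OF S zero_less_one] by blast
  from nuclear_bound_add[OF this(2) nuclear_bound_sum[of B "\<lambda>b x. (x \<bullet> c b) *\<^sub>R a b", OF nuclear_bound_rank_one]]
  show ?thesis by auto
qed

section \<open>Time-frequency shifts\<close>

lemma tf_shift_abs:
  assumes "square_integrable f"
  shows "tf_shift (x, w) (abs_L2 f) = abs_L2 (\<lambda>t. exp (2 * of_real pi * \<i> * of_real (w \<bullet> t)) * f (t - x))"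
  using tf_shift.abs_eq[OF L2_rel_refl[OF assms], of "(x, w)"] by simp

lemma tf_shift_add: "tf_shift z (f + g) = tf_shift z f + tf_shift z g"
  by transfer (auto simp: L2_rel_def distrib_left split_beta intro: square_integrable_add square_integrable_shift)

lemma tf_shift_cscale: "tf_shift z (cscale c f) = cscale c (tf_shift z f)"
proof transfer
  fix z :: "'a phase_space" and c and f :: "real^'a \<Rightarrow> complex"
  assume "L2_rel f f"
  then have f: "square_integrable f" by (simp add: L2_rel_def)
  obtain x w where z: "z = (x, w)" by fastforce
  let ?\<pi> = "\<lambda>f t. exp (2 * of_real pi * \<i> * of_real (w \<bullet> t)) * f (t - x)"
  have "?\<pi> (\<lambda>t. c * f t) = (\<lambda>t. c * ?\<pi> f t)" by (simp add: mult_ac)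
  then show "L2_rel ((case z of (x, w) \<Rightarrow> \<lambda>f t. exp (2 * of_real pi * \<i> * of_real (w \<bullet> t)) * f (t - x)) (\<lambda>t. c * f t))
      (\<lambda>t. c * (case z of (x, w) \<Rightarrow> \<lambda>f t. exp (2 * of_real pi * \<i> * of_real (w \<bullet> t)) * f (t - x)) f t)"
    unfolding z using L2_rel_refl[OF square_integrable_scale[OF square_integrable_shift[OF f], of c w x]] by simp
qed

lemma cinner_tf_shift: "cinner (tf_shift z f) (tf_shift z g) = cinner f g"
proof transfer
  fix z :: "'a phase_space" and f g :: "real^'a \<Rightarrow> complex"
  assume "L2_rel f f" "L2_rel g g"
  then have m: "(\<lambda>t. f t * cnj (g t)) \<in> borel_measurable borel"
    using borel_measurable_integrable[OF square_integrable_mult[of f g]] by (simp add: L2_rel_def)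
  obtain x w where z: "z = (x, w)" by fastforce
  have "exp (2 * of_real pi * \<i> * of_real (w \<bullet> t)) * f (t - x) *
      cnj (exp (2 * of_real pi * \<i> * of_real (w \<bullet> t)) * g (t - x)) = f (t - x) * cnj (g (t - x))" for t
  proof -
    have "exp (2 * complex_of_real pi * \<i> * complex_of_real (w \<bullet> t)) *
        cnj (exp (2 * complex_of_real pi * \<i> * complex_of_real (w \<bullet> t))) = 1"
      by (simp add: complex_norm_square[symmetric] norm_exp_eq_Re)
    then show ?thesis by (simp add: mult_ac)
  qed
  moreover have "(LINT t|lborel. f (t - x) * cnj (g (t - x))) = (LINT t|lborel. f t * cnj (g t))"
    using integral_distr[of "(+) (-x)" lborel borel "\<lambda>t. f t * cnj (g t)"] m
    by (simp add: lborel_distr_plus)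
  ultimately show "(LINT t|lborel. (case z of (x, w) \<Rightarrow> \<lambda>f t. exp (2 * of_real pi * \<i> * of_real (w \<bullet> t)) * f (t - x)) f t *
      cnj ((case z of (x, w) \<Rightarrow> \<lambda>f t. exp (2 * of_real pi * \<i> * of_real (w \<bullet> t)) * f (t - x)) g t))
      = (LINT t|lborel. f t * cnj (g t))"
    unfolding z prod.case by (simp only:)
qed

lemma norm_tf_shift: "norm (tf_shift z f) = norm f"
  by (simp add: norm_eq_sqrt_inner inner_L2_def cinner_tf_shift)

lemma bounded_op_tf_shift: "bounded_op (tf_shift z)"
  unfolding bounded_op_def
proof (intro conjI allI tf_shift_cscale)
  show "bounded_linear (tf_shift z)"
    by (rule bounded_linear_intro[where K = 1])
      (simp_all add: tf_shift_add tf_shift_cscale scaleR_eq_cscale norm_tf_shift)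
qed

definition tf_shift_inverse :: "('n::finite) phase_space \<Rightarrow> 'n L2 \<Rightarrow> 'n L2" where
  "tf_shift_inverse z f = cscale (exp (- (2 * of_real pi * \<i> * of_real (snd z \<bullet> fst z)))) (tf_shift (- z) f)"

lemma tf_shift_tf_shift_inverse: "tf_shift z (tf_shift_inverse z f) = f"
proof -
  obtain x w where z: "z = (x, w)" by fastforce
  define g where "g = rep_L2 f"
  have g: "square_integrable g" "abs_L2 g = f" by (simp_all add: g_def square_integrable_rep abs_rep_L2)
  have "tf_shift z (tf_shift (- z) f) = abs_L2 (\<lambda>t. exp (2 * of_real pi * \<i> * of_real (w \<bullet> x)) * g t)"
  proof -
    let ?E = "\<lambda>r::real. exp (2 * complex_of_real pi * \<i> * complex_of_real r)"
    have E: "?E r * ?E s = ?E (r + s)" for r s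
      by (simp only: exp_add[symmetric] of_real_add distrib_left)
    define h where "h t = ?E (- w \<bullet> t) * g (t - - x)" for t
    have h: "square_integrable h" unfolding h_def by (rule square_integrable_shift[OF g(1)])
    have "tf_shift (- z) f = abs_L2 h"
      unfolding z uminus_prod_def fst_conv snd_conv g(2)[symmetric] h_def by (rule tf_shift_abs[OF g(1)])
    then have "tf_shift z (tf_shift (- z) f) = abs_L2 (\<lambda>t. ?E (w \<bullet> t) * h (t - x))"
      unfolding z by (simp only: tf_shift_abs[OF h])
    moreover have "?E (w \<bullet> t) * h (t - x) = ?E (w \<bullet> x) * g t" for t
    proof -
      have "?E (w \<bullet> t) * h (t - x) = ?E (w \<bullet> t) * ?E (- w \<bullet> (t - x)) * g t"
        by (simp only: h_def mult.assoc diff_minus_eq_add diff_add_cancel)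
      also have "\<dots> = ?E (w \<bullet> x) * g t" by (simp only: E) (simp add: inner_diff_right)
      finally show ?thesis .
    qed
    ultimately show ?thesis by (simp only:)
  qed
  also have "\<dots> = cscale (exp (2 * of_real pi * \<i> * of_real (w \<bullet> x))) f"
    using cscale.abs_eq[OF L2_rel_refl[OF g(1)]] by (simp add: g(2))
  finally show ?thesis
    unfolding tf_shift_inverse_def tf_shift_cscale
    by (simp only: cscale_cscale z fst_conv snd_conv exp_add[symmetric]) simp
qed

lemma norm_tf_shift_inverse: "norm (tf_shift_inverse z f) = norm f"
  using norm_tf_shift[of z "tf_shift_inverse z f"] by (simp add: tf_shift_tf_shift_inverse)

lemma bounded_op_tf_shift_inverse: "bounded_op (tf_shift_inverse z)"
  unfolding bounded_op_def
proof (intro conjI allI)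
  show "bounded_linear (tf_shift_inverse z)"
    by (rule bounded_linear_intro[where K = 1])
      (simp_all add: tf_shift_inverse_def tf_shift_add tf_shift_cscale scaleR_eq_cscale norm_tf_shift
        cscale_cscale cscale_add_right mult.commute)
  show "tf_shift_inverse z (cscale c x) = cscale c (tf_shift_inverse z x)" for c x
    by (simp add: tf_shift_inverse_def tf_shift_cscale cscale_cscale mult.commute)
qed

lemma cinner_tf_shift_left: "cinner (tf_shift z f) g = cinner f (tf_shift_inverse z g)"
  using cinner_tf_shift[of z f "tf_shift_inverse z g"] by (simp add: tf_shift_tf_shift_inverse)

text \<open>For continuous functions of compact support the shifted functions converge pointwise, and they are
  dominated by a multiple of the indicator of one ball.\<close>
lemma tf_shift_abs_tendsto_of_compact_support:
  fixes f :: "real^'n \<Rightarrow> complex"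
  assumes f: "continuous_on UNIV f" and K: "\<And>t. norm (f t) \<le> K" and supp: "\<And>t. norm t > R \<Longrightarrow> f t = 0"
    and z: "z \<longlonglongrightarrow> y"
  shows "square_integrable f" "(\<lambda>n. tf_shift (z n) (abs_L2 f)) \<longlonglongrightarrow> tf_shift y (abs_L2 f)"
proof -
  have fm: "f \<in> borel_measurable borel" by (rule borel_measurable_continuous_onI[OF f])
  have K0: "0 \<le> K" using K[of 0] norm_ge_zero order_trans by blast
  have w: "(\<lambda>t. K * indicator (cball 0 r) t) \<in> borel_measurable borel"
    "integrable lborel (\<lambda>t::real^'n. (K * indicator (cball 0 r) t)\<^sup>2)" for r
  proof -
    have "(\<lambda>t::real^'n. (K * indicator (cball 0 r) t)\<^sup>2) = (\<lambda>t. K\<^sup>2 * indicator (cball 0 r) t)"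
      by (auto simp: fun_eq_iff indicator_def)
    moreover have "integrable lborel (\<lambda>t::real^'n. K\<^sup>2 * indicator (cball 0 r) t)"
      by (intro integrable_mult_right integrable_real_indicator) (auto simp: emeasure_lborel_cball_finite[unfolded infinity_ennreal_def])
    ultimately show "integrable lborel (\<lambda>t::real^'n. (K * indicator (cball 0 r) t)\<^sup>2)" by simp
  qed (intro borel_measurable_times borel_measurable_indicator; simp)
  show fs: "square_integrable f"
    by (rule norm_abs_L2_dominated_limit(2)[of "\<lambda>_. f", OF fm fm _ w[of R]])
      (use K supp K0 in \<open>auto simp: indicator_def not_le\<close>)
  obtain M where M: "\<And>n. norm (z n) \<le> M"
    using z convergent_imp_Bseq[of z] convergentI unfolding Bseq_def by blast
  define F where "F z t = exp (2 * of_real pi * \<i> * of_real (snd z \<bullet> t)) * f (t - fst z)" for z :: "'n phase_space" and t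
  have F: "tf_shift z (abs_L2 f) = abs_L2 (F z)" for z
    using tf_shift_abs[OF fs, of "fst z" "snd z"] unfolding F_def[abs_def] by simp
  have Fm: "F z \<in> borel_measurable borel" for z
    using square_integrable_shift[OF fs, of "snd z" "fst z"] unfolding F_def[abs_def] by (simp add: square_integrable_def)
  show "(\<lambda>n. tf_shift (z n) (abs_L2 f)) \<longlonglongrightarrow> tf_shift y (abs_L2 f)"
    unfolding F
  proof (rule norm_abs_L2_dominated_limit(3)[OF Fm Fm _ w[of "R + M"]])
    show "AE t in lborel. (\<lambda>n. F (z n) t) \<longlonglongrightarrow> F y t"
    proof (rule AE_I2)
      fix t
      have "isCont f (t - fst y)" using f by (simp add: continuous_on_eq_continuous_at)
      then have "(\<lambda>n. f (t - fst (z n))) \<longlonglongrightarrow> f (t - fst y)"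
        by (rule isCont_tendsto_compose) (intro tendsto_intros z)
      then show "(\<lambda>n. F (z n) t) \<longlonglongrightarrow> F y t"
        unfolding F_def by (intro tendsto_intros z)
    qed
    show "norm (F (z n) t) \<le> K * indicator (cball 0 (R + M)) t" for n t
    proof (cases "t \<in> cball 0 (R + M)")
      case True
      then show ?thesis using K by (simp add: F_def norm_mult norm_exp_eq_Re)
    next
      case False
      then have "norm (t - fst (z n)) > R"
        using M[of n] norm_fst_le[of "fst (z n)" "snd (z n)"] norm_triangle_ineq2[of t "fst (z n)"]
        by simp
      then show ?thesis by (simp add: F_def supp K0)
    qed
  qed
qed

text \<open>The set of vectors on which the shifts converge is closed, because shifts are isometries.\<close>
lemma tf_shift_tendsto_of_approximation:
  assumes h: "h \<longlonglongrightarrow> g" and lim: "\<And>k. (\<lambda>n. tf_shift (z n) (h k)) \<longlonglongrightarrow> tf_shift y (h k)"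
  shows "(\<lambda>n. tf_shift (z n) g) \<longlonglongrightarrow> tf_shift y g"
proof (rule LIMSEQ_I)
  fix e :: real assume e: "e > 0"
  then obtain k where k: "norm (h k - g) < e / 3" using LIMSEQ_D[OF h, of "e / 3"] by auto
  obtain N where N: "\<And>n. n \<ge> N \<Longrightarrow> norm (tf_shift (z n) (h k) - tf_shift y (h k)) < e / 3"
    using LIMSEQ_D[OF lim[of k], of "e / 3"] e by auto
  have d: "norm (tf_shift u (h k) - tf_shift u g) = norm (h k - g)" for u
    using bounded_op_tf_shift[of u] norm_tf_shift[of u "h k - g"]
    by (simp add: bounded_op_def linear_simps)
  have "norm (tf_shift (z n) g - tf_shift y g) < e" if "n \<ge> N" for n
  proof -
    have "tf_shift (z n) g - tf_shift y g = (tf_shift (z n) (h k) - tf_shift y (h k))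
        - (tf_shift (z n) (h k) - tf_shift (z n) g) + (tf_shift y (h k) - tf_shift y g)" by simp
    also have "norm \<dots> \<le> norm (tf_shift (z n) (h k) - tf_shift y (h k))
        + norm (tf_shift (z n) (h k) - tf_shift (z n) g) + norm (tf_shift y (h k) - tf_shift y g)"
      by (intro norm_triangle_mono norm_triangle_ineq4) simp
    also have "\<dots> < e" using N[OF that] k d[of "z n"] d[of y] by simp
    finally show ?thesis .
  qed
  then show "\<exists>no. \<forall>n\<ge>no. norm (tf_shift (z n) g - tf_shift y g) < e" by blast
qed

text \<open>The radial retraction of the plane onto the disc of radius \<open>N\<close>.\<close>
definition clamp_norm :: "real \<Rightarrow> complex \<Rightarrow> complex" where
  "clamp_norm N u = u * of_real (N / max N (norm u))"

lemma clamp_norm: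
  assumes "N > 0"
  shows "norm (clamp_norm N u) \<le> N" "norm (clamp_norm N u) \<le> norm u" "norm u \<le> N \<Longrightarrow> clamp_norm N u = u"
    "continuous_on A (clamp_norm N)"
proof -
  have m: "max N (norm u) > 0" for u :: complex using assms by simp
  have *: "norm (clamp_norm N u) = norm u * N / max N (norm u)"
    using assms m[of u] by (simp add: clamp_norm_def norm_mult norm_divide)
  have "norm u * N \<le> N * max N (norm u)" "norm u * N \<le> norm u * max N (norm u)"
    using assms mult_left_mono[of "norm u" "max N (norm u)" N] mult_left_mono[of N "max N (norm u)" "norm u"]
    by (simp_all add: mult.commute)
  then show "norm (clamp_norm N u) \<le> N" "norm (clamp_norm N u) \<le> norm u"
    unfolding * using m[of u] by (simp_all add: divide_le_eq)
  show "norm u \<le> N \<Longrightarrow> clamp_norm N u = u" using assms by (simp add: clamp_norm_def max_def)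
  show "continuous_on A (clamp_norm N)"
    unfolding clamp_norm_def using m by (intro continuous_intros) (metis less_numeral_extra(3))
qed

text \<open>Strong continuity. The function \<open>f\<close> is approximated by bounded truncations of bounded support, and
  each truncation by continuous functions of compact support: a measurable function is almost
  everywhere a limit of continuous functions \<open>h n\<close>, and clamping the values of \<open>h n\<close> and cutting off
  outside a ball makes the approximation dominated.\<close>
lemma tf_shift_tendsto:
  fixes g :: "('n::finite) L2"
  assumes z: "z \<longlonglongrightarrow> y"
  shows "(\<lambda>n. tf_shift (z n) g) \<longlonglongrightarrow> tf_shift y g"
proof -
  define f where "f = rep_L2 g"
  have fs: "square_integrable f" "abs_L2 f = g" by (simp_all add: f_def square_integrable_rep abs_rep_L2)
  then have fm[measurable]: "f \<in> borel_measurable borel" and fi: "integrable lborel (\<lambda>t. (norm (f t))\<^sup>2)"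
    by (auto simp: square_integrable_def)
  define N where "N k = real (Suc k)" for k
  have N: "N k > 0" for k by (simp add: N_def)
  define trunc where "trunc k t = indicator (cball 0 (N k)) t * clamp_norm (N k) (f t)" for k t
  have truncm: "trunc k \<in> borel_measurable borel" for k
  proof -
    have "(\<lambda>t. clamp_norm (N k) (f t)) \<in> borel_measurable borel"
      using clamp_norm(4)[OF N] fm by (rule borel_measurable_continuous_on)
    then show ?thesis unfolding trunc_def by (intro borel_measurable_times borel_measurable_indicator) auto
  qed
  have "(\<lambda>k. abs_L2 (trunc k)) \<longlonglongrightarrow> abs_L2 f"
  proof (rule norm_abs_L2_dominated_limit(3)[OF truncm fm _ _ fi])
    show "AE t in lborel. (\<lambda>k. trunc k t) \<longlonglongrightarrow> f t"
    proof (intro AE_I2 tendsto_eventually)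
      fix t :: "real^'n"
      obtain k0 :: nat where k0: "max (norm t) (norm (f t)) \<le> real k0" using real_arch_simple by blast
      have "trunc k t = f t" if "k \<ge> k0" for k
        using k0 that clamp_norm(3)[OF N, of "f t" k] by (simp add: trunc_def N_def)
      then show "\<forall>\<^sub>F k in sequentially. trunc k t = f t" by (auto simp: eventually_sequentially)
    qed
    show "norm (trunc k t) \<le> norm (f t)" for k t
      using clamp_norm(2)[OF N] by (simp add: trunc_def indicator_def)
  qed simp
  moreover have "(\<lambda>n. tf_shift (z n) (abs_L2 (trunc k))) \<longlonglongrightarrow> tf_shift y (abs_L2 (trunc k))" for k
  proof -
    define M where "M = N k"
    have M: "M > 0" by (simp add: M_def N)
    have "f measurable_on UNIV"
      using fm by (intro lebesgue_measurable_imp_measurable_on) (auto intro: measurable_completion)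
    then obtain S h where S: "negligible S" and h: "\<And>n. continuous_on UNIV (h n)"
      and hf: "\<And>t. t \<notin> S \<Longrightarrow> (\<lambda>n. h n t) \<longlonglongrightarrow> f t"
      unfolding measurable_on_def by auto
    \<comment> \<open>Equal to 1 on the ball of radius \<open>M\<close> and, for \<open>n > 0\<close>, to 0 outside the ball of radius \<open>M + 1\<close>.\<close>
    define cutoff where "cutoff n t = max 0 (1 - real n * max 0 (norm t - M))" for n and t :: "real^'n"
    define c where "c n t = of_real (cutoff n t) * clamp_norm M (h n t)" for n t
    have cutoff: "0 \<le> cutoff n t" "cutoff n t \<le> 1" for n t by (auto simp: cutoff_def mult_nonneg_nonneg)
    have cc: "continuous_on UNIV (c n)" for n
      unfolding c_def cutoff_def
      by (intro continuous_intros continuous_on_compose2[OF clamp_norm(4)[OF M, of UNIV] h]) auto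
    have cK: "norm (c n t) \<le> M" for n t
      using mult_mono[OF cutoff(2)[of n t] clamp_norm(1)[OF M, of "h n t"]] cutoff(1)[of n t] by (simp add: c_def norm_mult)
    have csupp: "c n t = 0" if "n > 0" "norm t > M + 1" for n t
    proof -
      have "real n * max 0 (norm t - M) \<ge> 1 * 1" using that by (intro mult_mono) auto
      then show ?thesis by (simp add: c_def cutoff_def)
    qed
    have conv: "(\<lambda>n. abs_L2 (c (Suc n))) \<longlonglongrightarrow> abs_L2 (trunc k)"
    proof (rule norm_abs_L2_dominated_limit(3)[where w = "\<lambda>t. M * indicator (cball 0 (M + 1)) t"])
      show "c (Suc n) \<in> borel_measurable borel" for n by (rule borel_measurable_continuous_onI[OF cc])
      show "trunc k \<in> borel_measurable borel" by (rule truncm)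
      show "(\<lambda>t::real^'n. M * indicator (cball 0 (M + 1)) t) \<in> borel_measurable borel"
        by (intro borel_measurable_times borel_measurable_indicator) auto
      have "(\<lambda>t::real^'n. (M * indicator (cball 0 (M + 1)) t)\<^sup>2) = (\<lambda>t. M\<^sup>2 * indicator (cball 0 (M + 1)) t)"
        by (auto simp: fun_eq_iff indicator_def)
      moreover have "integrable lborel (\<lambda>t::real^'n. M\<^sup>2 * indicator (cball 0 (M + 1)) t)"
        by (intro integrable_mult_right integrable_real_indicator) (auto simp: emeasure_lborel_cball_finite[unfolded infinity_ennreal_def])
      ultimately show "integrable lborel (\<lambda>t::real^'n. (M * indicator (cball 0 (M + 1)) t)\<^sup>2)" by simp
      show "norm (c (Suc n) t) \<le> M * indicator (cball 0 (M + 1)) t" for n t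
        using cK[of "Suc n" t] csupp[of "Suc n" t] by (cases "norm t \<le> M + 1") auto
      have "AE t in lebesgue. t \<notin> S" using S by (simp add: negligible_iff_null_sets AE_not_in)
      then have "AE t in lborel. t \<notin> S" by (simp add: AE_completion_iff)
      then show "AE t in lborel. (\<lambda>n. c (Suc n) t) \<longlonglongrightarrow> trunc k t"
      proof eventually_elim
        fix t assume "t \<notin> S"
        then have "(\<lambda>n. h n t) \<longlonglongrightarrow> f t" by (rule hf)
        then have "(\<lambda>n. clamp_norm M (h n t)) \<longlonglongrightarrow> clamp_norm M (f t)"
          using clamp_norm(4)[OF M, of UNIV] by (intro isCont_tendsto_compose[of _ "clamp_norm M"]) (auto simp: continuous_on_eq_continuous_at)
        moreover have "(\<lambda>n. complex_of_real (cutoff n t)) \<longlonglongrightarrow> indicator (cball 0 M) t"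
        proof (cases "norm t \<le> M")
          case True
          then show ?thesis by (simp add: cutoff_def max_def)
        next
          case False
          then obtain n0 :: nat where n0: "1 < real n0 * (norm t - M)" using reals_Archimedean3[of "norm t - M"] by auto
          have "cutoff n t = 0" if "n \<ge> n0" for n
          proof -
            have "real n0 * (norm t - M) \<le> real n * (norm t - M)" using that False by (intro mult_right_mono) auto
            then have "1 - real n * (norm t - M) \<le> 0" using n0 by linarith
            moreover have "max 0 (norm t - M) = norm t - M" using False by simp
            ultimately show ?thesis unfolding cutoff_def by (simp only: max_absorb1)
          qed
          then have "\<forall>\<^sub>F n in sequentially. complex_of_real (cutoff n t) = 0" by (auto simp: eventually_sequentially)
          then show ?thesis using False by (simp add: tendsto_eventually)
        qed
        ultimately have "(\<lambda>n. c n t) \<longlonglongrightarrow> trunc k t"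
          unfolding c_def trunc_def M_def by (intro tendsto_mult)
        then show "(\<lambda>n. c (Suc n) t) \<longlonglongrightarrow> trunc k t" by (rule LIMSEQ_Suc)
      qed
    qed
    show ?thesis
      by (rule tf_shift_tendsto_of_approximation[OF conv])
        (rule tf_shift_abs_tendsto_of_compact_support(2)[where R = "M + 1", OF cc cK _ z], use csupp in simp)
  qed
  ultimately show ?thesis
    using tf_shift_tendsto_of_approximation[where h = "\<lambda>k. abs_L2 (trunc k)" and g = g] fs(2) by simp
qed

lemma continuous_tf_shift: "continuous_on UNIV (\<lambda>z. tf_shift z g)"
  unfolding continuous_on_sequentially by (auto simp: comp_def tf_shift_tendsto)

lemma continuous_tf_shift_inverse: "continuous_on UNIV (\<lambda>z. tf_shift_inverse z g)"
proof -
  have "bounded_bilinear (cscale :: complex \<Rightarrow> 'a L2 \<Rightarrow> 'a L2)"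
  proof
    show "\<exists>K. \<forall>a b. norm (cscale a (b :: 'a L2)) \<le> norm a * norm b * K" by (intro exI[of _ 1]) simp
  qed (simp_all add: cscale_add_right L2_vector_axioms(6) scaleR_eq_cscale cscale_cscale scaleR_conv_of_real mult.commute)
  then show ?thesis
    unfolding tf_shift_inverse_def
    by (rule bounded_bilinear.continuous_on)
      (intro continuous_intros continuous_on_compose2[OF continuous_tf_shift]; simp)+
qed

section \<open>Continuity of Riemann integrable functions\<close>

text \<open>The points at which the oscillation of \<open>f\<close> is at least \<open>c\<close>.\<close>
definition oscillation_set :: "('a::metric_space \<Rightarrow> real) \<Rightarrow> real \<Rightarrow> 'a set" where
  "oscillation_set f c = {z. \<forall>r>0. \<exists>x\<in>ball z r. \<exists>y\<in>ball z r. c \<le> f x - f y}"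

lemma isCont_outside_oscillation_sets:
  assumes "\<And>n. z \<notin> oscillation_set f (1 / real (Suc n))"
  shows "isCont f z"
  unfolding continuous_at_eps_delta
proof (intro allI impI)
  fix e :: real assume "e > 0"
  then obtain n where n: "1 / real (Suc n) < e" by (rule nat_approx_posE)
  obtain r where r: "r > 0" and osc: "\<And>x y. x \<in> ball z r \<Longrightarrow> y \<in> ball z r \<Longrightarrow> f x - f y < 1 / real (Suc n)"
    using assms[of n] unfolding oscillation_set_def by (auto simp: not_le)
  have "dist (f x) (f z) < e" if "dist x z < r" for x
    using osc[of x z] osc[of z x] that r n by (simp add: dist_commute dist_real_def abs_less_iff)
  then show "\<exists>d>0. \<forall>x'. dist x' z < d \<longrightarrow> dist (f x') (f z) < e" using r by blast
qed

text \<open>Two taggings of one fine division have nearly equal Riemann sums. If a cell contains two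
  points whose values differ by at least \<open>c\<close>, each of them serves as the tag of one tagging; this
  bounds \<open>c\<close> times the total volume of such cells. Up to the frontiers of the cells, which are null sets, they cover the oscillation set.\<close>
lemma negligible_oscillation_set:
  fixes f :: "'a::euclidean_space \<Rightarrow> real"
  assumes f: "riemann_integrable_on f a b" and c: "c > 0"
  shows "negligible (oscillation_set f c \<inter> cbox a b)"
  unfolding negligible_outer_le
proof (intro allI impI)
  fix e :: real assume e: "e > 0"
  define \<eta> where "\<eta> = c * e / 2"
  have \<eta>: "\<eta> > 0" using c e by (simp add: \<eta>_def)
  obtain I \<delta> where \<delta>: "\<delta> > 0" and fine: "\<And>p. p tagged_division_of cbox a b \<Longrightarrow> (\<lambda>x. ball x \<delta>) fine p \<Longrightarrow>
      norm ((\<Sum>(x, k)\<in>p. measure lborel k *\<^sub>R f x) - I) < \<eta>"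
    using f \<eta> unfolding riemann_integrable_on_def by blast
  \<comment> \<open>Half the radius lets every point of a cell serve as its tag.\<close>
  have "gauge (\<lambda>x::'a. ball x (\<delta> / 2))" using \<delta> by (simp add: gauge_def)
  then obtain p where p: "p tagged_division_of cbox a b" "(\<lambda>x. ball x (\<delta> / 2)) fine p"
    by (rule fine_division_exists)
  define D where "D = snd ` p"
  have D: "D division_of cbox a b" unfolding D_def by (rule division_of_tagged_division[OF p(1)])
  have finD: "finite D" using D by blast
  have small: "k \<subseteq> ball x \<delta>" if "k \<in> D" and xk: "x \<in> k" for k x
  proof
    fix y assume "y \<in> k"
    obtain t where "(t, k) \<in> p" using \<open>k \<in> D\<close> by (auto simp: D_def)
    then have "k \<subseteq> ball t (\<delta> / 2)" using p(2) by (auto simp: fine_def)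
    then have "dist t x < \<delta> / 2" "dist t y < \<delta> / 2" using xk \<open>y \<in> k\<close> by auto
    then show "y \<in> ball x \<delta>" using dist_triangle3[of x y t] by simp
  qed
  have retag: "norm ((\<Sum>k\<in>D. measure lborel k * f (t k)) - I) < \<eta>" if t: "\<And>k. k \<in> D \<Longrightarrow> t k \<in> k" for t
  proof -
    have inj: "inj_on (\<lambda>k. (t k, k)) D" by (auto simp: inj_on_def)
    have "(\<lambda>k. (t k, k)) ` D tagged_division_of cbox a b"
    proof (rule tagged_division_ofI)
      show "finite ((\<lambda>k. (t k, k)) ` D)" using finD by simp
      show "x \<in> k" "k \<subseteq> cbox a b" "\<exists>a b. k = cbox a b" if "(x, k) \<in> (\<lambda>k. (t k, k)) ` D" for x k
        using that t division_ofD[OF D] by auto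
      show "interior k1 \<inter> interior k2 = {}"
        if "(x1, k1) \<in> (\<lambda>k. (t k, k)) ` D" "(x2, k2) \<in> (\<lambda>k. (t k, k)) ` D" "(x1, k1) \<noteq> (x2, k2)" for x1 k1 x2 k2
        using that division_ofD(5)[OF D] by auto
      have "{k. \<exists>x. (x, k) \<in> (\<lambda>k. (t k, k)) ` D} = D" by auto
      then show "\<Union>{k. \<exists>x. (x, k) \<in> (\<lambda>k. (t k, k)) ` D} = cbox a b" using division_ofD(6)[OF D] by simp
    qed
    moreover have "(\<lambda>x. ball x \<delta>) fine (\<lambda>k. (t k, k)) ` D"
      using small t by (intro fineI) auto
    ultimately have "norm ((\<Sum>(x, k)\<in>(\<lambda>k. (t k, k)) ` D. measure lborel k *\<^sub>R f x) - I) < \<eta>"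
      by (rule fine)
    then show ?thesis by (simp add: sum.reindex[OF inj] o_def)
  qed
  define bad where "bad k \<longleftrightarrow> (\<exists>x\<in>k. \<exists>y\<in>k. c \<le> f x - f y)" for k
  have "\<exists>x y. x \<in> k \<and> y \<in> k \<and> (if bad k then c else 0) \<le> f x - f y" if "k \<in> D" for k
    using division_ofD(3)[OF D that] unfolding bad_def by (auto simp: ex_in_conv)
  \<comment> \<open>On cells of small oscillation the two tags only need to give a nonnegative difference.\<close>
  then obtain hi lo where hl: "\<And>k. k \<in> D \<Longrightarrow> hi k \<in> k \<and> lo k \<in> k \<and> (if bad k then c else 0) \<le> f (hi k) - f (lo k)"
    by metis
  define E where "E = {k\<in>D. bad k}"
  have "c * (\<Sum>k\<in>E. measure lborel k) = (\<Sum>k\<in>D. measure lborel k * (if bad k then c else 0))"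
    unfolding E_def using finD by (simp add: sum_distrib_left if_distrib sum.If_cases Int_def mult.commute cong: if_cong)
  also have "\<dots> \<le> (\<Sum>k\<in>D. measure lborel k * (f (hi k) - f (lo k)))"
    using hl by (intro sum_mono mult_left_mono) auto
  also have "\<dots> = (\<Sum>k\<in>D. measure lborel k * f (hi k)) - (\<Sum>k\<in>D. measure lborel k * f (lo k))"
    by (simp add: right_diff_distrib sum_subtractf)
  also have "\<dots> \<le> 2 * \<eta>" using retag[of hi] retag[of lo] hl by (simp add: real_norm_def abs_less_iff)
  finally have "(\<Sum>k\<in>E. measure lborel k) \<le> e" using c by (simp add: \<eta>_def)
  define N where "N = (\<Union>k\<in>D. frontier k)"
  have N: "negligible N" unfolding N_def
  proof (rule negligible_Union)
    show "finite (frontier ` D)" using finD by simp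
    fix t assume "t \<in> frontier ` D"
    then obtain k where "k \<in> D" "t = frontier k" by blast
    moreover obtain u v where "k = cbox u v" using division_ofD(4)[OF D \<open>k \<in> D\<close>] by blast
    ultimately show "negligible t" using negligible_frontier_interval[of u v] by (simp add: frontier_cbox)
  qed
  have Elm: "k \<in> lmeasurable" if "k \<in> D" for k using division_ofD(4)[OF D that] by auto
  show "\<exists>T. oscillation_set f c \<inter> cbox a b \<subseteq> T \<and> T \<in> lmeasurable \<and> measure lebesgue T \<le> e"
  proof (intro exI[of _ "\<Union>E \<union> N"] conjI)
    show "oscillation_set f c \<inter> cbox a b \<subseteq> \<Union>E \<union> N"
    proof
      fix z assume z: "z \<in> oscillation_set f c \<inter> cbox a b"
      then obtain k where k: "k \<in> D" "z \<in> k" using division_ofD(6)[OF D] by blast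
      show "z \<in> \<Union>E \<union> N"
      proof (cases "z \<in> interior k")
        case True
        then obtain r where "r > 0" "ball z r \<subseteq> k" by (auto simp: mem_interior)
        then have "bad k" using z unfolding oscillation_set_def bad_def by blast
        then show ?thesis using k by (auto simp: E_def)
      next
        case False
        then have "z \<in> frontier k" using k(2) closure_subset by (auto simp: frontier_def)
        then show ?thesis using k(1) by (auto simp: N_def)
      qed
    qed
    have E: "\<Union>E \<in> lmeasurable" using finD Elm by (intro fmeasurable.finite_Union) (auto simp: E_def)
    then show "\<Union>E \<union> N \<in> lmeasurable" using N by (intro fmeasurable.Un) (auto intro: negligible_imp_measurable)
    have "measure lebesgue (\<Union>E \<union> N) \<le> measure lebesgue (\<Union>E) + measure lebesgue N"
      using E N by (intro measure_Un_le fmeasurableD) (auto intro: negligible_imp_measurable)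
    also have "measure lebesgue N = 0" using N by (rule negligible_imp_measure0)
    also have "measure lebesgue (\<Union>E) \<le> (\<Sum>k\<in>E. measure lebesgue k)"
      using measure_UNION_le[of E "\<lambda>k. k" lebesgue] finD Elm by (auto simp: E_def)
    also have "(\<Sum>k\<in>E. measure lebesgue k) = (\<Sum>k\<in>E. measure lborel k)"
    proof (intro sum.cong refl)
      fix k assume "k \<in> E"
      then obtain u v where "k = cbox u v" using division_ofD(4)[OF D, of k] unfolding E_def by blast
      then show "measure lebesgue k = measure lborel k" by (simp add: measure_completion)
    qed
    finally show "measure lebesgue (\<Union>E \<union> N) \<le> e" using \<open>(\<Sum>k\<in>E. measure lborel k) \<le> e\<close> by simp
  qed
qed

lemma UN_cbox_UNIV: "(\<Union>n::nat. cbox (- (real n *\<^sub>R One)) (real n *\<^sub>R One)) = (UNIV :: 'a::euclidean_space set)"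
proof -
  have "\<exists>n::nat. x \<in> cbox (- (real n *\<^sub>R One)) (real n *\<^sub>R One)" for x :: 'a
  proof -
    obtain n where n: "norm x \<le> real n" using real_arch_simple by blast
    have "\<bar>x \<bullet> b\<bar> \<le> real n" if "b \<in> Basis" for b using Basis_le_norm[OF that, of x] n by linarith
    then show ?thesis by (intro exI[of _ n]) (auto simp: mem_box abs_le_iff minus_le_iff)
  qed
  then show ?thesis by auto
qed

lemma riemann_integrable_real_AE_isCont:
  fixes f :: "'a::euclidean_space \<Rightarrow> real"
  assumes "riemann_integrable f"
  shows "AE z in lebesgue. isCont f z"
proof -
  define B :: "nat \<Rightarrow> 'a set" where "B k = cbox (- (real k *\<^sub>R One)) (real k *\<^sub>R One)" for k
  have "negligible (\<Union>(k, n)\<in>UNIV. oscillation_set f (1 / real (Suc n)) \<inter> B k)"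
    unfolding negligible_iff_null_sets
    using assms by (intro null_sets_UN')
      (auto simp: B_def riemann_integrable_def negligible_iff_null_sets[symmetric] intro!: negligible_oscillation_set)
  then have "AE z in lebesgue. z \<notin> (\<Union>(k, n)\<in>UNIV. oscillation_set f (1 / real (Suc n)) \<inter> B k)"
    by (intro AE_not_in) (simp add: negligible_iff_null_sets)
  then show ?thesis
  proof eventually_elim
    fix z assume z: "z \<notin> (\<Union>(k, n)\<in>UNIV. oscillation_set f (1 / real (Suc n)) \<inter> B k)"
    obtain k where "z \<in> B k" using UN_cbox_UNIV[where 'a = 'a] unfolding B_def by blast
    then have "z \<notin> oscillation_set f (1 / real (Suc n))" for n using z by auto
    then show "isCont f z" by (rule isCont_outside_oscillation_sets)
  qed
qed

lemma riemann_integrable_compose_functional: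
  fixes f :: "'a::euclidean_space \<Rightarrow> complex"
  assumes f: "riemann_integrable f" and h: "bounded_linear (h :: complex \<Rightarrow> real)" "\<And>u. \<bar>h u\<bar> \<le> norm u"
  shows "riemann_integrable (\<lambda>z. h (f z))"
  unfolding riemann_integrable_def riemann_integrable_on_def
proof (intro allI)
  fix a b
  interpret h: bounded_linear h by fact
  obtain I where I: "\<forall>e>0. \<exists>\<delta>>0. \<forall>p. p tagged_division_of (cbox a b) \<and> (\<lambda>x. ball x \<delta>) fine p \<longrightarrow>
     norm ((\<Sum>(x, k)\<in>p. measure lborel k *\<^sub>R f x) - I) < e"
    using f[unfolded riemann_integrable_def, rule_format, of a b] unfolding riemann_integrable_on_def by (rule exE)
  have "norm ((\<Sum>(x, k)\<in>p. measure lborel k *\<^sub>R h (f x)) - h I) \<le> norm ((\<Sum>(x, k)\<in>p. measure lborel k *\<^sub>R f x) - I)" for p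
    using h(2)[of "(\<Sum>(x, k)\<in>p. measure lborel k *\<^sub>R f x) - I"]
    by (simp add: h.diff h.sum h.scaleR split_beta)
  note le = this
  show "\<exists>I. \<forall>e>0. \<exists>\<delta>>0. \<forall>p. p tagged_division_of (cbox a b) \<and> (\<lambda>x. ball x \<delta>) fine p \<longrightarrow>
     norm ((\<Sum>(x, k)\<in>p. measure lborel k *\<^sub>R h (f x)) - I) < e"
  proof (rule exI[of _ "h I"], intro allI impI)
    fix e :: real assume "e > 0"
    with I obtain \<delta> where "\<delta> > 0" "\<forall>p. p tagged_division_of (cbox a b) \<and> (\<lambda>x. ball x \<delta>) fine p \<longrightarrow>
       norm ((\<Sum>(x, k)\<in>p. measure lborel k *\<^sub>R f x) - I) < e" by blast
    then show "\<exists>\<delta>>0. \<forall>p. p tagged_division_of (cbox a b) \<and> (\<lambda>x. ball x \<delta>) fine p \<longrightarrow>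
       norm ((\<Sum>(x, k)\<in>p. measure lborel k *\<^sub>R h (f x)) - h I) < e"
      by (intro exI[of _ \<delta>] conjI allI impI le_less_trans[OF le]) blast+
  qed
qed

text \<open>One half of Lebesgue's criterion, applied to the real and the imaginary part.\<close>
lemma riemann_integrable_AE_isCont:
  fixes f :: "'a::euclidean_space \<Rightarrow> complex"
  assumes f: "riemann_integrable f"
  shows "AE z in lebesgue. isCont f z"
proof -
  have "AE z in lebesgue. isCont (\<lambda>z. Re (f z)) z" "AE z in lebesgue. isCont (\<lambda>z. Im (f z)) z"
    by (intro riemann_integrable_real_AE_isCont riemann_integrable_compose_functional[OF f]
        bounded_linear_Re bounded_linear_Im abs_Re_le_cmod abs_Im_le_cmod)+
  then show ?thesis
    by eventually_elim (simp add: isCont_def tendsto_complex_iff)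
qed

text \<open>On a box the Riemann integral is a gauge integral, and gauge integrable functions are Lebesgue
  measurable.\<close>
lemma riemann_integrable_measurable:
  fixes f :: "'a::euclidean_space \<Rightarrow> complex"
  assumes f: "riemann_integrable f"
  shows "f \<in> borel_measurable lebesgue"
proof (rule borel_measurable_LIMSEQ_metric)
  define B :: "nat \<Rightarrow> 'a set" where "B k = cbox (- (real k *\<^sub>R One)) (real k *\<^sub>R One)" for k
  show "(\<lambda>z. if z \<in> B k then f z else 0) \<in> borel_measurable lebesgue" for k
  proof -
    obtain I where I: "\<forall>e>0. \<exists>\<delta>>0. \<forall>p. p tagged_division_of (B k) \<and> (\<lambda>x. ball x \<delta>) fine p \<longrightarrow>
       norm ((\<Sum>(x, k)\<in>p. measure lborel k *\<^sub>R f x) - I) < e"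
      using f[unfolded riemann_integrable_def, rule_format, of "- (real k *\<^sub>R One)" "real k *\<^sub>R One"]
      unfolding riemann_integrable_on_def B_def by (rule exE)
    have "(f has_integral I) (B k)"
      unfolding B_def has_integral
    proof (intro allI impI)
      fix e :: real assume "e > 0"
      then obtain \<delta> where "\<delta> > 0" and d: "\<forall>p. p tagged_division_of (B k) \<and> (\<lambda>x. ball x \<delta>) fine p \<longrightarrow>
         norm ((\<Sum>(x, k)\<in>p. measure lborel k *\<^sub>R f x) - I) < e" using I by blast
      show "\<exists>\<gamma>. gauge \<gamma> \<and> (\<forall>\<D>. \<D> tagged_division_of cbox (- (real k *\<^sub>R One)) (real k *\<^sub>R One) \<and> \<gamma> fine \<D> \<longrightarrow>
          norm ((\<Sum>(x, k)\<in>\<D>. measure lborel k *\<^sub>R f x) - I) < e)"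
        using \<open>\<delta> > 0\<close> d by (intro exI[of _ "\<lambda>x. ball x \<delta>"]) (simp add: gauge_def B_def)
    qed
    then have "f \<in> borel_measurable (lebesgue_on (B k))" by (intro integrable_imp_measurable) (auto simp: integrable_on_def)
    then show ?thesis by (intro borel_measurable_if_I) (auto simp: B_def)
  qed
  show "(\<lambda>k. if z \<in> B k then f z else 0) \<longlonglongrightarrow> f z" for z
  proof (rule tendsto_eventually)
    obtain k where k: "z \<in> B k" using UN_cbox_UNIV[where 'a = 'a] unfolding B_def by blast
    have "B k \<subseteq> B j" if "k \<le> j" for j unfolding B_def subset_box using that by (auto simp: algebra_simps)
    then show "\<forall>\<^sub>F j in sequentially. (if z \<in> B j then f z else 0) = f z"
      using k by (auto simp: eventually_sequentially intro!: exI[of _ k])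
  qed
qed

section \<open>Lattice sums as integrals\<close>

definition mesh_floor :: "real \<Rightarrow> real^'n \<Rightarrow> real^'n" where
  "mesh_floor r x = (\<chi> i. r * of_int \<lfloor>x $ i / r\<rfloor>)"

text \<open>The point of \<open>lattice \<alpha> \<beta>\<close> at the lower corner of the half-open cell that contains \<open>z\<close>.\<close>
definition lattice_floor :: "real \<Rightarrow> real \<Rightarrow> ('n::finite) phase_space \<Rightarrow> 'n phase_space" where
  "lattice_floor \<alpha> \<beta> z = (mesh_floor \<alpha> (fst z), mesh_floor \<beta> (snd z))"

lemma mesh_floor_bounds:
  assumes "r > 0"
  shows "mesh_floor r x $ i \<le> x $ i" "x $ i < mesh_floor r x $ i + r"
proof -
  show "mesh_floor r x $ i \<le> x $ i" "x $ i < mesh_floor r x $ i + r"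
    using floor_divide_lower[OF assms, of "x $ i"] floor_divide_upper[OF assms, of "x $ i"]
    by (simp_all add: mesh_floor_def algebra_simps)
qed

lemma mesh_floor_eqI:
  assumes "r > 0" "\<And>i. k $ i \<in> \<int>" "\<And>i. r * k $ i \<le> x $ i" "\<And>i. x $ i < r * k $ i + r"
  shows "mesh_floor r x = r *\<^sub>R k"
proof (rule vec_eq_iff[THEN iffD2], rule allI)
  fix i
  obtain j where j: "k $ i = of_int j" using assms(2)[of i] by (auto elim: Ints_cases)
  have "\<lfloor>x $ i / r\<rfloor> = j"
    using assms(1) assms(3)[of i] assms(4)[of i] by (intro floor_unique) (simp_all add: j field_simps)
  then show "mesh_floor r x $ i = (r *\<^sub>R k) $ i" by (simp add: mesh_floor_def j)
qed

lemma lattice_floor_in_lattice: "lattice_floor \<alpha> \<beta> z \<in> lattice \<alpha> \<beta>"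
proof -
  have "mesh_floor r x = r *\<^sub>R (\<chi> i. of_int \<lfloor>x $ i / r\<rfloor>)" for r and x :: "real^'a"
    by (simp add: mesh_floor_def vec_eq_iff)
  then show ?thesis unfolding lattice_def lattice_floor_def by (intro CollectI exI conjI allI) (auto simp: Ints_of_int)
qed

lemma lattice_floor_eq_iff:
  assumes "\<alpha> > 0" "\<beta> > 0" "n \<in> lattice \<alpha> \<beta>"
  shows "lattice_floor \<alpha> \<beta> z = n \<longleftrightarrow>
    (\<forall>i. fst n $ i \<le> fst z $ i \<and> fst z $ i < fst n $ i + \<alpha>) \<and>
    (\<forall>i. snd n $ i \<le> snd z $ i \<and> snd z $ i < snd n $ i + \<beta>)"
proof
  assume "lattice_floor \<alpha> \<beta> z = n"
  then show "(\<forall>i. fst n $ i \<le> fst z $ i \<and> fst z $ i < fst n $ i + \<alpha>) \<and>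
    (\<forall>i. snd n $ i \<le> snd z $ i \<and> snd z $ i < snd n $ i + \<beta>)"
    using mesh_floor_bounds[OF assms(1)] mesh_floor_bounds[OF assms(2)] by (auto simp: lattice_floor_def)
next
  assume *: "(\<forall>i. fst n $ i \<le> fst z $ i \<and> fst z $ i < fst n $ i + \<alpha>) \<and>
    (\<forall>i. snd n $ i \<le> snd z $ i \<and> snd z $ i < snd n $ i + \<beta>)"
  obtain k l where n: "n = (\<alpha> *\<^sub>R k, \<beta> *\<^sub>R l)" and kl: "\<And>i. k $ i \<in> \<int>" "\<And>i. l $ i \<in> \<int>"
    using assms(3) by (auto simp: lattice_def)
  have "mesh_floor \<alpha> (fst z) = \<alpha> *\<^sub>R k" "mesh_floor \<beta> (snd z) = \<beta> *\<^sub>R l"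
    using * assms kl by (intro mesh_floor_eqI; simp add: n)+
  then show "lattice_floor \<alpha> \<beta> z = n" by (simp add: lattice_floor_def n)
qed

lemma countable_lattice: "countable (lattice \<alpha> \<beta> :: ('n::finite) phase_space set)"
proof -
  have "lattice \<alpha> \<beta> \<subseteq> range (\<lambda>(k :: 'n \<Rightarrow> int, l :: 'n \<Rightarrow> int).
      (\<alpha> *\<^sub>R (\<chi> i. real_of_int (k i)), \<beta> *\<^sub>R (\<chi> i. real_of_int (l i))))"
  proof
    fix z :: "'n phase_space" assume "z \<in> lattice \<alpha> \<beta>"
    then obtain k l where z: "z = (\<alpha> *\<^sub>R k, \<beta> *\<^sub>R l)" and kl: "\<And>i. k $ i \<in> \<int>" "\<And>i. l $ i \<in> \<int>"
      by (auto simp: lattice_def)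
    have "(\<chi> i. real_of_int \<lfloor>k $ i\<rfloor>) = k" "(\<chi> i. real_of_int \<lfloor>l $ i\<rfloor>) = l"
      using kl by (simp_all add: vec_eq_iff)
    then show "z \<in> range (\<lambda>(k :: 'n \<Rightarrow> int, l :: 'n \<Rightarrow> int).
        (\<alpha> *\<^sub>R (\<chi> i. real_of_int (k i)), \<beta> *\<^sub>R (\<chi> i. real_of_int (l i))))"
      unfolding z by (intro range_eqI[of _ _ "(\<lambda>i. \<lfloor>k $ i\<rfloor>, \<lambda>i. \<lfloor>l $ i\<rfloor>)"]) simp
  qed
  then show ?thesis by (rule countable_subset) simp
qed

lemma Basis_phase_space:
  "(Basis :: ('n::finite) phase_space set) = range (\<lambda>i. (axis i 1, 0)) \<union> range (\<lambda>i. (0, axis i 1))"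
  by (auto simp: Basis_prod_def Basis_vec_def)

lemma prod_Basis_phase_space:
  "(\<Prod>b\<in>Basis. g b) = (\<Prod>i\<in>UNIV. g (axis i 1, 0)) * (\<Prod>i\<in>UNIV. g (0, axis i (1::real)))"
  for g :: "('n::finite) phase_space \<Rightarrow> real"
proof -
  have inj: "inj (\<lambda>i::'n. (axis i (1::real), 0 :: real^'n))" "inj (\<lambda>i::'n. (0 :: real^'n, axis i (1::real)))"
    by (auto simp: inj_on_def axis_eq_axis)
  have "range (\<lambda>i::'n. (axis i (1::real), 0 :: real^'n)) \<inter> range (\<lambda>i. (0, axis i 1)) = {}"
    by (auto simp: axis_eq_0_iff)
  then show ?thesis
    unfolding Basis_phase_space by (subst prod.union_disjoint) (simp_all add: prod.reindex[OF inj(1)] prod.reindex[OF inj(2)])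
qed

lemma ball_Basis_phase_space:
  "(\<forall>b\<in>Basis. P b) \<longleftrightarrow> (\<forall>i. P (axis i 1, 0)) \<and> (\<forall>i. P (0, axis i (1::real)))"
  for P :: "('n::finite) phase_space \<Rightarrow> bool"
  unfolding Basis_phase_space ball_Un by simp

text \<open>The half-open cell lies between an open and a closed box of equal volume.\<close>
lemma lattice_cell:
  fixes n :: "('n::finite) phase_space"
  assumes "\<alpha> > 0" "\<beta> > 0" "n \<in> lattice \<alpha> \<beta>"
  shows "{z. lattice_floor \<alpha> \<beta> z = n} \<in> sets borel"
    "emeasure lborel {z. lattice_floor \<alpha> \<beta> z = n} = ennreal (\<alpha> ^ CARD('n) * \<beta> ^ CARD('n))"
proof -
  let ?C = "{z. lattice_floor \<alpha> \<beta> z = n}"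
  define u where "u = n + (\<alpha> *\<^sub>R (\<chi> i. 1), \<beta> *\<^sub>R (\<chi> i. 1))"
  have C: "?C = (\<Inter>i. {z. fst n $ i \<le> fst z $ i} \<inter> {z. fst z $ i < fst n $ i + \<alpha>}) \<inter>
      (\<Inter>i. {z. snd n $ i \<le> snd z $ i} \<inter> {z. snd z $ i < snd n $ i + \<beta>})"
    using lattice_floor_eq_iff[OF assms] by auto
  show borel: "?C \<in> sets borel"
    unfolding C
    by (intro sets.Int sets.finite_INT borel_closed borel_open closed_Collect_le open_Collect_less continuous_intros) auto
  have sub: "box n u \<subseteq> ?C" "?C \<subseteq> cbox n u"
    using lattice_floor_eq_iff[OF assms]
    by (auto simp: mem_box ball_Basis_phase_space inner_Pair_0 inner_axis u_def less_imp_le)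
  have le: "n \<bullet> b \<le> u \<bullet> b" if "b \<in> Basis" for b
  proof -
    have "\<forall>b\<in>Basis. n \<bullet> b \<le> u \<bullet> b"
      unfolding ball_Basis_phase_space using assms by (simp add: u_def inner_axis inner_prod_def)
    then show ?thesis using that by blast
  qed
  have vol: "(\<Prod>b\<in>Basis. (u - n) \<bullet> b) = \<alpha> ^ CARD('n) * \<beta> ^ CARD('n)"
    unfolding prod_Basis_phase_space by (simp add: u_def inner_axis inner_prod_def)
  have "emeasure lborel (box n u) \<le> emeasure lborel ?C" "emeasure lborel ?C \<le> emeasure lborel (cbox n u)"
    using sub borel by (auto intro!: emeasure_mono)
  moreover have "emeasure lborel (box n u) = ennreal (\<alpha> ^ CARD('n) * \<beta> ^ CARD('n))"
      "emeasure lborel (cbox n u) = ennreal (\<alpha> ^ CARD('n) * \<beta> ^ CARD('n))"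
    using emeasure_lborel_box[of n u] emeasure_lborel_cbox[of n u] le vol by simp_all
  ultimately show "emeasure lborel ?C = ennreal (\<alpha> ^ CARD('n) * \<beta> ^ CARD('n))" by simp
qed

lemma measurable_lattice_floor:
  assumes "\<alpha> > 0" "\<beta> > 0"
  shows "lattice_floor \<alpha> \<beta> \<in> measurable lborel (count_space (lattice \<alpha> \<beta>))"
  using lattice_cell(1)[OF assms]
  by (subst measurable_count_space_eq_countable[OF countable_lattice])
    (auto simp: lattice_floor_in_lattice vimage_def)

text \<open>Rounding maps Lebesgue measure to a multiple of counting measure on the lattice. This turns
  lattice sums into integrals over the whole space.\<close>
lemma distr_lattice_floor:
  assumes "\<alpha> > 0" "\<beta> > 0"
  shows "distr lborel (count_space (lattice \<alpha> \<beta>)) (lattice_floor \<alpha> \<beta>) =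
    density (count_space (lattice \<alpha> \<beta> :: ('n::finite) phase_space set)) (\<lambda>_. ennreal (\<alpha> ^ CARD('n) * \<beta> ^ CARD('n)))"
proof (rule measure_eqI_countable[OF _ _ countable_lattice])
  fix n :: "'n phase_space" assume n: "n \<in> lattice \<alpha> \<beta>"
  show "emeasure (distr lborel (count_space (lattice \<alpha> \<beta>)) (lattice_floor \<alpha> \<beta>)) {n}
      = emeasure (density (count_space (lattice \<alpha> \<beta>)) (\<lambda>_. ennreal (\<alpha> ^ CARD('n) * \<beta> ^ CARD('n)))) {n}"
    using n lattice_cell(2)[OF assms n]
    by (subst emeasure_distr[OF measurable_lattice_floor[OF assms]])
      (auto simp: emeasure_density vimage_def nn_integral_cmult)
qed auto

lemma integral_lattice_floor:
  fixes g :: "('n::finite) phase_space \<Rightarrow> 'b::{banach, second_countable_topology}"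
  assumes "\<alpha> > 0" "\<beta> > 0"
  shows "integrable lborel (\<lambda>z. g (lattice_floor \<alpha> \<beta> z)) \<longleftrightarrow> integrable (count_space (lattice \<alpha> \<beta>)) g"
    "(LINT z|lborel. g (lattice_floor \<alpha> \<beta> z)) =
      (\<alpha> ^ CARD('n) * \<beta> ^ CARD('n)) *\<^sub>R (LINT n|count_space (lattice \<alpha> \<beta>). g n)"
proof -
  have c: "\<alpha> ^ CARD('n) * \<beta> ^ CARD('n) > 0" using assms by simp
  have "integrable lborel (\<lambda>z. g (lattice_floor \<alpha> \<beta> z)) \<longleftrightarrow>
      integrable (density (count_space (lattice \<alpha> \<beta>)) (\<lambda>_. ennreal (\<alpha> ^ CARD('n) * \<beta> ^ CARD('n)))) g"
    unfolding distr_lattice_floor[OF assms, symmetric]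
    by (rule integrable_distr_eq[OF measurable_lattice_floor[OF assms], symmetric]) simp
  also have "\<dots> \<longleftrightarrow> integrable (count_space (lattice \<alpha> \<beta>)) g"
  proof -
    let ?c = "\<alpha> ^ CARD('n) * \<beta> ^ CARD('n)" and ?M = "count_space (lattice \<alpha> \<beta>)"
    have "integrable (density ?M (\<lambda>_. ennreal ?c)) g \<longleftrightarrow> integrable ?M (\<lambda>n. ?c *\<^sub>R g n)"
      using c by (intro integrable_density) auto
    also have "\<dots> \<longleftrightarrow> integrable ?M g"
      using integrable_scaleR_right[of "1 / ?c" ?M "\<lambda>n. ?c *\<^sub>R g n"] integrable_scaleR_right[of ?c ?M g] assms by auto
    finally show ?thesis .
  qed
  finally show "integrable lborel (\<lambda>z. g (lattice_floor \<alpha> \<beta> z)) \<longleftrightarrow> integrable (count_space (lattice \<alpha> \<beta>)) g" .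
  have "(LINT z|lborel. g (lattice_floor \<alpha> \<beta> z)) =
      (LINT n|density (count_space (lattice \<alpha> \<beta>)) (\<lambda>_. ennreal (\<alpha> ^ CARD('n) * \<beta> ^ CARD('n))). g n)"
    unfolding distr_lattice_floor[OF assms, symmetric]
    by (rule integral_distr[OF measurable_lattice_floor[OF assms], symmetric]) simp
  also have "\<dots> = (\<alpha> ^ CARD('n) * \<beta> ^ CARD('n)) *\<^sub>R (LINT n|count_space (lattice \<alpha> \<beta>). g n)"
    using c by (subst integral_density) auto
  finally show "(LINT z|lborel. g (lattice_floor \<alpha> \<beta> z)) =
      (\<alpha> ^ CARD('n) * \<beta> ^ CARD('n)) *\<^sub>R (LINT n|count_space (lattice \<alpha> \<beta>). g n)" .
qed

lemma lattice_floor_tendsto: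
  fixes z :: "('n::finite) phase_space"
  assumes pos: "\<And>k. \<alpha> k > 0" "\<And>k. \<beta> k > 0" and lim: "\<alpha> \<longlonglongrightarrow> 0" "\<beta> \<longlonglongrightarrow> 0"
  shows "(\<lambda>k. lattice_floor (\<alpha> k) (\<beta> k) z) \<longlonglongrightarrow> z"
proof -
  have "(\<lambda>k. mesh_floor (r k) x) \<longlonglongrightarrow> x" if "\<And>k. r k > 0" "r \<longlonglongrightarrow> 0" for r and x :: "real^'n"
  proof (rule vec_tendstoI)
    fix i
    have lower: "(\<lambda>k. x $ i - r k) \<longlonglongrightarrow> x $ i" using tendsto_diff[OF tendsto_const that(2), of "x $ i"] by simp
    have "x $ i - r k \<le> mesh_floor (r k) x $ i" "mesh_floor (r k) x $ i \<le> x $ i" for k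
      using mesh_floor_bounds[OF that(1)[of k], of x i] by linarith+
    then show "(\<lambda>k. mesh_floor (r k) x $ i) \<longlonglongrightarrow> x $ i"
      by (intro tendsto_sandwich[OF _ _ lower tendsto_const] always_eventually allI)
  qed
  from tendsto_Pair[OF this[OF pos(1) lim(1)] this[OF pos(2) lim(2)], of "fst z" "snd z"]
  show ?thesis by (simp add: lattice_floor_def)
qed

text \<open>The supremum of \<open>|m|\<close> over the unit cell at \<open>n\<close>. It is finite at every lattice point \<open>n\<close> when the
  amalgam norm is finite, so that \<open>enn2real\<close> loses nothing.\<close>
definition cell_sup :: "(('n::finite) phase_space \<Rightarrow> complex) \<Rightarrow> 'n phase_space \<Rightarrow> real" where
  "cell_sup m n = enn2real (SUP z\<in>{z. \<forall>b\<in>Basis. 0 \<le> (z - n) \<bullet> b \<and> (z - n) \<bullet> b < 1}. ennreal (norm (m z)))"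

text \<open>The function \<open>z \<mapsto> cell_sup m (lattice_floor 1 1 z)\<close> is constant on unit cells, and its integral is
  the amalgam norm.\<close>
lemma
  fixes m :: "('n::finite) phase_space \<Rightarrow> complex"
  assumes m: "amalgam_norm m < \<infinity>"
  shows norm_le_cell_sup: "norm (m z) \<le> cell_sup m (lattice_floor 1 1 z)"
    and integrable_cell_sup: "integrable lborel (\<lambda>z. cell_sup m (lattice_floor 1 1 z))"
proof -
  let ?cell = "\<lambda>n :: 'n phase_space. {z. \<forall>b\<in>Basis. 0 \<le> (z - n) \<bullet> b \<and> (z - n) \<bullet> b < 1}"
  define s where "s n = (SUP z\<in>?cell n. ennreal (norm (m z)))" for n
  have total: "(\<Sum>n\<in>F. s n) \<le> amalgam_norm m" if "finite F" "F \<subseteq> lattice 1 1" for F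
    unfolding amalgam_norm_def s_def[symmetric]
  proof -
    have "(\<Sum>\<^sub>\<infinity>n\<in>F. s n) \<le> (\<Sum>\<^sub>\<infinity>n\<in>lattice 1 1. s n)"
      using that(2) by (intro infsum_mono_neutral nonneg_summable_on_complete) auto
    then show "(\<Sum>n\<in>F. s n) \<le> (\<Sum>\<^sub>\<infinity>n\<in>lattice 1 1. s n)" using that(1) by simp
  qed
  have fin: "s n < \<infinity>" if "n \<in> lattice 1 1" for n using total[of "{n}"] that m by (auto intro: le_less_trans)
  have cs: "ennreal (cell_sup m n) = s n" if "n \<in> lattice 1 1" for n
    using fin[OF that] by (simp add: cell_sup_def s_def)
  have "z \<in> ?cell (lattice_floor 1 1 z)"
    using mesh_floor_bounds[of 1] by (auto simp: ball_Basis_phase_space inner_axis inner_prod_def lattice_floor_def diff_less_eq add.commute)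
  then have "ennreal (norm (m z)) \<le> s (lattice_floor 1 1 z)" unfolding s_def by (rule SUP_upper)
  then show "norm (m z) \<le> cell_sup m (lattice_floor 1 1 z)"
    unfolding cs[OF lattice_floor_in_lattice[of 1 1 z], symmetric]
    by (simp add: ennreal_le_iff cell_sup_def)
  have "(\<lambda>n. norm (cell_sup m n)) summable_on lattice 1 1"
  proof (rule nonneg_bdd_above_summable_on)
    show "bdd_above (sum (\<lambda>n. norm (cell_sup m n)) ` {F. F \<subseteq> lattice 1 1 \<and> finite F})"
    proof (rule bdd_aboveI2)
      fix F :: "'n phase_space set" assume F: "F \<in> {F. F \<subseteq> lattice 1 1 \<and> finite F}"
      have "ennreal (\<Sum>n\<in>F. norm (cell_sup m n)) = (\<Sum>n\<in>F. ennreal (cell_sup m n))"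
        by (subst sum_ennreal[symmetric]) (auto simp: cell_sup_def)
      also have "\<dots> = (\<Sum>n\<in>F. s n)" using F cs by (intro sum.cong) auto
      also have "\<dots> \<le> amalgam_norm m" using F by (intro total) auto
      also have "\<dots> = ennreal (enn2real (amalgam_norm m))" using m by simp
      finally show "(\<Sum>n\<in>F. norm (cell_sup m n)) \<le> enn2real (amalgam_norm m)" by simp
    qed
  qed auto
  then have "integrable (count_space (lattice 1 1)) (cell_sup m)"
    using abs_summable_equivalent abs_summable_on_def by blast
  then show "integrable lborel (\<lambda>z. cell_sup m (lattice_floor 1 1 z))"
    by (subst integral_lattice_floor) auto
qed

text \<open>The corners of the unit cube, indexed by pairs of truth-valued functions.\<close>
definition cell_shift :: "('n \<Rightarrow> bool) \<times> ('n \<Rightarrow> bool) \<Rightarrow> ('n::finite) phase_space" where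
  "cell_shift s = ((\<chi> i. of_bool (fst s i)), (\<chi> i. of_bool (snd s i)))"

text \<open>When the mesh is at most 1, the lattice point below \<open>z\<close> lies in the unit cell of \<open>z\<close> or in one of
  the cells adjacent to it from below. The sum over all these cells dominates every sample.\<close>
definition amalgam_majorant :: "(('n::finite) phase_space \<Rightarrow> complex) \<Rightarrow> 'n phase_space \<Rightarrow> real" where
  "amalgam_majorant m z = (\<Sum>s\<in>UNIV. cell_sup m (lattice_floor 1 1 (z - cell_shift s)))"

lemma integrable_amalgam_majorant:
  fixes m :: "('n::finite) phase_space \<Rightarrow> complex"
  assumes m: "amalgam_norm m < \<infinity>"
  shows "integrable lborel (amalgam_majorant m)"
  unfolding amalgam_majorant_def[abs_def]
proof (rule Bochner_Integration.integrable_sum)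
  fix s :: "('n \<Rightarrow> bool) \<times> ('n \<Rightarrow> bool)"
  let ?c = "\<lambda>z. cell_sup m (lattice_floor 1 1 z)"
  have i: "integrable lborel ?c" by (rule integrable_cell_sup[OF m])
  then have "integrable (distr lborel borel ((+) (- cell_shift s))) ?c" by (simp add: lborel_distr_plus)
  then have "integrable lborel (\<lambda>z. ?c (- cell_shift s + z))"
    using borel_measurable_integrable[OF i] by (subst (asm) integrable_distr_eq) auto
  then show "integrable lborel (\<lambda>z. ?c (z - cell_shift s))" by simp
qed

lemma norm_lattice_sample_le:
  fixes m :: "('n::finite) phase_space \<Rightarrow> complex"
  assumes m: "amalgam_norm m < \<infinity>" and \<alpha>: "0 < \<alpha>" "\<alpha> \<le> 1" and \<beta>: "0 < \<beta>" "\<beta> \<le> 1"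
  shows "norm (m (lattice_floor \<alpha> \<beta> z)) \<le> amalgam_majorant m z"
proof -
  \<comment> \<open>Rounding down by less than 1 lowers the integer part by 0 or 1.\<close>
  have floor: "of_int \<lfloor>y\<rfloor> = real_of_int \<lfloor>x - of_bool (\<lfloor>y\<rfloor> < \<lfloor>x\<rfloor>)\<rfloor>" if "y \<le> x" "x < y + 1" for x y :: real
  proof -
    have "\<lfloor>y\<rfloor> \<le> \<lfloor>x\<rfloor>" "\<lfloor>x\<rfloor> \<le> \<lfloor>y\<rfloor> + 1" using that by linarith+
    then show ?thesis by (cases "\<lfloor>y\<rfloor> < \<lfloor>x\<rfloor>") auto
  qed
  have mesh: "mesh_floor 1 (mesh_floor r x) = mesh_floor 1 (x - (\<chi> i. of_bool (\<lfloor>mesh_floor r x $ i\<rfloor> < \<lfloor>x $ i\<rfloor>)))"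
    if "0 < r" "r \<le> 1" for r and x :: "real^'n"
  proof (rule vec_eq_iff[THEN iffD2], rule allI)
    fix i
    have "mesh_floor r x $ i \<le> x $ i" "x $ i < mesh_floor r x $ i + 1"
      using mesh_floor_bounds[OF that(1), of x i] that(2) by linarith+
    from floor[OF this] show "mesh_floor 1 (mesh_floor r x) $ i
        = mesh_floor 1 (x - (\<chi> i. of_bool (\<lfloor>mesh_floor r x $ i\<rfloor> < \<lfloor>x $ i\<rfloor>))) $ i"
      by (simp add: mesh_floor_def[of 1])
  qed
  define s where "s = (\<lambda>i. \<lfloor>mesh_floor \<alpha> (fst z) $ i\<rfloor> < \<lfloor>fst z $ i\<rfloor>, \<lambda>i. \<lfloor>mesh_floor \<beta> (snd z) $ i\<rfloor> < \<lfloor>snd z $ i\<rfloor>)"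
  have "lattice_floor 1 1 (lattice_floor \<alpha> \<beta> z) = lattice_floor 1 1 (z - cell_shift s)"
    using mesh[OF \<alpha>] mesh[OF \<beta>] by (simp add: lattice_floor_def cell_shift_def s_def)
  then have "norm (m (lattice_floor \<alpha> \<beta> z)) \<le> cell_sup m (lattice_floor 1 1 (z - cell_shift s))"
    using norm_le_cell_sup[OF m, of "lattice_floor \<alpha> \<beta> z"] by simp
  also have "\<dots> \<le> amalgam_majorant m z"
    unfolding amalgam_majorant_def by (rule member_le_sum) (auto simp: cell_sup_def)
  finally show ?thesis .
qed

section \<open>Convolution of measures and operators\<close>

text \<open>A factor of modulus one, absorbed into \<open>U\<close>, turns the complex sum into its absolute value.\<close>
lemma norm_sum_cinner_le_nuclear_bound:
  fixes X :: "('n::finite) L2 \<Rightarrow> 'n L2"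
  assumes X: "nuclear_bound X C" and F: "finite F" "orthonormal F" and U: "linear U" "\<And>x. norm (U x) \<le> norm x"
  shows "norm (\<Sum>e\<in>F. cinner (X e) (U e)) \<le> C"
proof -
  define w where "w = (\<Sum>e\<in>F. cinner (X e) (U e))"
  define c where "c = (if w = 0 then 1 else w / of_real (norm w))"
  have c: "norm c = 1" "cnj c * w = of_real (norm w)"
    using complex_norm_square[of w]
    by (auto simp: c_def norm_divide power2_eq_square field_simps)
  have "linear (\<lambda>x. cscale c (U x))"
    using linear_compose[OF U(1) bounded_linear.linear[OF bounded_linear_cscale[of c]]] by (simp add: comp_def)
  then have "(\<Sum>e\<in>F. X e \<bullet> cscale c (U e)) \<le> C"
    using U(2) c(1) by (intro nuclear_boundD[OF X F]) auto
  moreover have "(\<Sum>e\<in>F. X e \<bullet> cscale c (U e)) = Re (cnj c * w)"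
    by (simp add: inner_L2_def cinner_cscale_right w_def sum_distrib_left)
  ultimately show ?thesis by (simp add: c(2) w_def[symmetric])
qed

lemma adj_tf_shift: "adj (tf_shift z) = tf_shift_inverse z"
  by (rule adj_unique[OF bounded_op_tf_shift_inverse cinner_tf_shift_left])

lemma inner_tf_shift_left: "tf_shift z f \<bullet> g = f \<bullet> tf_shift_inverse z g"
  by (simp add: inner_L2_def cinner_tf_shift_left)

lemma linear_tf_shift: "linear (tf_shift z)" "linear (tf_shift_inverse z)"
  using bounded_op_tf_shift[of z] bounded_op_tf_shift_inverse[of z]
  by (auto simp: bounded_op_def bounded_linear.linear)

definition conjugated :: "(('n::finite) L2 \<Rightarrow> 'n L2) \<Rightarrow> 'n phase_space \<Rightarrow> 'n L2 \<Rightarrow> 'n L2" where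
  "conjugated S z x = tf_shift z (S (tf_shift_inverse z x))"

lemma nuclear_bound_conjugated:
  assumes "nuclear_bound S C"
  shows "nuclear_bound (conjugated S z) C"
  unfolding conjugated_def[abs_def]
  by (rule nuclear_bound_conjugate[OF assms linear_tf_shift(1) norm_tf_shift linear_tf_shift(2)
    norm_tf_shift_inverse tf_shift_tf_shift_inverse inner_tf_shift_left])

definition shift_modulus :: "('b \<Rightarrow> ('n::finite) L2) \<Rightarrow> ('b \<Rightarrow> 'n L2) \<Rightarrow> 'b set \<Rightarrow> 'n phase_space \<Rightarrow> 'n phase_space \<Rightarrow> real" where
  "shift_modulus c a B z w = (\<Sum>b\<in>B. norm (tf_shift z (c b) - tf_shift w (c b)) * norm (a b)
     + norm (c b) * norm (tf_shift z (a b) - tf_shift w (a b)))"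

text \<open>Equicontinuity of \<open>z \<mapsto> \<pi>(z) S \<pi>(z)*\<close> in trace norm. The part of \<open>S\<close> outside the finite-rank
  approximation contributes \<open>\<epsilon>\<close> at \<open>z\<close> and at \<open>w\<close>; for the finite-rank part the difference of
  \<open>x \<mapsto> <x, \<pi>(z) c> \<pi>(z) a\<close> at the two points is a sum of two operators of rank one.\<close>
lemma nuclear_bound_conjugated_diff:
  fixes S :: "('n::finite) L2 \<Rightarrow> 'n L2" and c a :: "'b \<Rightarrow> 'n L2"
  assumes S: "nuclear_bound (\<lambda>x. S x - (\<Sum>b\<in>B. (x \<bullet> c b) *\<^sub>R a b)) \<epsilon>"
  shows "nuclear_bound (\<lambda>x. conjugated S z x - conjugated S w x) (2 * \<epsilon> + shift_modulus c a B z w)"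
proof -
  define S' where "S' x = (\<Sum>b\<in>B. (x \<bullet> c b) *\<^sub>R a b)" for x
  have lin: "tf_shift u (x - y) = tf_shift u x - tf_shift u y" "tf_shift u (r *\<^sub>R x) = r *\<^sub>R tf_shift u x"
    "tf_shift u (\<Sum>b\<in>B. f b) = (\<Sum>b\<in>B. tf_shift u (f b))" for u x y r and f :: "'b \<Rightarrow> 'n L2"
    using linear_tf_shift(1)[of u] by (simp_all add: linear_diff linear_scale linear_sum)
  have S'_conj: "conjugated S' u x = (\<Sum>b\<in>B. (x \<bullet> tf_shift u (c b)) *\<^sub>R tf_shift u (a b))" for u x
    using inner_tf_shift_left[of u] by (simp add: conjugated_def S'_def lin inner_commute)
  have "nuclear_bound (\<lambda>x. (x \<bullet> (tf_shift z (c b) - tf_shift w (c b))) *\<^sub>R tf_shift z (a b)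
      + (x \<bullet> tf_shift w (c b)) *\<^sub>R (tf_shift z (a b) - tf_shift w (a b)))
      (norm (tf_shift z (c b) - tf_shift w (c b)) * norm (a b) + norm (c b) * norm (tf_shift z (a b) - tf_shift w (a b)))" for b
    using nuclear_bound_add[OF nuclear_bound_rank_one[of "tf_shift z (c b) - tf_shift w (c b)" "tf_shift z (a b)"]
        nuclear_bound_rank_one[of "tf_shift w (c b)" "tf_shift z (a b) - tf_shift w (a b)"]]
    by (simp add: norm_tf_shift)
  from nuclear_bound_sum[where B = B, OF this]
  have "nuclear_bound (\<lambda>x. conjugated S' z x - conjugated S' w x) (shift_modulus c a B z w)"
    by (simp add: S'_conj shift_modulus_def sum_subtractf[symmetric] inner_diff_right algebra_simps)
  moreover have "nuclear_bound (\<lambda>x. conjugated S u x - conjugated S' u x) \<epsilon>" for u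
    using nuclear_bound_conjugated[OF S[folded S'_def], of u] by (simp add: conjugated_def[abs_def] lin)
  ultimately have "nuclear_bound (\<lambda>x. (conjugated S z x - conjugated S' z x) - (conjugated S w x - conjugated S' w x)
      + (conjugated S' z x - conjugated S' w x)) ((\<epsilon> + \<epsilon>) + shift_modulus c a B z w)"
    by (intro nuclear_bound_add nuclear_bound_diff)
  then show ?thesis by simp
qed

lemma continuous_cinner_conjugated:
  assumes "bounded_op S"
  shows "continuous_on UNIV (\<lambda>z. cinner (conjugated S z \<psi>) \<phi>)"
proof -
  have "bounded_linear S" using assms by (simp add: bounded_op_def)
  then have "continuous_on UNIV (\<lambda>z. S (tf_shift_inverse z \<psi>))"
    using bounded_linear.continuous_on continuous_tf_shift_inverse by blast
  then show ?thesis
    unfolding conjugated_def cinner_tf_shift_left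
    by (intro bounded_bilinear.continuous_on[OF bounded_bilinear_cinner] continuous_tf_shift_inverse)
qed

text \<open>The definite description in the convolution denotes the operator of a bounded sesquilinear form.
  For the matrix coefficients, which are bounded and continuous in \<open>z\<close>, the integral against \<open>\<mu>\<close> may
  be computed with any density.\<close>
lemma measure_star_weak:
  fixes S :: "('n::finite) L2 \<Rightarrow> 'n L2"
  assumes S: "bounded_op S" and d: "has_density \<mu> \<nu> h"
  shows "bounded_op (\<mu> \<star> S)"
    "cinner ((\<mu> \<star> S) \<psi>) \<phi> = (LINT z|\<nu>. cinner (conjugated S z \<psi>) \<phi> * h z)"
    "integrable \<nu> (\<lambda>z. cinner (conjugated S z \<psi>) \<phi> * h z)"
proof -
  have \<nu>: "space \<nu> = UNIV" "sets borel \<subseteq> sets \<nu>" and h: "integrable \<nu> h"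
    using d by (auto simp: has_density_def)
  obtain K where K0: "0 < K" and K: "\<And>x. norm (S x) \<le> norm x * K"
    using S bounded_linear.pos_bounded unfolding bounded_op_def by blast
  have conj_add: "conjugated S z (x + y) = conjugated S z x + conjugated S z y"
    and conj_scale: "conjugated S z (cscale c x) = cscale c (conjugated S z x)" for z x y c
    using S bounded_op_tf_shift[of z] bounded_op_tf_shift_inverse[of z]
    by (simp_all add: conjugated_def bounded_op_def linear_simps)
  have bound: "norm (cinner (conjugated S z \<psi>) \<phi>) \<le> K * norm \<psi> * norm \<phi>" for z \<psi> \<phi>
  proof -
    have "norm (conjugated S z \<psi>) \<le> K * norm \<psi>"
      using K[of "tf_shift_inverse z \<psi>"] by (simp add: conjugated_def norm_tf_shift norm_tf_shift_inverse mult.commute)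
    then show ?thesis using cinner_cauchy_schwarz[of "conjugated S z \<psi>" \<phi>]
      by (meson mult_right_mono norm_ge_zero order_trans)
  qed
  have borel: "(\<lambda>z. cinner (conjugated S z \<psi>) \<phi>) \<in> borel_measurable borel" for \<psi> \<phi>
    by (rule borel_measurable_continuous_onI[OF continuous_cinner_conjugated[OF S]])
  have meas: "(\<lambda>z. cinner (conjugated S z \<psi>) \<phi>) \<in> borel_measurable \<nu>" for \<psi> \<phi>
    using borel[of \<psi> \<phi>] \<nu> by (auto simp: measurable_def)
  have int: "integrable \<nu> (\<lambda>z. cinner (conjugated S z \<psi>) \<phi> * h z)" for \<psi> \<phi>
  proof (rule Bochner_Integration.integrable_bound)
    show "integrable \<nu> (\<lambda>z. (K * norm \<psi> * norm \<phi>) * norm (h z))" using h by simp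
    show "(\<lambda>z. cinner (conjugated S z \<psi>) \<phi> * h z) \<in> borel_measurable \<nu>"
      using h meas by (intro borel_measurable_times) auto
    show "AE z in \<nu>. norm (cinner (conjugated S z \<psi>) \<phi> * h z) \<le> norm ((K * norm \<psi> * norm \<phi>) * norm (h z))"
      using mult_right_mono[OF bound norm_ge_zero] K0 by (intro AE_I2) (simp add: norm_mult abs_mult)
  qed
  show "integrable \<nu> (\<lambda>z. cinner (conjugated S z \<psi>) \<phi> * h z)" by (rule int)
  define B where "B \<psi> \<phi> = (LINT z|\<nu>. cinner (conjugated S z \<psi>) \<phi> * h z)" for \<psi> \<phi>
  have cm: "cm_integral \<mu> (\<lambda>z. cinner (tf_shift z (S (adj (tf_shift z) \<psi>))) \<phi>) = B \<psi> \<phi>" for \<psi> \<phi>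
    unfolding adj_tf_shift conjugated_def[symmetric] B_def
    by (rule cm_integral_eq[OF d borel bound])
  have "\<exists>!T. bounded_op T \<and> (\<forall>\<psi> \<phi>. cinner (T \<psi>) \<phi> = B \<psi> \<phi>)"
  proof (rule sesquilinear_representation)
    show "B (x + y) z = B x z + B y z" for x y z
      unfolding B_def by (simp add: conj_add cinner_add_left distrib_right int)
    show "B x (y + z) = B x y + B x z" for x y z
      unfolding B_def by (simp add: cinner_add_right distrib_right int)
    show "B (cscale c x) z = c * B x z" for c x z
      unfolding B_def by (simp add: conj_scale cinner_cscale_left mult.assoc)
    show "B x (cscale c z) = cnj c * B x z" for c x z
      unfolding B_def by (simp add: cinner_cscale_right mult.assoc)
    show "norm (B x y) \<le> (K * (LINT z|\<nu>. norm (h z))) * norm x * norm y" for x y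
    proof -
      have "norm (B x y) \<le> (LINT z|\<nu>. norm (cinner (conjugated S z x) y * h z))"
        unfolding B_def by (rule integral_norm_bound)
      also have "\<dots> \<le> (LINT z|\<nu>. (K * norm x * norm y) * norm (h z))"
        using h mult_right_mono[OF bound norm_ge_zero]
        by (intro integral_mono integrable_norm int) (auto simp: norm_mult)
      finally show ?thesis by (simp add: mult_ac)
    qed
  qed
  from theI'[OF this] have "bounded_op (\<mu> \<star> S) \<and> (\<forall>\<psi> \<phi>. cinner ((\<mu> \<star> S) \<psi>) \<phi> = B \<psi> \<phi>)"
    unfolding measure_star_def cm .
  then show "bounded_op (\<mu> \<star> S)" "cinner ((\<mu> \<star> S) \<psi>) \<phi> = (LINT z|\<nu>. cinner (conjugated S z \<psi>) \<phi> * h z)"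
    by (simp_all add: B_def)
qed

lemma integrable_of_amalgam:
  fixes m :: "('n::finite) phase_space \<Rightarrow> complex"
  assumes "riemann_integrable m" "amalgam_norm m < \<infinity>"
  shows "integrable lebesgue m"
proof (rule Bochner_Integration.integrable_bound)
  show "integrable lebesgue (\<lambda>z. cell_sup m (lattice_floor 1 1 z))"
    using integrable_cell_sup[OF assms(2)] integrable_completion borel_measurable_integrable by blast
  show "m \<in> borel_measurable lebesgue" by (rule riemann_integrable_measurable[OF assms(1)])
  show "AE z in lebesgue. norm (m z) \<le> norm (cell_sup m (lattice_floor 1 1 z))"
    using norm_le_cell_sup[OF assms(2)] by (intro AE_I2) (simp add: order_trans[OF _ abs_ge_self])
qed

lemma has_density_density_measure:
  assumes "integrable lebesgue m"
  shows "has_density (density_measure m) lebesgue m"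
  using assms by (auto simp: has_density_def density_measure_def)

lemma measurable_compose_lattice_floor:
  assumes "\<alpha> > 0" "\<beta> > 0"
  shows "(\<lambda>z. g (lattice_floor \<alpha> \<beta> z)) \<in> borel_measurable lborel"
  by (rule measurable_compose[OF measurable_lattice_floor[OF assms]]) simp

lemma integrable_lattice_sample:
  fixes m :: "('n::finite) phase_space \<Rightarrow> complex"
  assumes m: "amalgam_norm m < \<infinity>" and \<alpha>: "0 < \<alpha>" "\<alpha> \<le> 1" and \<beta>: "0 < \<beta>" "\<beta> \<le> 1"
  shows "integrable lborel (\<lambda>z. m (lattice_floor \<alpha> \<beta> z))"
proof (rule Bochner_Integration.integrable_bound[OF integrable_amalgam_majorant[OF m]])
  show "AE z in lborel. norm (m (lattice_floor \<alpha> \<beta> z)) \<le> norm (amalgam_majorant m z)"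
    using norm_lattice_sample_le[OF assms] by (intro AE_I2) (simp add: order_trans[OF _ abs_ge_self])
qed (rule measurable_compose_lattice_floor[OF \<alpha>(1) \<beta>(1)])

text \<open>The sampled measure has a density with respect to counting measure on the whole space, and
  integration against it becomes Lebesgue integration after rounding to the lattice.\<close>
lemma sampled_measure_density:
  fixes m :: "('n::finite) phase_space \<Rightarrow> complex"
  assumes m: "amalgam_norm m < \<infinity>" and \<alpha>: "0 < \<alpha>" "\<alpha> \<le> 1" and \<beta>: "0 < \<beta>" "\<beta> \<le> 1"
  defines "c \<equiv> \<alpha> ^ CARD('n) * \<beta> ^ CARD('n)"
  defines "h \<equiv> \<lambda>z. indicator (lattice \<alpha> \<beta>) z *\<^sub>R (c *\<^sub>R m z)"
  shows "has_density (sampled_measure m \<alpha> \<beta>) (count_space UNIV) h"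
    "(LINT z|count_space UNIV. g z * h z) = (LINT z|lborel. g (lattice_floor \<alpha> \<beta> z) * m (lattice_floor \<alpha> \<beta> z))"
proof -
  have int: "integrable (count_space (lattice \<alpha> \<beta>)) m"
    using integrable_lattice_sample[OF m \<alpha> \<beta>] integral_lattice_floor(1)[OF \<alpha>(1) \<beta>(1)] by blast
  have restrict: "(LINT z|count_space UNIV. g z * h z) = c *\<^sub>R (LINT z|count_space (lattice \<alpha> \<beta>). g z * m z)" for g
  proof -
    have "(LINT z|count_space UNIV. g z * h z) = set_lebesgue_integral (count_space UNIV) (lattice \<alpha> \<beta>) (\<lambda>z. c *\<^sub>R (g z * m z))"
      unfolding set_lebesgue_integral_def h_def
      by (intro Bochner_Integration.integral_cong) (auto simp: indicator_def)
    also have "\<dots> = (LINT z|count_space (lattice \<alpha> \<beta>). c *\<^sub>R (g z * m z))"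
      by (simp flip: infsetsum_altdef add: infsetsum_def)
    finally show ?thesis by simp
  qed
  show "(LINT z|count_space UNIV. g z * h z) = (LINT z|lborel. g (lattice_floor \<alpha> \<beta> z) * m (lattice_floor \<alpha> \<beta> z))"
    unfolding restrict c_def
    by (rule integral_lattice_floor(2)[OF \<alpha>(1) \<beta>(1), of "\<lambda>z. g z * m z", symmetric])
  show "has_density (sampled_measure m \<alpha> \<beta>) (count_space UNIV) h"
    unfolding has_density_def
  proof (intro conjI ballI)
    have "integrable (count_space (lattice \<alpha> \<beta>)) (\<lambda>z. c *\<^sub>R m z)" using int by simp
    then have "Infinite_Set_Sum.abs_summable_on (\<lambda>z. c *\<^sub>R m z) (lattice \<alpha> \<beta>)" unfolding abs_summable_on_def .
    then show "integrable (count_space UNIV) h"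
      unfolding abs_summable_on_altdef set_integrable_def h_def .
    fix A :: "'n phase_space set" assume "A \<in> sets borel"
    have "integrable (count_space (lattice \<alpha> \<beta>)) (\<lambda>z. m z * indicator A z)"
      by (rule Bochner_Integration.integrable_bound[OF int]) (auto simp: indicator_def)
    then have "Infinite_Set_Sum.abs_summable_on (\<lambda>z. m z * indicator A z) (lattice \<alpha> \<beta>)" unfolding abs_summable_on_def .
    then have "(\<Sum>\<^sub>\<infinity>z\<in>lattice \<alpha> \<beta>. m z * indicator A z) = (LINT z|count_space (lattice \<alpha> \<beta>). m z * indicator A z)"
      by (simp flip: infsetsum_infsum add: infsetsum_def)
    moreover have "(LINT z:A|count_space UNIV. h z) = c *\<^sub>R (LINT z|count_space (lattice \<alpha> \<beta>). m z * indicator A z)"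
    proof -
      have "(LINT z:A|count_space UNIV. h z) = (LINT z|count_space UNIV. indicator A z * h z)"
        unfolding set_lebesgue_integral_def by (intro Bochner_Integration.integral_cong) (auto simp: indicator_def)
      also have "\<dots> = c *\<^sub>R (LINT z|count_space (lattice \<alpha> \<beta>). indicator A z * m z)" by (rule restrict)
      finally show ?thesis by (simp only: mult.commute)
    qed
    ultimately show "sampled_measure m \<alpha> \<beta> A = (LINT z:A|count_space UNIV. h z)"
      by (simp add: sampled_measure_def c_def scaleR_conv_of_real)
  qed auto
qed

section \<open>Convergence of the sampled operators\<close>

text \<open>The integrand that bounds the trace norm of the difference: \<open>K\<close> is a nuclear bound of \<open>S\<close>, and
  \<open>2 \<epsilon> + shift_modulus\<close> bounds the variation of the conjugated operators between \<open>z\<close> and the lattice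
  point below it.\<close>
definition discretization_error :: "(('n::finite) phase_space \<Rightarrow> complex) \<Rightarrow> real \<Rightarrow> ('b \<Rightarrow> 'n L2) \<Rightarrow> ('b \<Rightarrow> 'n L2) \<Rightarrow> 'b set
    \<Rightarrow> real \<Rightarrow> real \<Rightarrow> real \<Rightarrow> 'n phase_space \<Rightarrow> real" where
  "discretization_error m K c a B \<epsilon> \<alpha> \<beta> z = K * norm (m (lattice_floor \<alpha> \<beta> z) - m z)
     + norm (m z) * (2 * \<epsilon> + shift_modulus c a B (lattice_floor \<alpha> \<beta> z) z)"

lemma shift_modulus_le: "shift_modulus c a B z w \<le> (\<Sum>b\<in>B. 4 * (norm (c b) * norm (a b)))"
  unfolding shift_modulus_def
proof (rule sum_mono)
  fix b
  have d: "norm (tf_shift z x - tf_shift w x) \<le> 2 * norm x" for x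
    using norm_triangle_ineq4[of "tf_shift z x" "tf_shift w x"] by (simp add: norm_tf_shift)
  show "norm (tf_shift z (c b) - tf_shift w (c b)) * norm (a b) + norm (c b) * norm (tf_shift z (a b) - tf_shift w (a b))
      \<le> 4 * (norm (c b) * norm (a b))"
    using mult_right_mono[OF d[of "c b"], of "norm (a b)"] mult_left_mono[OF d[of "a b"], of "norm (c b)"]
    by (simp add: algebra_simps)
qed

lemma shift_modulus_nonneg: "0 \<le> shift_modulus c a B z w"
  unfolding shift_modulus_def by (intro sum_nonneg) simp

lemma measurable_shift_modulus:
  fixes a c :: "'b \<Rightarrow> ('n::finite) L2"
  assumes "\<alpha> > 0" "\<beta> > 0"
  shows "(\<lambda>z. shift_modulus c a B (lattice_floor \<alpha> \<beta> z) z) \<in> borel_measurable lborel"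
proof (rule measurable_compose_countable'[OF _ measurable_lattice_floor[OF assms] countable_lattice])
  fix n :: "'n phase_space"
  have "continuous_on UNIV (shift_modulus c a B n)"
    unfolding shift_modulus_def by (intro continuous_intros continuous_tf_shift)
  then show "shift_modulus c a B n \<in> borel_measurable lborel"
    using borel_measurable_continuous_onI by simp
qed

lemma discretization_error_bound:
  assumes m: "amalgam_norm m < \<infinity>" and \<alpha>: "0 < \<alpha>" "\<alpha> \<le> 1" and \<beta>: "0 < \<beta>" "\<beta> \<le> 1"
    and K: "0 \<le> K" and \<epsilon>: "0 \<le> \<epsilon>"
  shows "norm (discretization_error m K c a B \<epsilon> \<alpha> \<beta> z) \<le>
    K * (amalgam_majorant m z + norm (m z)) + norm (m z) * (2 * \<epsilon> + (\<Sum>b\<in>B. 4 * (norm (c b) * norm (a b))))"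
proof -
  have "0 \<le> discretization_error m K c a B \<epsilon> \<alpha> \<beta> z"
    using K \<epsilon> unfolding discretization_error_def
    by (intro add_nonneg_nonneg mult_nonneg_nonneg shift_modulus_nonneg norm_ge_zero) auto
  moreover have "norm (m (lattice_floor \<alpha> \<beta> z) - m z) \<le> amalgam_majorant m z + norm (m z)"
    using norm_triangle_ineq4[of "m (lattice_floor \<alpha> \<beta> z)" "m z"] norm_lattice_sample_le[OF m \<alpha> \<beta>, of z] by linarith
  ultimately show ?thesis
    unfolding discretization_error_def using K
    by (simp add: add_mono mult_left_mono shift_modulus_le)
qed

lemma discretization_error_measurable:
  assumes m: "m \<in> borel_measurable lebesgue" and "\<alpha> > 0" "\<beta> > 0"
  shows "discretization_error m K c a B \<epsilon> \<alpha> \<beta> \<in> borel_measurable lebesgue"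
proof -
  have [measurable]: "(\<lambda>z. m (lattice_floor \<alpha> \<beta> z)) \<in> borel_measurable lebesgue"
    "(\<lambda>z. shift_modulus c a B (lattice_floor \<alpha> \<beta> z) z) \<in> borel_measurable lebesgue"
    "m \<in> borel_measurable lebesgue"
    using measurable_completion[OF measurable_compose_lattice_floor[OF assms(2,3), of m]]
      measurable_completion[OF measurable_shift_modulus[OF assms(2,3), of c a B]] m by auto
  show ?thesis unfolding discretization_error_def[abs_def] by measurable
qed

lemma discretization_majorant_integrable:
  assumes m: "riemann_integrable m" "amalgam_norm m < \<infinity>"
  shows "integrable lebesgue (\<lambda>z. K * (amalgam_majorant m z + norm (m z)) + norm (m z) * C)"
proof -
  have "integrable lebesgue (amalgam_majorant m)"
    using integrable_amalgam_majorant[OF m(2)] integrable_completion borel_measurable_integrable by blast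
  moreover have "integrable lebesgue (\<lambda>z. norm (m z))" using integrable_of_amalgam[OF m] by simp
  ultimately show ?thesis
    by (intro Bochner_Integration.integrable_add integrable_mult_right integrable_mult_left)
qed

text \<open>Dominated convergence. At points of continuity of \<open>m\<close> the sampled values converge, and the shift
  modulus vanishes by strong continuity; only the approximation error \<open>\<epsilon>\<close> remains.\<close>
lemma discretization_error_tendsto:
  fixes m :: "('n::finite) phase_space \<Rightarrow> complex"
  assumes m: "riemann_integrable m" "amalgam_norm m < \<infinity>" and K: "0 \<le> K" and \<epsilon>: "0 \<le> \<epsilon>"
    and pos: "\<And>k. 0 < \<alpha> k \<and> \<alpha> k \<le> 1" "\<And>k. 0 < \<beta> k \<and> \<beta> k \<le> 1" and lim: "\<alpha> \<longlonglongrightarrow> 0" "\<beta> \<longlonglongrightarrow> 0"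
  shows "(\<lambda>k. LINT z|lebesgue. discretization_error m K c a B \<epsilon> (\<alpha> k) (\<beta> k) z)
    \<longlonglongrightarrow> 2 * \<epsilon> * (LINT z|lebesgue. norm (m z))"
proof -
  let ?C = "\<Sum>b\<in>B. 4 * (norm (c b) * norm (a b))"
  have mm: "m \<in> borel_measurable lebesgue" by (rule riemann_integrable_measurable[OF m(1)])
  have "(\<lambda>k. LINT z|lebesgue. discretization_error m K c a B \<epsilon> (\<alpha> k) (\<beta> k) z)
    \<longlonglongrightarrow> (LINT z|lebesgue. norm (m z) * (2 * \<epsilon>))"
  proof (rule integral_dominated_convergence)
    show "integrable lebesgue (\<lambda>z. K * (amalgam_majorant m z + norm (m z)) + norm (m z) * (2 * \<epsilon> + ?C))"
      by (rule discretization_majorant_integrable[OF m])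
    show "discretization_error m K c a B \<epsilon> (\<alpha> k) (\<beta> k) \<in> borel_measurable lebesgue" for k
      using pos by (intro discretization_error_measurable mm) auto
    show "(\<lambda>z. norm (m z) * (2 * \<epsilon>)) \<in> borel_measurable lebesgue" using mm by simp
    show "AE z in lebesgue. norm (discretization_error m K c a B \<epsilon> (\<alpha> k) (\<beta> k) z)
        \<le> K * (amalgam_majorant m z + norm (m z)) + norm (m z) * (2 * \<epsilon> + ?C)" for k
      using pos[of k] by (intro AE_I2 discretization_error_bound m K \<epsilon>) auto
    show "AE z in lebesgue. (\<lambda>k. discretization_error m K c a B \<epsilon> (\<alpha> k) (\<beta> k) z) \<longlonglongrightarrow> norm (m z) * (2 * \<epsilon>)"
      using riemann_integrable_AE_isCont[OF m(1)]
    proof eventually_elim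
      fix z assume cont: "isCont m z"
      have l: "(\<lambda>k. lattice_floor (\<alpha> k) (\<beta> k) z) \<longlonglongrightarrow> z"
        using pos lim by (intro lattice_floor_tendsto) auto
      have "(\<lambda>k. discretization_error m K c a B \<epsilon> (\<alpha> k) (\<beta> k) z) \<longlonglongrightarrow>
          K * norm (m z - m z) + norm (m z) * (2 * \<epsilon> + shift_modulus c a B z z)"
        unfolding discretization_error_def shift_modulus_def
        by (intro tendsto_intros isCont_tendsto_compose[OF cont] l tf_shift_tendsto)
      then show "(\<lambda>k. discretization_error m K c a B \<epsilon> (\<alpha> k) (\<beta> k) z) \<longlonglongrightarrow> norm (m z) * (2 * \<epsilon>)"
        by (simp add: shift_modulus_def)
    qed
  qed
  then show ?thesis by (simp add: mult.commute)
qed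

lemma bounded_op_diff:
  assumes "bounded_op A" "bounded_op B"
  shows "bounded_op (\<lambda>x. A x - B x)"
proof -
  have "cscale c (x - y) = cscale c x - cscale c y" for c and x y :: "'a L2"
    by (rule linear_diff[OF bounded_linear.linear[OF bounded_linear_cscale]])
  then show ?thesis using assms by (simp add: bounded_op_def bounded_linear_sub)
qed

text \<open>Both operators are integrals of the same matrix coefficient \<open>g\<close>, and
  \<open>g(\<lambda>) m(\<lambda>) - g(z) m(z) = g(\<lambda>) (m(\<lambda>) - m(z)) + m(z) (g(\<lambda>) - g(z))\<close>.\<close>
lemma sampling_difference_nuclear_bound:
  fixes m :: "('n::finite) phase_space \<Rightarrow> complex" and c a :: "'b \<Rightarrow> 'n L2"
  assumes m: "riemann_integrable m" "amalgam_norm m < \<infinity>" and Sb: "bounded_op S"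
    and \<alpha>: "0 < \<alpha>" "\<alpha> \<le> 1" and \<beta>: "0 < \<beta>" "\<beta> \<le> 1"
    and K: "nuclear_bound S K" and S: "nuclear_bound (\<lambda>x. S x - (\<Sum>b\<in>B. (x \<bullet> c b) *\<^sub>R a b)) \<epsilon>"
    and K0: "0 \<le> K" and \<epsilon>: "0 \<le> \<epsilon>"
  shows "bounded_op (\<lambda>\<psi>. (sampled_measure m \<alpha> \<beta> \<star> S) \<psi> - (density_measure m \<star> S) \<psi>)" (is "bounded_op ?T")
    "nuclear_bound (\<lambda>\<psi>. (sampled_measure m \<alpha> \<beta> \<star> S) \<psi> - (density_measure m \<star> S) \<psi>)
      (LINT z|lebesgue. discretization_error m K c a B \<epsilon> \<alpha> \<beta> z)"
proof -
  let ?L = "lattice_floor \<alpha> \<beta> :: 'n phase_space \<Rightarrow> 'n phase_space"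
  note dens = has_density_density_measure[OF integrable_of_amalgam[OF m]]
  note samp = sampled_measure_density[OF m(2) \<alpha> \<beta>]
  note star = measure_star_weak[OF Sb samp(1)] measure_star_weak[OF Sb dens]
  show "bounded_op ?T"
    by (rule bounded_op_diff[OF star(1,4)])
  have mm: "m \<in> borel_measurable lebesgue" by (rule riemann_integrable_measurable[OF m(1)])
  show "nuclear_bound ?T (LINT z|lebesgue. discretization_error m K c a B \<epsilon> \<alpha> \<beta> z)"
  proof (rule nuclear_boundI)
    fix F :: "'n L2 set" and U :: "'n L2 \<Rightarrow> 'n L2"
    assume F: "finite F" "orthonormal F" and U: "linear U" "\<And>x. norm (U x) \<le> norm x"
    define g where "g z = (\<Sum>e\<in>F. cinner (conjugated S z e) (U e))" for z
    have gK: "norm (g z) \<le> K" for z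
      unfolding g_def by (rule norm_sum_cinner_le_nuclear_bound[OF nuclear_bound_conjugated[OF K] F U])
    have gd: "norm (g z - g w) \<le> 2 * \<epsilon> + shift_modulus c a B z w" for z w
      using norm_sum_cinner_le_nuclear_bound[OF nuclear_bound_conjugated_diff[OF S, of z w] F U]
      by (simp add: g_def sum_subtractf bounded_bilinear.diff_left[OF bounded_bilinear_cinner])
    have gm: "g \<in> borel_measurable borel"
      unfolding g_def by (intro borel_measurable_continuous_onI continuous_intros continuous_cinner_conjugated Sb)
    have i1: "integrable lborel (\<lambda>z. g (?L z) * m (?L z))"
    proof (rule Bochner_Integration.integrable_bound)
      show "integrable lborel (\<lambda>z. K * norm (m (?L z)))" using integrable_lattice_sample[OF m(2) \<alpha> \<beta>] by simp
      show "AE z in lborel. norm (g (?L z) * m (?L z)) \<le> norm (K * norm (m (?L z)))"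
        using gK K0 by (intro AE_I2) (simp add: norm_mult mult_right_mono)
    qed (rule measurable_compose_lattice_floor[OF \<alpha>(1) \<beta>(1)])
    then have i1': "integrable lebesgue (\<lambda>z. g (?L z) * m (?L z))"
      and e1: "(LINT z|lebesgue. g (?L z) * m (?L z)) = (LINT z|lborel. g (?L z) * m (?L z))"
      by (simp_all add: integrable_completion integral_completion borel_measurable_integrable)
    have sum1: "(\<Sum>e\<in>F. cinner ((sampled_measure m \<alpha> \<beta> \<star> S) e) (U e)) = (LINT z|lebesgue. g (?L z) * m (?L z))"
    proof -
      have "(\<Sum>e\<in>F. cinner ((sampled_measure m \<alpha> \<beta> \<star> S) e) (U e)) =
          (LINT z|count_space UNIV. g z * (indicator (lattice \<alpha> \<beta>) z *\<^sub>R ((\<alpha> ^ CARD('n) * \<beta> ^ CARD('n)) *\<^sub>R m z)))"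
        unfolding star(2) g_def sum_distrib_right by (rule Bochner_Integration.integral_sum[symmetric]) (rule star(3))
      then show ?thesis unfolding samp(2) e1 .
    qed
    have sum2: "(\<Sum>e\<in>F. cinner ((density_measure m \<star> S) e) (U e)) = (LINT z|lebesgue. g z * m z)"
      unfolding star(5) g_def sum_distrib_right by (rule Bochner_Integration.integral_sum[symmetric]) (rule star(6))
    have i2: "integrable lebesgue (\<lambda>z. g z * m z)"
      unfolding g_def sum_distrib_right by (intro Bochner_Integration.integrable_sum star(6))
    have "(\<Sum>e\<in>F. ?T e \<bullet> U e) = Re (LINT z|lebesgue. g (?L z) * m (?L z) - g z * m z)"
      using i1' i2 by (simp add: inner_L2_def bounded_bilinear.diff_left[OF bounded_bilinear_cinner] sum_subtractf
          flip: sum1 sum2)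
    also have "\<dots> \<le> norm (LINT z|lebesgue. g (?L z) * m (?L z) - g z * m z)" by (rule complex_Re_le_cmod)
    also have "\<dots> \<le> (LINT z|lebesgue. norm (g (?L z) * m (?L z) - g z * m z))" by (rule integral_norm_bound)
    also have "\<dots> \<le> (LINT z|lebesgue. discretization_error m K c a B \<epsilon> \<alpha> \<beta> z)"
    proof (rule integral_mono)
      show "integrable lebesgue (\<lambda>z. norm (g (?L z) * m (?L z) - g z * m z))" using i1' i2 by simp
      show "integrable lebesgue (discretization_error m K c a B \<epsilon> \<alpha> \<beta>)"
      proof (rule Bochner_Integration.integrable_bound[OF discretization_majorant_integrable[OF m]
            discretization_error_measurable[OF mm \<alpha>(1) \<beta>(1)]], rule AE_I2)
        fix z
        show "norm (discretization_error m K c a B \<epsilon> \<alpha> \<beta> z) \<le> norm (K * (amalgam_majorant m z + norm (m z))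
            + norm (m z) * (2 * \<epsilon> + (\<Sum>b\<in>B. 4 * (norm (c b) * norm (a b)))))"
          unfolding real_norm_def[of "K * _ + _"]
          by (rule order_trans[OF discretization_error_bound[OF m(2) \<alpha> \<beta> K0 \<epsilon>] abs_ge_self])
      qed
      fix z
      have "g (?L z) * m (?L z) - g z * m z = g (?L z) * (m (?L z) - m z) + m z * (g (?L z) - g z)"
        by (simp add: algebra_simps)
      also have "norm \<dots> \<le> norm (g (?L z)) * norm (m (?L z) - m z) + norm (m z) * norm (g (?L z) - g z)"
        by (rule order_trans[OF norm_triangle_ineq]) (simp add: norm_mult)
      also have "\<dots> \<le> discretization_error m K c a B \<epsilon> \<alpha> \<beta> z"
        unfolding discretization_error_def by (intro add_mono mult_right_mono mult_left_mono gK gd) auto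
      finally show "norm (g (?L z) * m (?L z) - g z * m z) \<le> discretization_error m K c a B \<epsilon> \<alpha> \<beta> z" .
    qed
    finally show "(\<Sum>e\<in>F. ?T e \<bullet> U e) \<le> (LINT z|lebesgue. discretization_error m K c a B \<epsilon> \<alpha> \<beta> z)" .
  qed
qed

theorem theorem4p17:
  fixes m :: "('n :: finite) phase_space \<Rightarrow> complex"
    and S :: "'n L2 \<Rightarrow> 'n L2"
  assumes "riemann_integrable m"
    and "amalgam_norm m < \<infinity>"
    and "trace_class S"
  shows "((\<lambda>(\<alpha>, \<beta>). trace_norm (\<lambda>\<psi>. (sampled_measure m \<alpha> \<beta> \<star> S) \<psi> - (density_measure m \<star> S) \<psi>))
           \<longlongrightarrow> 0) (at_right 0 \<times>\<^sub>F at_right 0)"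
proof -
  note m = assms(1,2)
  have Sb: "bounded_op S" using assms(3) by (simp add: trace_class_def)
  define t where "t \<alpha> \<beta> = trace_norm (\<lambda>\<psi>. (sampled_measure m \<alpha> \<beta> \<star> S) \<psi> - (density_measure m \<star> S) \<psi>)" for \<alpha> \<beta>
  obtain K0 where "nuclear_bound S K0" using trace_class_nuclear_bound[OF assms(3)] by blast
  then have K: "nuclear_bound S (max K0 0)" by (rule nuclear_bound_mono) simp
  have small: "\<exists>d>0. \<forall>\<alpha> \<beta>. 0 < \<alpha> \<longrightarrow> \<alpha> < d \<longrightarrow> 0 < \<beta> \<longrightarrow> \<beta> < d \<longrightarrow> t \<alpha> \<beta> < ennreal r" if r: "r > 0" for r
  proof (rule ccontr)
    assume contr: "\<not> ?thesis"
    define I where "I = (LINT z|lebesgue. norm (m z))"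
    have I: "I \<ge> 0" by (simp add: I_def)
    \<comment> \<open>Makes the limit \<open>2 \<epsilon> I\<close> smaller than \<open>r\<close>, also when \<open>I = 0\<close>.\<close>
    define \<epsilon> where "\<epsilon> = r / (4 * (I + 1))"
    have \<epsilon>: "\<epsilon> > 0" "2 * \<epsilon> * I < r"
      using r I add_pos_nonneg[of "r * 4" "I * (r * 2)"] by (simp_all add: \<epsilon>_def field_simps)
    obtain B :: "'n L2 set" and c a where S: "nuclear_bound (\<lambda>x. S x - (\<Sum>b\<in>B. (x \<bullet> c b) *\<^sub>R a b)) \<epsilon>"
      using trace_class_finite_rank_approximation[OF assms(3) \<epsilon>(1)] by blast
    have "\<forall>k. \<exists>p. 0 < fst p \<and> fst p < 1 / real (Suc k) \<and> 0 < snd p \<and> snd p < 1 / real (Suc k) \<and> \<not> t (fst p) (snd p) < ennreal r"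
    proof
      fix k
      have "1 / real (Suc k) > 0" by simp
      with contr obtain \<alpha> \<beta> where "0 < \<alpha>" "\<alpha> < 1 / real (Suc k)" "0 < \<beta>" "\<beta> < 1 / real (Suc k)" "\<not> t \<alpha> \<beta> < ennreal r"
        by blast
      then show "\<exists>p. 0 < fst p \<and> fst p < 1 / real (Suc k) \<and> 0 < snd p \<and> snd p < 1 / real (Suc k) \<and> \<not> t (fst p) (snd p) < ennreal r"
        by (intro exI[of _ "(\<alpha>, \<beta>)"]) simp
    qed
    from choice[OF this] obtain p where p: "\<And>k. 0 < fst (p k)" "\<And>k. fst (p k) < 1 / real (Suc k)"
      "\<And>k. 0 < snd (p k)" "\<And>k. snd (p k) < 1 / real (Suc k)" "\<And>k. \<not> t (fst (p k)) (snd (p k)) < ennreal r"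
      by blast
    have le1: "fst (p k) \<le> 1" "snd (p k) \<le> 1" for k
    proof -
      have "1 / real (Suc k) \<le> 1" by simp
      then show "fst (p k) \<le> 1" "snd (p k) \<le> 1" using p(2,4)[of k] by linarith+
    qed
    have inv: "(\<lambda>k. 1 / real (Suc k)) \<longlonglongrightarrow> 0" by (rule LIMSEQ_Suc[OF lim_1_over_n])
    have lims: "(\<lambda>k. fst (p k)) \<longlonglongrightarrow> 0" "(\<lambda>k. snd (p k)) \<longlonglongrightarrow> 0"
      by (rule tendsto_sandwich[OF _ _ tendsto_const inv]; intro always_eventually allI less_imp_le p)+
    define D where "D k = (LINT z|lebesgue. discretization_error m (max K0 0) c a B \<epsilon> (fst (p k)) (snd (p k)) z)" for k
    have "D \<longlonglongrightarrow> 2 * \<epsilon> * I"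
      unfolding D_def I_def
      using p(1,3) le1 \<epsilon>(1) lims by (intro discretization_error_tendsto[OF m]) auto
    then have "\<forall>\<^sub>F k in sequentially. D k < r" using \<epsilon>(2) by (rule order_tendstoD(2))
    then obtain k where Dk: "D k < r" by (auto simp: eventually_sequentially)
    have "t (fst (p k)) (snd (p k)) \<le> ennreal (D k)"
      unfolding t_def D_def
      by (rule trace_norm_le_nuclear_bound[OF sampling_difference_nuclear_bound[OF m Sb p(1) le1(1) p(3) le1(2) K S]])
        (use \<epsilon>(1) in auto)
    also have "\<dots> < ennreal r" using Dk r by (simp add: ennreal_less_iff ennreal_lessI)
    finally show False using p(5) by blast
  qed
  have "((\<lambda>p. t (fst p) (snd p)) \<longlongrightarrow> 0) (at_right 0 \<times>\<^sub>F at_right 0)"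
  proof (rule order_tendstoI)
    fix x :: ennreal assume "0 < x"
    then obtain y where y: "0 < y" "y < x" using dense by blast
    have "y < top" using y(2) top_greatest[of x] by (rule less_le_trans)
    then have yr: "ennreal (enn2real y) = y" by simp
    define r where "r = enn2real y"
    have r: "r > 0" "ennreal r < x"
      using y \<open>y < top\<close> yr by (simp_all add: r_def enn2real_positive_iff)
    obtain d where d: "d > 0" "\<forall>\<alpha> \<beta>. 0 < \<alpha> \<longrightarrow> \<alpha> < d \<longrightarrow> 0 < \<beta> \<longrightarrow> \<beta> < d \<longrightarrow> t \<alpha> \<beta> < ennreal r" using small[OF r(1)] by blast
    have ev: "\<forall>\<^sub>F \<alpha> in at_right 0. \<alpha> \<in> {0<..<d}" by (rule eventually_at_right_real[OF d(1)])
    show "\<forall>\<^sub>F p in at_right 0 \<times>\<^sub>F at_right 0. t (fst p) (snd p) < x"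
      unfolding eventually_prod_filter
      using ev d(2) r(2) by (intro exI[of _ "\<lambda>\<alpha>. \<alpha> \<in> {0<..<d}"] conjI) (auto intro: less_trans)
  qed simp
  then show ?thesis by (simp only: t_def case_prod_unfold)
qed

end
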